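(* Let $G$ be a countable discrete group acting on $X$ by a boundary action. Denote by $\mathcal{G}$ the groupoid of germs of this action and by $\pi:G\to C^*_{\mathrm{ess}}(\mathcal{G})$ the associated unitary representation. Then $\pi(G)\subseteq C^*_{\mathrm{ess}}(\mathcal{G})$ satisfies the relative Powers averaging property.
   Context: A boundary action of a discrete group $G$ is a continuous action on a compact Hausdorff space $X$ that is minimal and strongly proximal (the weak*-closure of the $G$-orbit of every probability measure on $X$ contains a Dirac measure). The transformation groupoid $G\ltimes X$ is the set $G\times X$ (product topology, unit space $X$) with $s(g,x)=x$, $r(g,x)=gx$, $(g,hx)(h,x)=(gh,x)$. Its isotropy bundle is $\mathrm{Iso}(G\ltimes X)=\{(g,x):gx=x\}$. The groupoid of germs of the action is the étale quotient groupoid $\mathcal{G}=(G\ltimes X)/\mathrm{Iso}(G\ltimes X)^\circ$, where $^\circ$ denotes the interior in $G\ltimes X$; its unit space is $X$, and it need not be Hausdorff. Essential $C^*$-algebra of an étale groupoid $\mathcal{G}$ with compact Hausdorff unit space. An open bisection is an open $U\subseteq\mathcal{G}$ on which $s,r$ are homeomorphisms onto their images. With $\mathcal{G}_x=s^{-1}(x)$, $\mathcal{C}(\mathcal{G})\subseteq\ell^\infty(\mathcal{G})$ is the linear span of the spaces $C_c(U)$ (extended by zero), $U$ open bisections, a $*$-algebra under convolution. $C^*_{\mathrm{red}}(\mathcal{G})$ is its completion with respect to the representations $\lambda_x$ on $\ell^2(\mathcal{G}_x)$, $\lambda_x(f)\delta_g=\sum_{h\in\mathcal{G}_{r(g)}}f(h)\delta_{hg}$.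 $\mathrm{Dix}(X)$ is the algebra of bounded Borel functions on $X$ modulo those vanishing off a meager set. $E_{\mathrm{red}}:C^*_{\mathrm{red}}(\mathcal{G})\to\mathrm{Dix}(\mathcal{G}^{(0)})$ extends $f\mapsto[f|_{\mathcal{G}^{(0)}}]$ continuously, $C^*_{\mathrm{ess}}(\mathcal{G})=C^*_{\mathrm{red}}(\mathcal{G})/\{a:E_{\mathrm{red}}(a^*a)=0\}$, and $E_{\mathrm{ess}}:C^*_{\mathrm{ess}}(\mathcal{G})\to\mathrm{Dix}(\mathcal{G}^{(0)})$ is the induced map. The unitary representation $\pi$ sends $g\in G$ to (the image in $C^*_{\mathrm{ess}}(\mathcal{G})$ of) the indicator function of the global open bisection $\{[g,x]:x\in X\}$ of germs of $g$. "$\pi(G)\subseteq C^*_{\mathrm{ess}}(\mathcal{G})$ satisfies the relative Powers averaging property" means: for every $a\in C^*_{\mathrm{ess}}(\mathcal{G})$ with $E_{\mathrm{ess}}(a)=0$, the element $0$ lies in the norm-closed convex hull of $\{\pi(g)a\pi(g)^*:g\in G\}$. *)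

theory Defs
  imports "HOL-Probability.Probability" "HOL-Algebra.Group_Action"
begin

section \<open>The Hilbert space of square-summable complex functions\<close>

typedef 'a ell2 = "{f :: 'a \<Rightarrow> complex. (\<lambda>i. (cmod (f i))\<^sup>2) summable_on UNIV}"
  by (rule exI[of _ "\<lambda>_. 0"]) simp

setup_lifting type_definition_ell2

lemma ell2_add_summable:
  fixes f g :: "'a \<Rightarrow> complex"
  assumes "(\<lambda>i. (cmod (f i))\<^sup>2) summable_on UNIV" "(\<lambda>i. (cmod (g i))\<^sup>2) summable_on UNIV"
  shows "(\<lambda>i. (cmod (f i + g i))\<^sup>2) summable_on UNIV"
proof (rule summable_on_comparison_test)
  show "(\<lambda>i. 2 * (cmod (f i))\<^sup>2 + 2 * (cmod (g i))\<^sup>2) summable_on UNIV"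
    using assms by (intro summable_on_add summable_on_cmult_right)
  fix i
  have "(cmod (f i + g i))\<^sup>2 \<le> (cmod (f i) + cmod (g i))\<^sup>2"
    by (simp add: norm_triangle_ineq power_mono)
  also have "\<dots> \<le> 2 * (cmod (f i))\<^sup>2 + 2 * (cmod (g i))\<^sup>2"
    using sum_squares_bound[of "cmod (f i)" "cmod (g i)"] by (simp add: power2_sum)
  finally show "(cmod (f i + g i))\<^sup>2 \<le> 2 * (cmod (f i))\<^sup>2 + 2 * (cmod (g i))\<^sup>2" .
qed auto

lemma ell2_scale_summable:
  fixes f :: "'a \<Rightarrow> complex"
  assumes "(\<lambda>i. (cmod (f i))\<^sup>2) summable_on UNIV"
  shows "(\<lambda>i. (cmod (c * f i))\<^sup>2) summable_on UNIV"
  using assms by (simp add: norm_mult power_mult_distrib summable_on_cmult_right)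

lemma ell2_prod_summable:
  fixes f g :: "'a \<Rightarrow> complex"
  assumes "(\<lambda>i. (cmod (f i))\<^sup>2) summable_on UNIV" "(\<lambda>i. (cmod (g i))\<^sup>2) summable_on UNIV"
  shows "(\<lambda>i. f i * cnj (g i)) summable_on UNIV"
proof (rule abs_summable_summable, rule summable_on_comparison_test)
  show "(\<lambda>i. (cmod (f i))\<^sup>2 + (cmod (g i))\<^sup>2) summable_on UNIV"
    using assms by (intro summable_on_add)
  fix i
  have "0 \<le> cmod (f i) * cmod (g i)" by simp
  then show "cmod (f i * cnj (g i)) \<le> (cmod (f i))\<^sup>2 + (cmod (g i))\<^sup>2"
    using sum_squares_bound[of "cmod (f i)" "cmod (g i)"]
    unfolding norm_mult complex_mod_cnj by linarith
qed auto

definition ell2_cinner :: "'a ell2 \<Rightarrow> 'a ell2 \<Rightarrow> complex" where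
  "ell2_cinner \<xi> \<eta> = (\<Sum>\<^sub>\<infinity>i. Rep_ell2 \<xi> i * cnj (Rep_ell2 \<eta> i))"

instantiation ell2 :: (type) real_vector
begin

lift_definition zero_ell2 :: "'a ell2" is "\<lambda>_. 0" by simp
lift_definition plus_ell2 :: "'a ell2 \<Rightarrow> 'a ell2 \<Rightarrow> 'a ell2" is "\<lambda>f g i. f i + g i"
  by (rule ell2_add_summable)
lift_definition uminus_ell2 :: "'a ell2 \<Rightarrow> 'a ell2" is "\<lambda>f i. - f i" by simp
lift_definition minus_ell2 :: "'a ell2 \<Rightarrow> 'a ell2 \<Rightarrow> 'a ell2" is "\<lambda>f g i. f i - g i"
  subgoal for f g using ell2_add_summable[of f "\<lambda>i. - g i"] by simp
  done
lift_definition scaleR_ell2 :: "real \<Rightarrow> 'a ell2 \<Rightarrow> 'a ell2" is "\<lambda>r f i. complex_of_real r * f i"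
  by (rule ell2_scale_summable)

instance
  by (standard; transfer; simp add: fun_eq_iff algebra_simps)

end

instantiation ell2 :: (type) real_inner
begin

definition "inner_ell2 (\<xi> :: 'a ell2) \<eta> = Re (ell2_cinner \<xi> \<eta>)"
definition "norm_ell2 (\<xi> :: 'a ell2) = sqrt (inner \<xi> \<xi>)"
definition "sgn_ell2 (\<xi> :: 'a ell2) = \<xi> /\<^sub>R norm \<xi>"
definition "dist_ell2 (\<xi> :: 'a ell2) \<eta> = norm (\<xi> - \<eta>)"
definition "uniformity_ell2 =
  (INF e\<in>{0<..}. principal {(\<xi>, \<eta>). dist (\<xi> :: 'a ell2) \<eta> < e})"
definition "open_ell2 (U :: 'a ell2 set) =
  (\<forall>\<xi>\<in>U. eventually (\<lambda>(\<xi>', \<eta>). \<xi>' = \<xi> \<longrightarrow> \<eta> \<in> U) uniformity)"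

instance
proof
  fix x y z :: "'a ell2" and r s :: real
  show "sgn x = x /\<^sub>R norm x" by (rule sgn_ell2_def)
  show "dist x y = norm (x - y)" by (rule dist_ell2_def)
  show "uniformity = (INF e\<in>{0<..}. principal {(x, y). dist (x :: 'a ell2) y < e})"
    by (rule uniformity_ell2_def)
  show "open U = (\<forall>x\<in>U. \<forall>\<^sub>F (x', y) in uniformity. x' = x \<longrightarrow> y \<in> U)" for U :: "'a ell2 set"
    by (rule open_ell2_def)
  have sq: "(\<lambda>i. (cmod (Rep_ell2 \<xi> i))\<^sup>2) summable_on UNIV" for \<xi> :: "'a ell2"
    using Rep_ell2[of \<xi>] by simp
  have prod: "(\<lambda>i. Rep_ell2 \<xi> i * cnj (Rep_ell2 \<eta> i)) summable_on UNIV" for \<xi> \<eta> :: "'a ell2"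
    by (rule ell2_prod_summable[OF sq sq])
  have "ell2_cinner y x = cnj (ell2_cinner x y)"
    unfolding ell2_cinner_def infsum_cnj[symmetric] by (simp add: mult.commute)
  then show "inner x y = inner y x" by (simp add: inner_ell2_def)
  have "ell2_cinner (x + y) z = ell2_cinner x z + ell2_cinner y z"
    unfolding ell2_cinner_def plus_ell2.rep_eq distrib_right by (rule infsum_add[OF prod prod])
  then show "inner (x + y) z = inner x z + inner y z" by (simp add: inner_ell2_def)
  have "ell2_cinner (r *\<^sub>R x) y = complex_of_real r * ell2_cinner x y"
    unfolding ell2_cinner_def scaleR_ell2.rep_eq mult.assoc by (rule infsum_cmult_right')
  then show "inner (r *\<^sub>R x) y = r * inner x y" by (simp add: inner_ell2_def)
  have self: "inner x x = (\<Sum>\<^sub>\<infinity>i. (cmod (Rep_ell2 x i))\<^sup>2)"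
    unfolding inner_ell2_def ell2_cinner_def infsum_Re[OF prod, symmetric]
    by (simp add: cmod_power2 flip: power2_eq_square)
  show "0 \<le> inner x x" unfolding self by (rule infsum_nonneg) simp
  show "(inner x x = 0) = (x = 0)"
  proof
    assume "inner x x = 0"
    then have "(cmod (Rep_ell2 x i))\<^sup>2 = 0" for i
      using nonneg_infsum_le_0D[OF _ sq[of x]] unfolding self by simp
    then show "x = 0" by transfer (auto simp: fun_eq_iff)
  next
    assume "x = 0"
    then show "inner x x = 0" unfolding self by (simp add: zero_ell2.rep_eq)
  qed
  show "norm x = sqrt (inner x x)" by (rule norm_ell2_def)
qed

end

text \<open>The complex Hilbert space adjoint. The operators it is applied to are bounded and
  complex-linear, although the type records only real linearity.\<close>

definition ell2_adj :: "('a ell2 \<Rightarrow>\<^sub>L 'a ell2) \<Rightarrow> 'a ell2 \<Rightarrow>\<^sub>L 'a ell2" where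
  "ell2_adj T = (THE S. \<forall>\<xi> \<eta>. ell2_cinner (blinfun_apply T \<xi>) \<eta> = ell2_cinner \<xi> (blinfun_apply S \<eta>))"


section \<open>Boundary actions\<close>

text \<open>Since the compact Hausdorff space need not be metrizable, probability measures are taken to
  be regular, as is needed for them to be the states on the continuous functions.\<close>

definition regular_probs :: "'x::t2_space measure set" where
  "regular_probs = {\<mu>. sets \<mu> = sets borel \<and> prob_space \<mu> \<and>
     (\<forall>A\<in>sets borel. emeasure \<mu> A = (SUP K\<in>{K. compact K \<and> K \<subseteq> A}. emeasure \<mu> K))}"

definition weak_star_topology :: "'x::t2_space measure topology" where
  "weak_star_topology =
     (let C = {f :: 'x \<Rightarrow> complex. continuous_on UNIV f}
      in pullback_topology regular_probs (\<lambda>\<mu>. \<lambda>f\<in>C. integral\<^sup>L \<mu> f)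
           (product_topology (\<lambda>_. euclidean) C))"

definition minimal_action ::
  "('g, 'm) monoid_scheme \<Rightarrow> ('g \<Rightarrow> 'x::t2_space \<Rightarrow> 'x) \<Rightarrow> bool" where
  "minimal_action G \<phi> \<longleftrightarrow> (\<forall>x. closure (orbit G \<phi> x) = UNIV)"

definition strongly_proximal ::
  "('g, 'm) monoid_scheme \<Rightarrow> ('g \<Rightarrow> 'x::t2_space \<Rightarrow> 'x) \<Rightarrow> bool" where
  "strongly_proximal G \<phi> \<longleftrightarrow>
     (\<forall>\<mu>\<in>regular_probs. \<exists>x. return borel x \<in>
        weak_star_topology closure_of ((\<lambda>g. distr \<mu> borel (\<phi> g)) ` carrier G))"

definition boundary_action ::
  "('g, 'm) monoid_scheme \<Rightarrow> ('g \<Rightarrow> 'x::t2_space \<Rightarrow> 'x) \<Rightarrow> bool" where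
  "boundary_action G \<phi> \<longleftrightarrow>
     compact (UNIV :: 'x set) \<and> group_action G UNIV \<phi> \<and>
     (\<forall>g\<in>carrier G. continuous_on UNIV (\<phi> g)) \<and>
     minimal_action G \<phi> \<and> strongly_proximal G \<phi>"


section \<open>The groupoid of germs\<close>

definition trans_topology :: "('g, 'm) monoid_scheme \<Rightarrow> ('g \<times> 'x::t2_space) topology" where
  "trans_topology G = prod_topology (discrete_topology (carrier G)) euclidean"

definition isotropy ::
  "('g, 'm) monoid_scheme \<Rightarrow> ('g \<Rightarrow> 'x::t2_space \<Rightarrow> 'x) \<Rightarrow> ('g \<times> 'x) set" where
  "isotropy G \<phi> = {(g, x). g \<in> carrier G \<and> \<phi> g x = x}"

definition germ_rel ::
  "('g, 'm) monoid_scheme \<Rightarrow> ('g \<Rightarrow> 'x::t2_space \<Rightarrow> 'x) \<Rightarrow> (('g \<times> 'x) \<times> ('g \<times> 'x)) set" where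
  "germ_rel G \<phi> = {((g, x), (h, y)). g \<in> carrier G \<and> h \<in> carrier G \<and> x = y \<and>
     (inv\<^bsub>G\<^esub> h \<otimes>\<^bsub>G\<^esub> g, x) \<in> trans_topology G interior_of isotropy G \<phi>}"

definition germs ::
  "('g, 'm) monoid_scheme \<Rightarrow> ('g \<Rightarrow> 'x::t2_space \<Rightarrow> 'x) \<Rightarrow> ('g \<times> 'x) set set" where
  "germs G \<phi> = (carrier G \<times> UNIV) // germ_rel G \<phi>"

definition germ ::
  "('g, 'm) monoid_scheme \<Rightarrow> ('g \<Rightarrow> 'x::t2_space \<Rightarrow> 'x) \<Rightarrow> 'g \<Rightarrow> 'x \<Rightarrow> ('g \<times> 'x) set" where
  "germ G \<phi> g x = germ_rel G \<phi> `` {(g, x)}"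

definition germ_topology ::
  "('g, 'm) monoid_scheme \<Rightarrow> ('g \<Rightarrow> 'x::t2_space \<Rightarrow> 'x) \<Rightarrow> ('g \<times> 'x) set topology" where
  "germ_topology G \<phi> = topology (\<lambda>U. U \<subseteq> germs G \<phi> \<and>
     openin (trans_topology G) {(g, x). g \<in> carrier G \<and> germ G \<phi> g x \<in> U})"

definition germ_src :: "('g \<times> 'x) set \<Rightarrow> 'x" where
  "germ_src \<gamma> = the_elem (snd ` \<gamma>)"

definition germ_rng :: "('g \<Rightarrow> 'x \<Rightarrow> 'x) \<Rightarrow> ('g \<times> 'x) set \<Rightarrow> 'x" where
  "germ_rng \<phi> \<gamma> = the_elem ((\<lambda>(g, x). \<phi> g x) ` \<gamma>)"

definition germ_mult ::
  "('g, 'm) monoid_scheme \<Rightarrow> ('g \<Rightarrow> 'x \<Rightarrow> 'x) \<Rightarrow> ('g \<times> 'x) set \<Rightarrow> ('g \<times> 'x) set \<Rightarrow> ('g \<times> 'x) set" where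
  "germ_mult G \<phi> \<gamma> \<delta> = {(g \<otimes>\<^bsub>G\<^esub> h, x) | g h x. (g, \<phi> h x) \<in> \<gamma> \<and> (h, x) \<in> \<delta>}"


lemma trans_topology_topspace: "topspace (trans_topology G) = carrier G \<times> UNIV"
  by (simp add: trans_topology_def)

lemma openin_germ_topology:
  "openin (germ_topology G \<phi>) U \<longleftrightarrow> U \<subseteq> germs G \<phi> \<and>
     openin (trans_topology G) {(g, x). g \<in> carrier G \<and> germ G \<phi> g x \<in> U}"
proof -
  let ?P = "\<lambda>U. {(g, x). g \<in> carrier G \<and> germ G \<phi> g x \<in> U}"
  have "?P (S \<inter> T) = ?P S \<inter> ?P T" "?P (\<Union>K) = (\<Union>S\<in>K. ?P S)" for S T K
    by auto
  then have "istopology (\<lambda>U. U \<subseteq> germs G \<phi> \<and> openin (trans_topology G) (?P U))"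
    by (auto simp: istopology_def simp del: split_paired_All)
  then show ?thesis
    by (simp add: germ_topology_def)
qed

text \<open>Two pairs have the same germ iff the group elements agree near the common source.\<close>

lemma germ_rel_iff:
  assumes "group_action G UNIV \<phi>"
  shows "((g, x), (h, y)) \<in> germ_rel G \<phi> \<longleftrightarrow> g \<in> carrier G \<and> h \<in> carrier G \<and> x = y \<and>
    (\<exists>V. open V \<and> x \<in> V \<and> (\<forall>z\<in>V. \<phi> g z = \<phi> h z))"
proof -
  interpret group_action G UNIV \<phi> by fact
  interpret group G using group_hom by (simp add: group_hom_def)
  have iso: "\<phi> (inv\<^bsub>G\<^esub> h \<otimes>\<^bsub>G\<^esub> g) z = z \<longleftrightarrow> \<phi> g z = \<phi> h z"
    if "g \<in> carrier G" "h \<in> carrier G" for z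
  proof -
    have "\<phi> (inv\<^bsub>G\<^esub> h \<otimes>\<^bsub>G\<^esub> g) z = \<phi> (inv\<^bsub>G\<^esub> h) (\<phi> g z)"
      using that by (simp add: composition_rule)
    moreover have "\<phi> (inv\<^bsub>G\<^esub> h) (\<phi> h z) = z"
      by (rule orbit_sym_aux[OF that(2) UNIV_I refl])
    moreover have "\<phi> h z = \<phi> g z" if "\<phi> (inv\<^bsub>G\<^esub> h) (\<phi> g z) = z"
      using orbit_sym_aux[OF inv_closed[OF \<open>h \<in> carrier G\<close>] UNIV_I that]
      unfolding inv_inv[OF \<open>h \<in> carrier G\<close>] .
    ultimately show ?thesis by argo
  qed
  have int: "(k, x) \<in> trans_topology G interior_of isotropy G \<phi> \<longleftrightarrow>
      k \<in> carrier G \<and> (\<exists>V. open V \<and> x \<in> V \<and> (\<forall>z\<in>V. \<phi> k z = z))" for k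
  proof
    assume "(k, x) \<in> trans_topology G interior_of isotropy G \<phi>"
    then obtain T where T: "openin (trans_topology G) T" "(k, x) \<in> T" "T \<subseteq> isotropy G \<phi>"
      unfolding interior_of_def by auto
    then obtain A V where V: "openin euclidean V" "k \<in> A" "x \<in> V" "A \<times> V \<subseteq> T"
      using T(1)[unfolded trans_topology_def openin_prod_topology_alt, rule_format, OF T(2)]
      by (elim exE conjE)
    have "k \<in> carrier G" using T(2,3) unfolding isotropy_def by blast
    moreover have "\<phi> k z = z" if "z \<in> V" for z
      using that V(2,4) T(3) unfolding isotropy_def by blast
    ultimately show "k \<in> carrier G \<and> (\<exists>V. open V \<and> x \<in> V \<and> (\<forall>z\<in>V. \<phi> k z = z))"
      using V(1,3) open_openin by blast
  next
    assume "k \<in> carrier G \<and> (\<exists>V. open V \<and> x \<in> V \<and> (\<forall>z\<in>V. \<phi> k z = z))"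
    then obtain V where V: "k \<in> carrier G" "open V" "x \<in> V" "\<forall>z\<in>V. \<phi> k z = z" by blast
    then have "openin (trans_topology G) ({k} \<times> V)"
      by (simp add: trans_topology_def openin_prod_Times_iff)
    moreover have "{k} \<times> V \<subseteq> isotropy G \<phi>" using V by (auto simp: isotropy_def)
    ultimately show "(k, x) \<in> trans_topology G interior_of isotropy G \<phi>"
      using V(3) unfolding interior_of_def by auto
  qed
  show ?thesis
  proof (cases "g \<in> carrier G \<and> h \<in> carrier G \<and> x = y")
    case True
    then have "inv\<^bsub>G\<^esub> h \<otimes>\<^bsub>G\<^esub> g \<in> carrier G" by simp
    then show ?thesis
      unfolding germ_rel_def mem_Collect_eq prod.case int using True by (simp only: iso simp_thms)
  qed (auto simp: germ_rel_def)
qed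

lemma germ_rel_equiv:
  assumes "group_action G UNIV \<phi>"
  shows "equiv (carrier G \<times> UNIV) (germ_rel G \<phi>)"
proof (rule equivI)
  show "germ_rel G \<phi> \<subseteq> (carrier G \<times> UNIV) \<times> (carrier G \<times> UNIV)"
    by (auto simp: germ_rel_def)
  show "refl_on (carrier G \<times> UNIV) (germ_rel G \<phi>)"
    by (auto simp: refl_on_def germ_rel_iff[OF assms] intro!: exI[of _ UNIV])
  show "sym (germ_rel G \<phi>)"
    unfolding sym_def by (auto simp: germ_rel_iff[OF assms])
  show "trans (germ_rel G \<phi>)"
  proof (rule transI, clarify)
    fix g x h y k z
    assume 1: "((g, x), (h, y)) \<in> germ_rel G \<phi>" and 2: "((h, y), (k, z)) \<in> germ_rel G \<phi>"
    obtain V where V: "open V" "x \<in> V" "\<forall>z\<in>V. \<phi> g z = \<phi> h z"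
      using 1 unfolding germ_rel_iff[OF assms] by blast
    obtain W where W: "open W" "x \<in> W" "\<forall>z\<in>W. \<phi> h z = \<phi> k z"
      using 1 2 unfolding germ_rel_iff[OF assms] by blast
    have "open (V \<inter> W) \<and> x \<in> V \<inter> W \<and> (\<forall>z\<in>V \<inter> W. \<phi> g z = \<phi> k z)"
      using V W by auto
    then show "((g, x), (k, z)) \<in> germ_rel G \<phi>"
      using 1 2 unfolding germ_rel_iff[OF assms] by blast
  qed
qed

lemma mem_germ_iff:
  assumes "group_action G UNIV \<phi>"
  shows "(h, y) \<in> germ G \<phi> g x \<longleftrightarrow> g \<in> carrier G \<and> h \<in> carrier G \<and> x = y \<and>
    (\<exists>V. open V \<and> x \<in> V \<and> (\<forall>z\<in>V. \<phi> g z = \<phi> h z))"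
  unfolding germ_def by (simp add: germ_rel_iff[OF assms])

lemma mem_germ_self:
  assumes "group_action G UNIV \<phi>" "g \<in> carrier G"
  shows "(g, x) \<in> germ G \<phi> g x"
  using assms by (auto simp: mem_germ_iff)

lemma germ_src_germ:
  assumes "group_action G UNIV \<phi>" "g \<in> carrier G"
  shows "germ_src (germ G \<phi> g x) = x"
proof -
  have "snd ` germ G \<phi> g x = {x}"
  proof (intro subset_antisym subsetI)
    show "y \<in> {x}" if "y \<in> snd ` germ G \<phi> g x" for y
      using that by (auto simp: mem_germ_iff[OF assms(1)])
    show "y \<in> snd ` germ G \<phi> g x" if "y \<in> {x}" for y
      using that mem_germ_self[OF assms, of x] by (auto intro: rev_image_eqI)
  qed
  then show ?thesis by (simp add: germ_src_def)
qed

lemma germ_rng_germ: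
  assumes "group_action G UNIV \<phi>" "g \<in> carrier G"
  shows "germ_rng \<phi> (germ G \<phi> g x) = \<phi> g x"
proof -
  have "(\<lambda>(g, x). \<phi> g x) ` germ G \<phi> g x = {\<phi> g x}"
  proof (intro subset_antisym subsetI)
    show "y \<in> {\<phi> g x}" if "y \<in> (\<lambda>(g, x). \<phi> g x) ` germ G \<phi> g x" for y
      using that by (auto simp: mem_germ_iff[OF assms(1)])
    show "y \<in> (\<lambda>(g, x). \<phi> g x) ` germ G \<phi> g x" if "y \<in> {\<phi> g x}" for y
      using that mem_germ_self[OF assms, of x] by (auto intro: rev_image_eqI)
  qed
  then show ?thesis by (simp add: germ_rng_def)
qed

lemma germ_mult_germ:
  assumes "group_action G UNIV \<phi>" "\<forall>g\<in>carrier G. continuous_on UNIV (\<phi> g)"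
    and gh: "g \<in> carrier G" "h \<in> carrier G"
  shows "germ_mult G \<phi> (germ G \<phi> g (\<phi> h x)) (germ G \<phi> h x) = germ G \<phi> (g \<otimes>\<^bsub>G\<^esub> h) x"
proof -
  interpret group_action G UNIV \<phi> by fact
  interpret group G using group_hom by (simp add: group_hom_def)
  note mem = mem_germ_iff[OF assms(1)]
  have comp: "\<phi> (a \<otimes>\<^bsub>G\<^esub> b) z = \<phi> a (\<phi> b z)" if "a \<in> carrier G" "b \<in> carrier G" for a b z
    using that by (simp add: composition_rule)
  show ?thesis
  proof (intro subset_antisym subsetI; clarify)
    fix k y assume "(k, y) \<in> germ_mult G \<phi> (germ G \<phi> g (\<phi> h x)) (germ G \<phi> h x)"
    then obtain a b where k: "k = a \<otimes>\<^bsub>G\<^esub> b" and a: "(a, \<phi> b y) \<in> germ G \<phi> g (\<phi> h x)"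
      and b: "(b, y) \<in> germ G \<phi> h x"
      unfolding germ_mult_def by blast
    obtain V where V: "open V" "\<phi> h x \<in> V" "\<forall>z\<in>V. \<phi> g z = \<phi> a z" using a unfolding mem by blast
    obtain W where W: "open W" "x \<in> W" "\<forall>z\<in>W. \<phi> h z = \<phi> b z" using b unfolding mem by blast
    have ab: "a \<in> carrier G" "b \<in> carrier G" "x = y" using a b unfolding mem by blast+
    have "open (\<phi> h -` V)" using assms(2) gh V(1) by (auto intro: open_vimage)
    then have "open (\<phi> h -` V \<inter> W) \<and> x \<in> \<phi> h -` V \<inter> W \<and>
        (\<forall>z\<in>\<phi> h -` V \<inter> W. \<phi> (g \<otimes>\<^bsub>G\<^esub> h) z = \<phi> k z)"
      using V W ab gh k by (auto simp: comp)
    moreover have "g \<otimes>\<^bsub>G\<^esub> h \<in> carrier G" "k \<in> carrier G" using gh ab k by auto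
    ultimately show "(k, y) \<in> germ G \<phi> (g \<otimes>\<^bsub>G\<^esub> h) x"
      unfolding mem using ab(3) by blast
  next
    fix k y assume ky: "(k, y) \<in> germ G \<phi> (g \<otimes>\<^bsub>G\<^esub> h) x"
    then obtain V where V: "open V" "x \<in> V" "\<forall>z\<in>V. \<phi> (g \<otimes>\<^bsub>G\<^esub> h) z = \<phi> k z" unfolding mem by blast
    have k: "k \<in> carrier G" "x = y" using ky unfolding mem by blast+
    let ?a = "k \<otimes>\<^bsub>G\<^esub> inv\<^bsub>G\<^esub> h"
    have inv: "\<phi> (inv\<^bsub>G\<^esub> h) (\<phi> h z) = z" "\<phi> h (\<phi> (inv\<^bsub>G\<^esub> h) z) = z" for z
      using orbit_sym_aux[OF gh(2) UNIV_I refl] orbit_sym_aux[OF inv_closed[OF gh(2)] UNIV_I refl] gh(2)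
      by simp_all
    have "open (\<phi> (inv\<^bsub>G\<^esub> h) -` V)" using assms(2) gh V(1) by (auto intro: open_vimage)
    moreover have "\<phi> g z = \<phi> ?a z" if "z \<in> \<phi> (inv\<^bsub>G\<^esub> h) -` V" for z
    proof -
      have "\<phi> (g \<otimes>\<^bsub>G\<^esub> h) (\<phi> (inv\<^bsub>G\<^esub> h) z) = \<phi> k (\<phi> (inv\<^bsub>G\<^esub> h) z)" using that V(3) by auto
      then show ?thesis using gh k(1) by (simp add: comp inv)
    qed
    ultimately have "(?a, \<phi> h y) \<in> germ G \<phi> g (\<phi> h x)"
      unfolding mem using gh k V(2) by (auto simp: inv intro!: exI[of _ "\<phi> (inv\<^bsub>G\<^esub> h) -` V"])
    moreover have "(h, y) \<in> germ G \<phi> h x" using mem_germ_self[OF assms(1) gh(2)] k(2) by simp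
    moreover have "k = ?a \<otimes>\<^bsub>G\<^esub> h" using gh k by (simp add: m_assoc)
    ultimately show "(k, y) \<in> germ_mult G \<phi> (germ G \<phi> g (\<phi> h x)) (germ G \<phi> h x)"
      unfolding germ_mult_def by blast
  qed
qed


section \<open>The reduced algebra\<close>

type_synonym ('g, 'x) germ_op = "('g \<times> 'x) set ell2 \<Rightarrow>\<^sub>L ('g \<times> 'x) set ell2"

definition open_bisection ::
  "('g, 'm) monoid_scheme \<Rightarrow> ('g \<Rightarrow> 'x::t2_space \<Rightarrow> 'x) \<Rightarrow> ('g \<times> 'x) set set \<Rightarrow> bool" where
  "open_bisection G \<phi> U \<longleftrightarrow> openin (germ_topology G \<phi>) U \<and>
     homeomorphic_map (subtopology (germ_topology G \<phi>) U) (top_of_set (germ_src ` U)) germ_src \<and>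
     homeomorphic_map (subtopology (germ_topology G \<phi>) U) (top_of_set (germ_rng \<phi> ` U)) (germ_rng \<phi>)"

definition Cc ::
  "('g, 'm) monoid_scheme \<Rightarrow> ('g \<Rightarrow> 'x::t2_space \<Rightarrow> 'x) \<Rightarrow> ('g \<times> 'x) set set \<Rightarrow>
     (('g \<times> 'x) set \<Rightarrow> complex) set" where
  "Cc G \<phi> U = {f. continuous_map (subtopology (germ_topology G \<phi>) U) euclidean f \<and>
     (\<exists>K. K \<subseteq> U \<and> compactin (germ_topology G \<phi>) K \<and> (\<forall>\<gamma>. \<gamma> \<notin> K \<longrightarrow> f \<gamma> = 0))}"

definition conv_alg ::
  "('g, 'm) monoid_scheme \<Rightarrow> ('g \<Rightarrow> 'x::t2_space \<Rightarrow> 'x) \<Rightarrow> (('g \<times> 'x) set \<Rightarrow> complex) set" where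
  "conv_alg G \<phi> = {(\<lambda>\<gamma>. \<Sum>i<n. c i * f i \<gamma>) | (n :: nat) c f.
     \<forall>i<n. \<exists>U. open_bisection G \<phi> U \<and> f i \<in> Cc G \<phi> U}"

definition germ_conv ::
  "('g, 'm) monoid_scheme \<Rightarrow> ('g \<Rightarrow> 'x::t2_space \<Rightarrow> 'x) \<Rightarrow> (('g \<times> 'x) set \<Rightarrow> complex) \<Rightarrow>
     (('g \<times> 'x) set \<Rightarrow> complex) \<Rightarrow> ('g \<times> 'x) set \<Rightarrow> complex" where
  "germ_conv G \<phi> f \<xi> \<gamma> =
     (\<Sum>\<^sub>\<infinity>(\<eta>, \<delta>)\<in>{(\<eta>, \<delta>). \<eta> \<in> germs G \<phi> \<and> \<delta> \<in> germs G \<phi> \<and>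
        germ_src \<eta> = germ_rng \<phi> \<delta> \<and> germ_mult G \<phi> \<eta> \<delta> = \<gamma>}. f \<eta> * \<xi> \<delta>)"

text \<open>This is the direct sum of the representations \<open>\<lambda>\<^sub>x\<close>: the set of germs is the disjoint union of
  the source fibres, so the sum of the spaces \<open>\<ell>\<^sup>2(\<G>\<^sub>x)\<close> is \<open>\<ell>\<^sup>2(\<G>)\<close>, and left convolution by \<open>f\<close>
  sends the basis vector at \<open>\<delta>\<close> to the sum of \<open>f \<eta>\<close> times the basis vector at \<open>\<eta>\<delta>\<close>.
  Indices that are not germs span a summand on which all these operators vanish. The completion is
  thus the norm closure of the image in the bounded operators.\<close>

definition lreg ::
  "('g, 'm) monoid_scheme \<Rightarrow> ('g \<Rightarrow> 'x::t2_space \<Rightarrow> 'x) \<Rightarrow> (('g \<times> 'x) set \<Rightarrow> complex) \<Rightarrow>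
     ('g, 'x) germ_op" where
  "lreg G \<phi> f = Blinfun (\<lambda>\<xi>. Abs_ell2 (germ_conv G \<phi> f (Rep_ell2 \<xi>)))"

definition Cred ::
  "('g, 'm) monoid_scheme \<Rightarrow> ('g \<Rightarrow> 'x::t2_space \<Rightarrow> 'x) \<Rightarrow>
     ('g, 'x) germ_op set" where
  "Cred G \<phi> = closure (lreg G \<phi> ` conv_alg G \<phi>)"


section \<open>The Dixmier algebra and the conditional expectation\<close>

definition meager :: "'x::topological_space set \<Rightarrow> bool" where
  "meager S \<longleftrightarrow> (\<exists>N :: nat \<Rightarrow> 'x set. (\<forall>n. interior (closure (N n)) = {}) \<and> S \<subseteq> (\<Union>n. N n))"

definition bounded_borel :: "('x::topological_space \<Rightarrow> complex) set" where
  "bounded_borel = {f \<in> borel_measurable borel. bounded (range f)}"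

definition dix_rel :: "(('x::topological_space \<Rightarrow> complex) \<times> ('x \<Rightarrow> complex)) set" where
  "dix_rel = {(f, g). f \<in> bounded_borel \<and> g \<in> bounded_borel \<and> meager {x. f x - g x \<noteq> 0}}"

definition dix_class :: "('x::topological_space \<Rightarrow> complex) \<Rightarrow> ('x \<Rightarrow> complex) set" where
  "dix_class f = dix_rel `` {f}"

definition Dix :: "('x::topological_space \<Rightarrow> complex) set set" where
  "Dix = bounded_borel // dix_rel"

text \<open>The distance induced by the quotient of the supremum norm.\<close>

definition dix_dist ::
  "('x::topological_space \<Rightarrow> complex) set \<Rightarrow> ('x \<Rightarrow> complex) set \<Rightarrow> real" where
  "dix_dist D D' = (INF (d, d')\<in>D \<times> D'. SUP x. cmod (d x - d' x))"

definition unit_restrict ::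
  "('g, 'm) monoid_scheme \<Rightarrow> ('g \<Rightarrow> 'x::t2_space \<Rightarrow> 'x) \<Rightarrow> (('g \<times> 'x) set \<Rightarrow> complex) \<Rightarrow> 'x \<Rightarrow> complex"
  where "unit_restrict G \<phi> f x = f (germ G \<phi> \<one>\<^bsub>G\<^esub> x)"

text \<open>The continuous extension of \<open>f \<mapsto> [f|\<^sub>X]\<close>, as a limit along approximating sequences.\<close>

definition E_red ::
  "('g, 'm) monoid_scheme \<Rightarrow> ('g \<Rightarrow> 'x::t2_space \<Rightarrow> 'x) \<Rightarrow>
     ('g, 'x) germ_op \<Rightarrow> ('x \<Rightarrow> complex) set" where
  "E_red G \<phi> a = (THE D. D \<in> Dix \<and>
     (\<forall>f. range f \<subseteq> conv_alg G \<phi> \<longrightarrow> (\<lambda>n. lreg G \<phi> (f n)) \<longlonglongrightarrow> a \<longrightarrow>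
        (\<lambda>n :: nat. dix_dist (dix_class (unit_restrict G \<phi> (f n))) D) \<longlonglongrightarrow> 0))"


section \<open>The essential algebra\<close>

definition ess_ideal ::
  "('g, 'm) monoid_scheme \<Rightarrow> ('g \<Rightarrow> 'x::t2_space \<Rightarrow> 'x) \<Rightarrow>
     ('g, 'x) germ_op set" where
  "ess_ideal G \<phi> = {a \<in> Cred G \<phi>. E_red G \<phi> (ell2_adj a o\<^sub>L a) = dix_class (\<lambda>_. 0)}"

text \<open>Elements of the quotient are cosets of the ideal; the operations on cosets are the
  cosets of the corresponding operations on representatives, and the norm is the quotient norm.\<close>

definition ess_coset ::
  "('g, 'm) monoid_scheme \<Rightarrow> ('g \<Rightarrow> 'x::t2_space \<Rightarrow> 'x) \<Rightarrow>
     ('g, 'x) germ_op \<Rightarrow>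
     ('g, 'x) germ_op set" where
  "ess_coset G \<phi> a = (\<lambda>n. a + n) ` ess_ideal G \<phi>"

definition Cess ::
  "('g, 'm) monoid_scheme \<Rightarrow> ('g \<Rightarrow> 'x::t2_space \<Rightarrow> 'x) \<Rightarrow>
     ('g, 'x) germ_op set set" where
  "Cess G \<phi> = ess_coset G \<phi> ` Cred G \<phi>"

definition ess_add ::
  "('g, 'm) monoid_scheme \<Rightarrow> ('g \<Rightarrow> 'x::t2_space \<Rightarrow> 'x) \<Rightarrow>
     ('g, 'x) germ_op set \<Rightarrow>
     ('g, 'x) germ_op set \<Rightarrow>
     ('g, 'x) germ_op set" where
  "ess_add G \<phi> A B = (\<Union>a\<in>A. \<Union>b\<in>B. ess_coset G \<phi> (a + b))"

definition ess_scaleR ::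
  "('g, 'm) monoid_scheme \<Rightarrow> ('g \<Rightarrow> 'x::t2_space \<Rightarrow> 'x) \<Rightarrow> real \<Rightarrow>
     ('g, 'x) germ_op set \<Rightarrow>
     ('g, 'x) germ_op set" where
  "ess_scaleR G \<phi> t A = (\<Union>a\<in>A. ess_coset G \<phi> (t *\<^sub>R a))"

definition ess_mult ::
  "('g, 'm) monoid_scheme \<Rightarrow> ('g \<Rightarrow> 'x::t2_space \<Rightarrow> 'x) \<Rightarrow>
     ('g, 'x) germ_op set \<Rightarrow>
     ('g, 'x) germ_op set \<Rightarrow>
     ('g, 'x) germ_op set" where
  "ess_mult G \<phi> A B = (\<Union>a\<in>A. \<Union>b\<in>B. ess_coset G \<phi> (a o\<^sub>L b))"

definition ess_adj ::
  "('g, 'm) monoid_scheme \<Rightarrow> ('g \<Rightarrow> 'x::t2_space \<Rightarrow> 'x) \<Rightarrow>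
     ('g, 'x) germ_op set \<Rightarrow>
     ('g, 'x) germ_op set" where
  "ess_adj G \<phi> A = (\<Union>a\<in>A. ess_coset G \<phi> (ell2_adj a))"

definition ess_norm :: "('a ell2 \<Rightarrow>\<^sub>L 'a ell2) set \<Rightarrow> real" where
  "ess_norm A = (INF a\<in>A. norm a)"

definition E_ess ::
  "('g, 'm) monoid_scheme \<Rightarrow> ('g \<Rightarrow> 'x::t2_space \<Rightarrow> 'x) \<Rightarrow>
     ('g, 'x) germ_op set \<Rightarrow> ('x \<Rightarrow> complex) set" where
  "E_ess G \<phi> A = the_elem (E_red G \<phi> ` A)"

definition ess_convex ::
  "('g, 'm) monoid_scheme \<Rightarrow> ('g \<Rightarrow> 'x::t2_space \<Rightarrow> 'x) \<Rightarrow>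
     ('g, 'x) germ_op set set \<Rightarrow> bool" where
  "ess_convex G \<phi> S \<longleftrightarrow> S \<subseteq> Cess G \<phi> \<and>
     (\<forall>A\<in>S. \<forall>B\<in>S. \<forall>u\<ge>0. \<forall>v\<ge>0. u + v = 1 \<longrightarrow>
        ess_add G \<phi> (ess_scaleR G \<phi> u A) (ess_scaleR G \<phi> v B) \<in> S)"

definition ess_closure ::
  "('g, 'm) monoid_scheme \<Rightarrow> ('g \<Rightarrow> 'x::t2_space \<Rightarrow> 'x) \<Rightarrow>
     ('g, 'x) germ_op set set \<Rightarrow>
     ('g, 'x) germ_op set set" where
  "ess_closure G \<phi> S = {A \<in> Cess G \<phi>. \<forall>e>0. \<exists>B\<in>S.
     ess_norm (ess_add G \<phi> B (ess_scaleR G \<phi> (- 1) A)) < e}"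

definition ess_rep ::
  "('g, 'm) monoid_scheme \<Rightarrow> ('g \<Rightarrow> 'x::t2_space \<Rightarrow> 'x) \<Rightarrow> 'g \<Rightarrow>
     ('g, 'x) germ_op set" where
  "ess_rep G \<phi> g = ess_coset G \<phi> (lreg G \<phi> (indicator (range (germ G \<phi> g))))"

definition relative_powers_averaging ::
  "('g, 'm) monoid_scheme \<Rightarrow> ('g \<Rightarrow> 'x::t2_space \<Rightarrow> 'x) \<Rightarrow> bool" where
  "relative_powers_averaging G \<phi> \<longleftrightarrow>
     (\<forall>A\<in>Cess G \<phi>. E_ess G \<phi> A = dix_class (\<lambda>_. 0) \<longrightarrow>
        ess_coset G \<phi> 0 \<in> ess_closure G \<phi> (ess_convex G \<phi> hull
          {ess_mult G \<phi> (ess_mult G \<phi> (ess_rep G \<phi> g) A) (ess_adj G \<phi> (ess_rep G \<phi> g)) | g.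
             g \<in> carrier G}))"

end

(* For f = sum_i h_i u_{s_i} in the convolution algebra, Baire category gives a point, off the meager
   set where the diagonal of f fails to be small, near which every s_i is either the identity or
   moves a neighbourhood V off itself. Compressed to the germs with range in V, f is then
   multiplication by its small diagonal. It remains to find g_j in G and weights t_j such that
   sum_j t_j 1[g_j x not in V] is uniformly small in x, since then sum_j t_j u_{g_j}^* f u_{g_j} has
   small norm by Cauchy-Schwarz. If there were no such average, Hahn-Banach would give a finitely
   additive probability m with m(g^{-1}(X - V)) bounded below for all g; regularizing m to a Borel
   measure contradicts strong proximality and minimality. This already makes the averages small in
   the norm of the reduced algebra, so the norm of the quotient is only ever bounded above. *)

theory Submission
  imports Defs
begin

text \<open>Smallness must be uniform in the point, because the regular representation on the germs
  contains the representations at all points of X at once; control along one measure would not bound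
  its norm. The minimax step runs over all bounded functions because the sets of points carried
  outside V have no continuous indicator. The price is mere finite additivity. It is affordable:
  these sets are closed, and passing to the regular Borel measure can only raise the mass of a
  closed set, which preserves the lower bound. On the groupoid side the germs need not be separated,
  so the diagonal of an element is only a Borel function and is known only off a meager set.
  Frontiers of the fixed-point sets of finitely many group elements are nowhere dense and can be
  avoided together with that set. Countability of G keeps a union of translates of a meager set
  meager; this is what makes the ideal, defined by the columns at the units alone, stable under
  adjoints and under multiplication from both sides.\<close>

section \<open>Uniform averaging for boundary actions\<close>

definition sublinear :: "('v::real_vector \<Rightarrow> real) \<Rightarrow> bool" where
  "sublinear p \<longleftrightarrow> (\<forall>x y. p (x + y) \<le> p x + p y) \<and> (\<forall>t\<ge>0. \<forall>x. p (t *\<^sub>R x) = t * p x)"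

lemma sublinear_add: "sublinear p \<Longrightarrow> p (x + y) \<le> p x + p y"
  and sublinear_scale: "sublinear p \<Longrightarrow> t \<ge> 0 \<Longrightarrow> p (t *\<^sub>R x) = t * p x"
  by (auto simp: sublinear_def)

lemma sublinear_zero: "sublinear p \<Longrightarrow> p 0 = 0"
  using sublinear_scale[of p 0 0] by simp

lemma sublinear_minus_le: "sublinear p \<Longrightarrow> - p (- x) \<le> p x"
  using sublinear_add[of p x "- x"] sublinear_zero[of p] by simp

text \<open>The infimum is finite because \<open>- p (- x)\<close> bounds every member from below.
  For subadditivity, two members taken at different arguments are replaced by the smaller of the
  two, which exists in a chain.\<close>

lemma sublinear_chain_Inf:
  fixes C :: "('v::real_vector \<Rightarrow> real) set"
  assumes ne: "C \<noteq> {}" and sub: "\<And>q. q \<in> C \<Longrightarrow> sublinear q"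
    and chain: "\<And>q r. q \<in> C \<Longrightarrow> r \<in> C \<Longrightarrow> q \<le> r \<or> r \<le> q"
    and bound: "\<And>q. q \<in> C \<Longrightarrow> q \<le> p"
  shows "sublinear (\<lambda>x. INF q\<in>C. q x)" and "\<And>q x. q \<in> C \<Longrightarrow> (INF q\<in>C. q x) \<le> q x"
proof -
  have bdd: "bdd_below ((\<lambda>q. q x) ` C)" for x
  proof (rule bdd_belowI2)
    fix q assume "q \<in> C"
    then show "- p (- x) \<le> q x"
      using sublinear_minus_le[OF sub, of q x] bound[of q] by (auto simp: le_fun_def intro: order_trans[rotated])
  qed
  show le: "(INF q\<in>C. q x) \<le> q x" if "q \<in> C" for q x
    using that by (intro cINF_lower bdd)
  show "sublinear (\<lambda>x. INF q\<in>C. q x)"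
    unfolding sublinear_def
  proof (intro conjI allI impI)
    fix x y
    have "(INF q\<in>C. q (x + y)) - q x \<le> r y" if qr: "q \<in> C" "r \<in> C" for q r
    proof -
      obtain s where s: "s \<in> C" "s \<le> q" "s \<le> r" using chain[OF qr] qr by blast
      have "(INF q\<in>C. q (x + y)) \<le> s (x + y)" by (rule le[OF s(1)])
      also have "\<dots> \<le> s x + s y" by (rule sublinear_add[OF sub[OF s(1)]])
      also have "\<dots> \<le> q x + r y" using s(2,3) by (auto simp: le_fun_def intro: add_mono)
      finally show ?thesis by simp
    qed
    then have "(INF q\<in>C. q (x + y)) - q x \<le> (INF r\<in>C. r y)" if "q \<in> C" for q
      using that ne by (intro cINF_greatest) auto
    then have "(INF q\<in>C. q (x + y)) - (INF r\<in>C. r y) \<le> (INF q\<in>C. q x)"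
      using ne by (intro cINF_greatest) (auto simp: algebra_simps)
    then show "(INF q\<in>C. q (x + y)) \<le> (INF q\<in>C. q x) + (INF q\<in>C. q y)" by simp
  next
    fix t :: real and x assume t: "t \<ge> 0"
    have eq: "(INF q\<in>C. q (t *\<^sub>R x)) = (INF q\<in>C. t * q x)"
      using sub t by (intro INF_cong) (auto simp: sublinear_scale)
    show "(INF q\<in>C. q (t *\<^sub>R x)) = t * (INF q\<in>C. q x)"
    proof (cases "t = 0")
      case True then show ?thesis unfolding eq using ne by simp
    next
      case False
      then have t: "t > 0" using t by simp
      show ?thesis unfolding eq
      proof (rule antisym)
        have "bdd_below ((\<lambda>q. t * q x) ` C)"
          using bdd[of "t *\<^sub>R x"] sub t by (simp add: sublinear_scale cong: image_cong)
        then have "(INF q\<in>C. t * q x) \<le> t * q x" if "q \<in> C" for q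
          using that by (intro cINF_lower)
        then have "(INF q\<in>C. t * q x) / t \<le> (INF q\<in>C. q x)"
          using ne t by (intro cINF_greatest) (auto simp: field_simps)
        then show "(INF q\<in>C. t * q x) \<le> t * (INF q\<in>C. q x)"
          using t by (simp add: field_simps)
        show "t * (INF q\<in>C. q x) \<le> (INF q\<in>C. t * q x)"
          using ne t le by (intro cINF_greatest) auto
      qed
    qed
  qed
qed

text \<open>For fixed \<open>y\<close> the functional \<open>r\<close> is the largest candidate that
  has been lowered along the ray of \<open>y\<close>: it is again sublinear and lies below
  \<open>q\<close>. Minimality gives \<open>r = q\<close>, and the competitor \<open>t = 1\<close>
  in the infimum is superadditivity.\<close>

lemma minimal_sublinear_linear:
  fixes q :: "'v::real_vector \<Rightarrow> real"
  assumes q: "sublinear q" and min: "\<And>r. sublinear r \<Longrightarrow> r \<le> q \<Longrightarrow> r = q"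
  shows "linear q"
proof -
  have superadd: "q x + q y \<le> q (x + y)" for x y
  proof -
    define r where "r z = (INF t\<in>{0..}. q (z + t *\<^sub>R y) - t * q y)" for z
    have bdd: "bdd_below ((\<lambda>t. q (z + t *\<^sub>R y) - t * q y) ` {0..})" for z
    proof (rule bdd_belowI2)
      fix t :: real assume "t \<in> {0..}"
      then show "- q (- z) \<le> q (z + t *\<^sub>R y) - t * q y"
        using sublinear_add[OF q, of "z + t *\<^sub>R y" "- z"] sublinear_scale[OF q, of t y] by simp
    qed
    have le: "r z \<le> q (z + t *\<^sub>R y) - t * q y" if "t \<ge> 0" for z t
      unfolding r_def using that by (intro cINF_lower bdd) simp
    have "sublinear r" unfolding sublinear_def
    proof (intro conjI allI impI)
      fix u v
      have "r (u + v) - (q (u + s *\<^sub>R y) - s * q y) \<le> q (v + t *\<^sub>R y) - t * q y"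
        if "s \<ge> 0" "t \<ge> 0" for s t
      proof -
        have "r (u + v) \<le> q ((u + v) + (s + t) *\<^sub>R y) - (s + t) * q y" using that by (intro le) simp
        also have "(u + v) + (s + t) *\<^sub>R y = (u + s *\<^sub>R y) + (v + t *\<^sub>R y)" by (simp add: algebra_simps)
        also have "q \<dots> \<le> q (u + s *\<^sub>R y) + q (v + t *\<^sub>R y)" by (rule sublinear_add[OF q])
        finally show ?thesis by (simp add: algebra_simps)
      qed
      then have "r (u + v) - (q (u + s *\<^sub>R y) - s * q y) \<le> r v" if "s \<ge> 0" for s
        unfolding r_def[of v] using that by (intro cINF_greatest) auto
      then have "r (u + v) - r v \<le> r u"
        unfolding r_def[of u] by (intro cINF_greatest) (auto simp: algebra_simps)
      then show "r (u + v) \<le> r u + r v" by simp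
    next
      fix t :: real and u assume t: "t \<ge> 0"
      have up: "r (c *\<^sub>R v) \<le> c * r v" if c: "c > 0" for c v
      proof -
        have "r (c *\<^sub>R v) / c \<le> q (v + s *\<^sub>R y) - s * q y" if "s \<ge> 0" for s
        proof -
          have "r (c *\<^sub>R v) \<le> q (c *\<^sub>R v + (c * s) *\<^sub>R y) - (c * s) * q y"
            using that c by (intro le) simp
          also have "c *\<^sub>R v + (c * s) *\<^sub>R y = c *\<^sub>R (v + s *\<^sub>R y)" by (simp add: algebra_simps)
          also have "q \<dots> = c * q (v + s *\<^sub>R y)" using c by (intro sublinear_scale[OF q]) simp
          finally show ?thesis using c by (simp add: field_simps)
        qed
        then have "r (c *\<^sub>R v) / c \<le> r v" unfolding r_def[of v] by (intro cINF_greatest) auto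
        then show ?thesis using c by (simp add: field_simps)
      qed
      show "r (t *\<^sub>R u) = t * r u"
      proof (cases "t = 0")
        case True
        have "r 0 = (INF s\<in>{0::real..}. 0)"
          unfolding r_def by (intro INF_cong) (auto simp: sublinear_scale[OF q])
        then show ?thesis using True by simp
      next
        case False
        then have t: "t > 0" using t by simp
        have "r u \<le> r (t *\<^sub>R u) / t"
          using up[of "1 / t" "t *\<^sub>R u"] t by simp
        then show ?thesis using up[OF t, of u] t by (simp add: field_simps)
      qed
    qed
    moreover have "r \<le> q" using le[of 0] by (auto simp: le_fun_def)
    ultimately have "r = q" by (rule min)
    then show ?thesis using le[of 1 x] by simp
  qed
  have add: "q (x + y) = q x + q y" for x y
    using superadd sublinear_add[OF q] by (simp add: antisym)
  have neg: "q (- x) = - q x" for x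
    using add[of x "- x"] sublinear_zero[OF q] by simp
  show "linear q"
  proof (rule linearI)
    show "q (x + y) = q x + q y" for x y by (rule add)
    show "q (c *\<^sub>R x) = c *\<^sub>R q x" for c x
    proof (cases "c \<ge> 0")
      case False
      then show ?thesis using sublinear_scale[OF q, of "- c" x] neg[of "c *\<^sub>R x"] by simp
    qed (simp add: sublinear_scale[OF q])
  qed
qed

text \<open>Hahn-Banach without extension from a subspace: Zorn's lemma gives a minimal sublinear
  functional below \<open>p\<close>, and minimality forces linearity. Every constraint wanted of
  \<open>L\<close> has to be built into \<open>p\<close> beforehand.\<close>

theorem sublinear_dominates_linear:
  fixes p :: "'v::real_vector \<Rightarrow> real"
  assumes p: "sublinear p"
  obtains L where "linear L" "\<And>x. L x \<le> p x"
proof -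
  define A where "A = {q. sublinear q \<and> q \<le> p}"
  \<comment> \<open>Zorn is applied to the reversed order, so the upper bound of a chain is its
    pointwise infimum.\<close>
  have "\<exists>m\<in>A. \<forall>a\<in>A. m \<ge> a \<longrightarrow> a = m"
  proof (rule predicate_Zorn)
    show "partial_order_on A (relation_of (\<ge>) A)"
      by (rule partial_order_on_relation_ofI) auto
    fix C assume "C \<in> Chains (relation_of (\<ge>) A)"
    then have C: "C \<subseteq> A" "\<And>q r. q \<in> C \<Longrightarrow> r \<in> C \<Longrightarrow> q \<le> r \<or> r \<le> q"
      by (auto simp: Chains_def relation_of_def)
    show "\<exists>u\<in>A. \<forall>a\<in>C. u \<le> a"
    proof (cases "C = {}")
      case True then show ?thesis using p by (auto simp: A_def)
    next
      case False
      have sub: "\<And>q. q \<in> C \<Longrightarrow> sublinear q" and bnd: "\<And>q. q \<in> C \<Longrightarrow> q \<le> p"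
        using C(1) by (auto simp: A_def)
      have inf: "sublinear (\<lambda>x. INF q\<in>C. q x)" "\<And>q x. q \<in> C \<Longrightarrow> (INF q\<in>C. q x) \<le> q x"
        using sublinear_chain_Inf[of C p] False sub C(2) bnd by blast+
      obtain q where q: "q \<in> C" using False by blast
      have "(\<lambda>x. INF q\<in>C. q x) \<le> p"
        using inf(2)[OF q] bnd[OF q] by (auto simp: le_fun_def intro: order_trans)
      then show ?thesis using inf by (auto simp: A_def le_fun_def intro!: bexI[of _ "\<lambda>x. INF q\<in>C. q x"])
    qed
  qed
  then obtain q where q: "sublinear q" "q \<le> p" "\<And>r. sublinear r \<Longrightarrow> r \<le> p \<Longrightarrow> r \<le> q \<Longrightarrow> r = q"
    by (auto simp: A_def)
  have "linear q" using q(1)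
    by (rule minimal_sublinear_linear) (use q in \<open>blast intro: order_trans\<close>)
  then show ?thesis using q(2) that by (auto simp: le_fun_def)
qed

section \<open>Finitely additive probabilities and the minimax argument\<close>

definition fin_additive_prob :: "('x set \<Rightarrow> real) \<Rightarrow> bool" where
  "fin_additive_prob m \<longleftrightarrow> (\<forall>A. 0 \<le> m A) \<and> m UNIV = 1 \<and>
     (\<forall>A B. A \<inter> B = {} \<longrightarrow> m (A \<union> B) = m A + m B)"

text \<open>The discrete topology makes every bounded function an element of the space of bounded
  continuous functions, on which a finitely additive measure is a linear functional.\<close>

lemma fin_additive_minimax:
  fixes C :: "'i \<Rightarrow> 'x set"
  assumes no_avg: "\<And>F t. finite F \<Longrightarrow> F \<subseteq> I \<Longrightarrow> (\<forall>i\<in>F. t i \<ge> 0) \<Longrightarrow> sum t F = 1 \<Longrightarrow>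
      \<exists>x. (\<Sum>i\<in>F. t i * indicator (C i) x) > d"
  obtains m where "fin_additive_prob m" "\<And>i. i \<in> I \<Longrightarrow> m (C i) \<ge> d"
proof -
  define ind :: "'x set \<Rightarrow> 'x discrete \<Rightarrow>\<^sub>C real" where
    "ind A = Bcontfun (\<lambda>x. indicator A (of_discrete x))" for A
  have cont: "continuous_on UNIV f" for f :: "'x discrete \<Rightarrow> real"
    by (simp add: continuous_on_open_vimage open_discrete)
  have ind: "apply_bcontfun (ind A) x = indicator A (of_discrete x)" for A x
    unfolding ind_def
    by (subst Bcontfun_inverse)
       (auto simp: bcontfun_def cont bounded_iff indicator_def intro!: exI[of _ 1])
  \<comment> \<open>\<open>L (v i) \<ge> 0\<close> will say exactly that the mass of
    \<open>C i\<close> is at least \<open>d\<close>. The cone \<open>K\<close> collects all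
    constraints of this kind.\<close>
  define v where "v i = ind (C i) - d *\<^sub>R ind UNIV" for i
  define K where "K = {\<Sum>i\<in>F. t i *\<^sub>R v i | F t. finite F \<and> F \<subseteq> I \<and> (\<forall>i\<in>F. t i \<ge> 0)}"
  have K_zero: "0 \<in> K" unfolding K_def by (auto intro!: exI[of _ "{}"])
  have K_v: "v i \<in> K" if "i \<in> I" for i
    unfolding K_def using that by (auto intro!: exI[of _ "{i}"] exI[of _ "\<lambda>_. 1"])
  have K_add: "k + l \<in> K" if "k \<in> K" "l \<in> K" for k l
  proof -
    obtain F t where F: "k = (\<Sum>i\<in>F. t i *\<^sub>R v i)" "finite F" "F \<subseteq> I" "\<forall>i\<in>F. t i \<ge> 0"
      using \<open>k \<in> K\<close> by (auto simp: K_def)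
    obtain E s where E: "l = (\<Sum>i\<in>E. s i *\<^sub>R v i)" "finite E" "E \<subseteq> I" "\<forall>i\<in>E. s i \<ge> 0"
      using \<open>l \<in> K\<close> by (auto simp: K_def)
    let ?t = "\<lambda>i. if i \<in> F then t i else 0" and ?s = "\<lambda>i. if i \<in> E then s i else 0"
    have "k = (\<Sum>i\<in>F \<union> E. ?t i *\<^sub>R v i)" unfolding F(1)
      using F E by (intro sum.mono_neutral_cong_left) auto
    moreover have "l = (\<Sum>i\<in>F \<union> E. ?s i *\<^sub>R v i)" unfolding E(1)
      using F E by (intro sum.mono_neutral_cong_left) auto
    ultimately have "k + l = (\<Sum>i\<in>F \<union> E. (?t i + ?s i) *\<^sub>R v i)"
      by (simp only: scaleR_add_left sum.distrib)
    moreover have "\<forall>i\<in>F \<union> E. ?t i + ?s i \<ge> 0" using F E by auto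
    ultimately show ?thesis using F(2,3) E(2,3) unfolding K_def
      by (intro CollectI exI[of _ "F \<union> E"] exI[of _ "\<lambda>i. ?t i + ?s i"]) auto
  qed
  have K_scale: "c *\<^sub>R k \<in> K" if "k \<in> K" "c \<ge> 0" for k c
  proof -
    obtain F t where F: "k = (\<Sum>i\<in>F. t i *\<^sub>R v i)" "finite F" "F \<subseteq> I" "\<forall>i\<in>F. t i \<ge> 0"
      using \<open>k \<in> K\<close> by (auto simp: K_def)
    have "c *\<^sub>R k = (\<Sum>i\<in>F. (c * t i) *\<^sub>R v i)" by (simp add: F(1) scaleR_sum_right)
    then show ?thesis using F that(2) unfolding K_def
      by (intro CollectI exI[of _ F] exI[of _ "\<lambda>i. c * t i"]) auto
  qed
  \<comment> \<open>No element of the cone is negative everywhere: after dividing the weights by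
    their sum this is the hypothesis \<open>no_avg\<close>. It keeps the functional \<open>p\<close>
    below from being minus infinity.\<close>
  have K_pos: "\<exists>x. apply_bcontfun k x \<ge> 0" if "k \<in> K" for k
  proof -
    obtain F t where F: "k = (\<Sum>i\<in>F. t i *\<^sub>R v i)" "finite F" "F \<subseteq> I" "\<forall>i\<in>F. t i \<ge> 0"
      using \<open>k \<in> K\<close> by (auto simp: K_def)
    have k: "apply_bcontfun k x = (\<Sum>i\<in>F. t i * indicator (C i) (of_discrete x)) - d * sum t F" for x
      using F(2) unfolding F(1) by (induction F) (simp_all add: v_def ind algebra_simps del: sum_mult_indicator)
    show ?thesis
    proof (cases "sum t F = 0")
      case True
      then show ?thesis using F(4) unfolding k by (intro exI) (auto intro!: sum_nonneg simp del: sum_mult_indicator)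
    next
      case False
      then have pos: "sum t F > 0" using F(4) by (simp add: less_le sum_nonneg)
      obtain x where x: "(\<Sum>i\<in>F. t i / sum t F * indicator (C i) x) > d"
        using no_avg[OF F(2,3), of "\<lambda>i. t i / sum t F"] F(4) pos
        by (auto simp: sum_divide_distrib[symmetric])
      have "d < (\<Sum>i\<in>F. t i * indicator (C i) x) / sum t F"
        using x by (simp only: sum_divide_distrib times_divide_eq_left)
      then have "apply_bcontfun k (discrete x) > 0" unfolding k
        using pos by (simp only: discrete_inverse UNIV_I pos_less_divide_eq diff_gt_0_iff_gt)
      then show ?thesis by (auto intro: less_imp_le)
    qed
  qed
  \<comment> \<open>\<open>p u\<close> is the infimum over \<open>k\<close> in \<open>K\<close> of
    the supremum of \<open>u + k\<close>. Taking \<open>k = 0\<close> bounds \<open>p\<close> by the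
    supremum, which gives positivity and total mass one; taking \<open>k = v i\<close> gives
    \<open>p (- v i) \<le> 0\<close>.\<close>
  define S where "S u = {s. \<exists>k\<in>K. \<forall>x. apply_bcontfun (u + k) x \<le> s}" for u :: "'x discrete \<Rightarrow>\<^sub>C real"
  define p where "p u = Inf (S u)" for u
  have S_low: "- norm u \<le> s" if su: "s \<in> S u" for s u
  proof -
    obtain k where k: "k \<in> K" "\<forall>x. apply_bcontfun (u + k) x \<le> s" using su unfolding S_def by blast
    obtain x where "apply_bcontfun k x \<ge> 0" using K_pos[OF k(1)] by blast
    then show ?thesis using k(2)[rule_format, of x] norm_bounded[of u x] by auto
  qed
  have bdd: "bdd_below (S u)" for u using S_low by (auto simp: bdd_below_def)
  have S_ne: "S u \<noteq> {}" for u
  proof -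
    have "norm u \<in> S u" unfolding S_def
    proof (intro CollectI bexI[OF _ K_zero] allI)
      fix x show "apply_bcontfun (u + 0) x \<le> norm u" using norm_bounded[of u x] by auto
    qed
    then show ?thesis by blast
  qed
  have p_le: "p u \<le> s" if "s \<in> S u" for u s unfolding p_def using that by (rule cInf_lower[OF _ bdd])
  have "sublinear p" unfolding sublinear_def
  proof (intro conjI allI impI)
    fix u w
    have "p (u + w) - s \<le> r" if sr: "s \<in> S u" "r \<in> S w" for s r
    proof -
      obtain k where k: "k \<in> K" "\<forall>x. apply_bcontfun (u + k) x \<le> s" using sr unfolding S_def by blast
      obtain l where l: "l \<in> K" "\<forall>x. apply_bcontfun (w + l) x \<le> r" using sr unfolding S_def by blast
      have "apply_bcontfun ((u + w) + (k + l)) x \<le> s + r" for x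
        using k(2)[rule_format, of x] l(2)[rule_format, of x] by simp
      then have "s + r \<in> S (u + w)" using K_add[OF k(1) l(1)] unfolding S_def by blast
      then show ?thesis using p_le by force
    qed
    then have "p (u + w) - s \<le> p w" if "s \<in> S u" for s
      unfolding p_def[of w] using that S_ne by (intro cInf_greatest) auto
    then have "p (u + w) - p w \<le> p u"
      unfolding p_def[of u] using S_ne by (intro cInf_greatest) (auto simp: algebra_simps)
    then show "p (u + w) \<le> p u + p w" by simp
  next
    fix t :: real and u assume t: "t \<ge> 0"
    have up: "p (c *\<^sub>R w) \<le> c * p w" if c: "c > 0" for c w
    proof -
      have "p (c *\<^sub>R w) / c \<le> s" if su: "s \<in> S w" for s
      proof -
        obtain k where k: "k \<in> K" "\<forall>x. apply_bcontfun (w + k) x \<le> s" using su unfolding S_def by blast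
        have "apply_bcontfun (c *\<^sub>R w + c *\<^sub>R k) x \<le> c * s" for x
        proof -
          have "apply_bcontfun (c *\<^sub>R w + c *\<^sub>R k) x = c * apply_bcontfun (w + k) x"
            by (simp add: algebra_simps)
          then show ?thesis using k(2) c by simp
        qed
        then have "c * s \<in> S (c *\<^sub>R w)" using K_scale[OF k(1) less_imp_le[OF c]] unfolding S_def by blast
        then show ?thesis using p_le c by (force simp: field_simps)
      qed
      then have "p (c *\<^sub>R w) / c \<le> p w" unfolding p_def[of w] using S_ne by (intro cInf_greatest) auto
      then show ?thesis using c by (simp add: field_simps)
    qed
    show "p (t *\<^sub>R u) = t * p u"
    proof (cases "t = 0")
      case True
      have "p 0 \<le> 0" using p_le[of 0 0] K_zero unfolding S_def by force
      moreover have "p 0 \<ge> 0" unfolding p_def using S_ne S_low[of _ 0] by (intro cInf_greatest) auto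
      ultimately show ?thesis using True by simp
    next
      case False
      then have t: "t > 0" using t by simp
      have "p u \<le> p (t *\<^sub>R u) / t" using up[of "1 / t" "t *\<^sub>R u"] t by simp
      then show ?thesis using up[OF t, of u] t by (simp add: field_simps)
    qed
  qed
  then obtain L where L: "linear L" "\<And>u. L u \<le> p u"
    using sublinear_dominates_linear[of p] by blast
  have L_le: "L u \<le> s" if "\<And>x. apply_bcontfun u x \<le> s" for u s
  proof -
    have "s \<in> S u" unfolding S_def using that K_zero by (intro CollectI bexI[of _ 0]) auto
    then show ?thesis using L(2)[of u] p_le by force
  qed
  have "L (- v i) \<le> 0" if "i \<in> I" for i
  proof -
    have "0 \<in> S (- v i)" unfolding S_def using K_v[OF that] by (intro CollectI bexI[of _ "v i"]) auto
    then show ?thesis using L(2)[of "- v i"] p_le by force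
  qed
  then have L_v: "L (v i) \<ge> 0" if "i \<in> I" for i using that by (simp add: linear_neg[OF L(1)])
  define m where "m A = L (ind A)" for A
  have m_nonneg: "m A \<ge> 0" for A
    using L_le[of "- ind A" 0] by (simp add: m_def ind linear_neg[OF L(1)])
  have m_1: "m UNIV = 1"
    using L_le[of "- ind UNIV" "-1"] L_le[of "ind UNIV" 1] by (simp add: m_def ind linear_neg[OF L(1)])
  have m_add: "m (A \<union> B) = m A + m B" if "A \<inter> B = {}" for A B
  proof -
    have "ind (A \<union> B) = ind A + ind B"
      by (rule bcontfun_eqI) (use that in \<open>auto simp: ind indicator_def\<close>)
    then show ?thesis by (simp add: m_def linear_add[OF L(1)])
  qed
  have "m (C i) \<ge> d" if "i \<in> I" for i
    using L_v[OF that] m_1 by (simp add: v_def m_def linear_diff[OF L(1)] linear_scale[OF L(1)])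
  moreover have "fin_additive_prob m" unfolding fin_additive_prob_def using m_nonneg m_1 m_add by blast
  ultimately show ?thesis using that by blast
qed

lemma fin_additive_mono:
  assumes "fin_additive_prob m" "A \<subseteq> B"
  shows "m A \<le> m B"
proof -
  have "m (A \<union> (B - A)) = m A + m (B - A)" "m (B - A) \<ge> 0"
    using assms(1) unfolding fin_additive_prob_def by blast+
  moreover have "A \<union> (B - A) = B" using assms(2) by blast
  ultimately show ?thesis by simp
qed

lemma fin_additive_subadd:
  assumes "fin_additive_prob m"
  shows "m (A \<union> B) \<le> m A + m B"
proof -
  have "m (A \<union> (B - A)) = m A + m (B - A)"
    using assms unfolding fin_additive_prob_def by blast
  moreover have "m (B - A) \<le> m B" by (rule fin_additive_mono[OF assms]) blast
  ultimately show ?thesis by simp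
qed

section \<open>From a finitely additive set function to a regular Borel measure\<close>

text \<open>Only the values of \<open>m\<close> on compact sets are kept. This and
  \<open>outer_content\<close> are the two stages in the classical construction of a Radon measure
  from a content: first open sets from inside, then all sets from outside.\<close>

definition inner_content :: "('x::topological_space set \<Rightarrow> real) \<Rightarrow> 'x set \<Rightarrow> ennreal" where
  "inner_content m U = (SUP K\<in>{K. compact K \<and> K \<subseteq> U}. ennreal (m K))"

definition outer_content :: "('x::topological_space set \<Rightarrow> real) \<Rightarrow> 'x set \<Rightarrow> ennreal" where
  "outer_content m A = (INF U\<in>{U. open U \<and> A \<subseteq> U}. inner_content m U)"

lemma inner_content_upper: "compact K \<Longrightarrow> K \<subseteq> U \<Longrightarrow> ennreal (m K) \<le> inner_content m U"
  unfolding inner_content_def by (intro SUP_upper) auto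

lemma inner_content_mono: "U \<subseteq> W \<Longrightarrow> inner_content m U \<le> inner_content m W"
  unfolding inner_content_def by (intro SUP_subset_mono) auto

lemma outer_content_open: "open U \<Longrightarrow> outer_content m U = inner_content m U"
  unfolding outer_content_def
  by (intro antisym INF_lower INF_greatest) (auto intro: inner_content_mono)

lemma outer_content_mono: "A \<subseteq> B \<Longrightarrow> outer_content m A \<le> outer_content m B"
  unfolding outer_content_def by (intro INF_superset_mono) auto

lemma Hausdorff_space_euclidean_t2: "Hausdorff_space (euclidean :: 'x::t2_space topology)"
  unfolding Hausdorff_space_def using hausdorff by (auto simp: disjnt_def)

text \<open>\<open>K - W\<close> and \<open>K - U\<close> are disjoint compact sets, hence have
  disjoint open neighbourhoods; removing one neighbourhood or the other from \<open>K\<close> gives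
  the two pieces.\<close>

lemma compact_Un_decompose:
  fixes K :: "'x::t2_space set"
  assumes "compact K" "open U" "open W" "K \<subseteq> U \<union> W"
  obtains K1 K2 where "compact K1" "compact K2" "K = K1 \<union> K2" "K1 \<subseteq> U" "K2 \<subseteq> W"
proof -
  have "compact (K - W)" "compact (K - U)" using assms by (simp_all add: compact_diff)
  moreover have "disjnt (K - W) (K - U)" using assms(4) by (auto simp: disjnt_def)
  ultimately obtain P Q where PQ: "open P" "open Q" "K - W \<subseteq> P" "K - U \<subseteq> Q" "disjnt P Q"
    using iffD1[OF Hausdorff_space_compact_sets Hausdorff_space_euclidean_t2, rule_format, of "K - W" "K - U"]
    by (auto simp del: disjnt_insert1)
  show ?thesis
  proof (rule that)
    show "compact (K - Q)" "compact (K - P)" using PQ assms by (simp_all add: compact_diff)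
    show "K = (K - Q) \<union> (K - P)" using PQ(5) by (auto simp: disjnt_def)
    show "K - Q \<subseteq> U" "K - P \<subseteq> W" using PQ by auto
  qed
qed

text \<open>The compact set is split into compact pieces subordinate to the open cover; then
  subadditivity of \<open>m\<close> suffices.\<close>

lemma inner_content_finite_subadd:
  fixes m :: "'x::t2_space set \<Rightarrow> real"
  assumes m: "fin_additive_prob m" and "finite I" "\<And>i. i \<in> I \<Longrightarrow> open (U i)"
    and "compact K" "K \<subseteq> (\<Union>i\<in>I. U i)"
  shows "ennreal (m K) \<le> (\<Sum>i\<in>I. inner_content m (U i))"
  using assms(2-5)
proof (induction I arbitrary: K)
  case empty
  have "m ({} \<union> {}) = m {} + m {}" using m unfolding fin_additive_prob_def by blast
  then show ?case using empty by simp
next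
  case (insert i I)
  have "open (\<Union>i\<in>I. U i)" using insert.prems by auto
  then obtain K1 K2 where K: "compact K1" "compact K2" "K = K1 \<union> K2" "K1 \<subseteq> U i" "K2 \<subseteq> (\<Union>i\<in>I. U i)"
    using compact_Un_decompose[of K "U i" "\<Union>i\<in>I. U i"] insert.prems by auto
  have nn: "m A \<ge> 0" for A using m unfolding fin_additive_prob_def by blast
  have "ennreal (m K) \<le> ennreal (m K1) + ennreal (m K2)"
    using fin_additive_subadd[OF m, of K1 K2] K(3) nn by (simp flip: ennreal_plus)
  also have "\<dots> \<le> inner_content m (U i) + (\<Sum>i\<in>I. inner_content m (U i))"
    using K insert.prems by (intro add_mono inner_content_upper insert.IH) auto
  finally show ?case using insert.hyps by simp
qed

lemma inner_content_countable_subadd: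
  fixes m :: "'x::t2_space set \<Rightarrow> real" and U :: "nat \<Rightarrow> 'x set"
  assumes m: "fin_additive_prob m" and op: "\<And>i. open (U i)"
  shows "inner_content m (\<Union>i. U i) \<le> (\<Sum>i. inner_content m (U i))"
  unfolding inner_content_def[of m "\<Union>i. U i"]
proof (rule SUP_least, clarify)
  fix K assume K: "compact K" "K \<subseteq> (\<Union>i. U i)"
  obtain I where I: "finite I" "K \<subseteq> (\<Union>i\<in>I. U i)"
    by (rule compactE_image[OF K(1), of UNIV U]) (use op K in auto)
  have "ennreal (m K) \<le> (\<Sum>i\<in>I. inner_content m (U i))"
    by (rule inner_content_finite_subadd[OF m I(1) op K(1) I(2)])
  also have "\<dots> \<le> (\<Sum>i. inner_content m (U i))"
    by (rule sum_le_suminf) (use I in auto)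
  finally show "ennreal (m K) \<le> (\<Sum>i. inner_content m (U i))" .
qed

lemma outer_content_measure_space:
  fixes m :: "'x::t2_space set \<Rightarrow> real"
  assumes m: "fin_additive_prob m"
  shows "outer_measure_space (Pow UNIV) (outer_content m)"
  unfolding outer_measure_space_def
proof (intro conjI)
  have "m ({} \<union> {}) = m {} + m {}" using m unfolding fin_additive_prob_def by blast
  then show "positive (Pow UNIV) (outer_content m)"
    by (auto simp: positive_def outer_content_open inner_content_def intro!: SUP_eq_const[THEN trans])
  show "increasing (Pow UNIV) (outer_content m)"
    by (auto simp: increasing_def intro: outer_content_mono)
  show "countably_subadditive (Pow UNIV) (outer_content m)"
    unfolding countably_subadditive_def
  proof (intro allI impI)
    fix A :: "nat \<Rightarrow> 'x set"
    show "outer_content m (\<Union>i. A i) \<le> (\<Sum>i. outer_content m (A i))"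
    proof (rule ennreal_le_epsilon)
      fix e :: real assume e: "e > 0" and fin: "(\<Sum>i. outer_content m (A i)) < top_class.top"
      \<comment> \<open>The errors form a geometric series with total \<open>e\<close>. A strictly
        smaller cover exists only because the outer content of \<open>A i\<close> is finite.\<close>
      have "\<exists>U. open U \<and> A i \<subseteq> U \<and>
          inner_content m U \<le> outer_content m (A i) + ennreal (e * (1/2) ^ Suc i)" for i
      proof -
        have "outer_content m (A i) \<noteq> top_class.top"
          using fin ennreal_suminf_lessD by (metis less_irrefl)
        then have "outer_content m (A i) < outer_content m (A i) + ennreal (e * (1/2) ^ Suc i)"
          using e using ennreal_add_left_cancel_less[of "outer_content m (A i)" 0 "ennreal (e * (1/2) ^ Suc i)"] by simp
        then show ?thesis unfolding outer_content_def INF_less_iff by (auto intro: less_imp_le)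
      qed
      then obtain U where U: "\<And>i. open (U i)" "\<And>i. A i \<subseteq> U i"
        "\<And>i. inner_content m (U i) \<le> outer_content m (A i) + ennreal (e * (1/2) ^ Suc i)" by metis
      have "outer_content m (\<Union>i. A i) \<le> outer_content m (\<Union>i. U i)"
        using U(2) by (intro outer_content_mono) blast
      also have "\<dots> = inner_content m (\<Union>i. U i)" using U(1) by (intro outer_content_open) auto
      also have "\<dots> \<le> (\<Sum>i. inner_content m (U i))" by (rule inner_content_countable_subadd[OF m U(1)])
      also have "\<dots> \<le> (\<Sum>i. outer_content m (A i) + ennreal (e * (1/2) ^ Suc i))"
        by (intro suminf_le U(3)) auto
      also have "\<dots> = (\<Sum>i. outer_content m (A i)) + (\<Sum>i. ennreal (e * (1/2) ^ Suc i))"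
        by (intro suminf_add[symmetric]) auto
      also have "(\<Sum>i. ennreal (e * (1/2) ^ Suc i)) = ennreal e"
        using e power_half_series sums_mult[OF power_half_series, of e]
        by (intro suminf_ennreal_eq) auto
      finally show "outer_content m (\<Union>i. A i) \<le> (\<Sum>i. outer_content m (A i)) + ennreal e" .
    qed
  qed
qed

text \<open>The Caratheodory inequality for an open set \<open>U\<close>. Inside an open
  \<open>W\<close> around \<open>E\<close>, choose first a compact \<open>K\<close> in
  \<open>W \<inter> U\<close> and then a compact \<open>K'\<close> in \<open>W - K\<close>; the
  second set still covers \<open>E - U\<close>, and \<open>m\<close> is additive on the disjoint
  pair.\<close>

lemma outer_content_disjoint_superadd:
  fixes m :: "'x::t2_space set \<Rightarrow> real"
  assumes m: "fin_additive_prob m" and U: "open U"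
  shows "outer_content m (U \<inter> E) + outer_content m (E - U) \<le> outer_content m E"
  unfolding outer_content_def[of m E]
proof (rule INF_greatest, clarify)
  fix W assume W: "open W" "E \<subseteq> W"
  have nn: "m A \<ge> 0" for A using m unfolding fin_additive_prob_def by blast
  have step: "ennreal (m K) + outer_content m (E - U) \<le> inner_content m W"
    if K: "compact K" "K \<subseteq> W \<inter> U" for K
  proof -
    have op: "open (W - K)" using W K compact_imp_closed by blast
    have "outer_content m (E - U) \<le> outer_content m (W - K)"
      using W K by (intro outer_content_mono) blast
    also have "\<dots> = inner_content m (W - K)" by (rule outer_content_open[OF op])
    finally have "ennreal (m K) + outer_content m (E - U) \<le> ennreal (m K) + inner_content m (W - K)"
      by (rule add_left_mono)
    also have "\<dots> = (SUP K'\<in>{K'. compact K' \<and> K' \<subseteq> W - K}. ennreal (m K) + ennreal (m K'))"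
      unfolding inner_content_def by (rule ennreal_SUP_add_right) auto
    also have "\<dots> \<le> inner_content m W"
    proof (rule SUP_least, clarify)
      fix K' assume K': "compact K'" "K' \<subseteq> W - K"
      have "m (K \<union> K') = m K + m K'" using m K' unfolding fin_additive_prob_def by blast
      then have "ennreal (m K) + ennreal (m K') = ennreal (m (K \<union> K'))" using nn by simp
      also have "\<dots> \<le> inner_content m W" using K K' by (intro inner_content_upper compact_Un) auto
      finally show "ennreal (m K) + ennreal (m K') \<le> inner_content m W" .
    qed
    finally show ?thesis .
  qed
  have "outer_content m (U \<inter> E) \<le> outer_content m (W \<inter> U)" using W by (intro outer_content_mono) blast
  also have "\<dots> = inner_content m (W \<inter> U)" using W U by (intro outer_content_open) auto
  finally have "outer_content m (U \<inter> E) + outer_content m (E - U)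
      \<le> inner_content m (W \<inter> U) + outer_content m (E - U)" by (rule add_right_mono)
  also have "\<dots> = (SUP K\<in>{K. compact K \<and> K \<subseteq> W \<inter> U}. ennreal (m K) + outer_content m (E - U))"
    unfolding inner_content_def by (intro ennreal_SUP_add_left[symmetric]) auto
  also have "\<dots> \<le> inner_content m W" using step by (intro SUP_least) auto
  finally show "outer_content m (U \<inter> E) + outer_content m (E - U) \<le> inner_content m W" .
qed

text \<open>Only an inequality on closed sets can be expected, since \<open>m\<close> may have mass
  that is invisible to compact subsets of open sets. It holds because a closed \<open>C\<close> is
  compact and so competes in the inner content of each open set around it.\<close>

theorem fin_additive_regularize:
  fixes m :: "'x::t2_space set \<Rightarrow> real"
  assumes X: "compact (UNIV :: 'x set)" and m: "fin_additive_prob m"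
  obtains \<mu> where "\<mu> \<in> regular_probs" "\<And>C. closed C \<Longrightarrow> m C \<le> measure \<mu> C"
proof -
  let ?\<nu> = "outer_content m"
  let ?L = "lambda_system UNIV (Pow UNIV) ?\<nu>"
  interpret P: sigma_algebra "UNIV :: 'x set" "Pow UNIV" by (rule sigma_algebra_Pow)
  have ms: "measure_space UNIV ?L ?\<nu>"
    by (rule P.caratheodory_lemma[OF outer_content_measure_space[OF m]])
  then interpret L: sigma_algebra UNIV ?L by (simp add: measure_space_def)
  have oms: "positive (Pow UNIV) ?\<nu>" "countably_subadditive (Pow UNIV) ?\<nu>"
    using outer_content_measure_space[OF m] by (auto simp: outer_measure_space_def)
  have subadd: "?\<nu> E \<le> ?\<nu> (U \<inter> E) + ?\<nu> (E - U)" for E U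
  proof -
    have "subadditive (Pow UNIV) ?\<nu>"
      using oms by (intro P.countably_subadditive_subadditive) auto
    then have "?\<nu> ((U \<inter> E) \<union> (E - U)) \<le> ?\<nu> (U \<inter> E) + ?\<nu> (E - U)"
      by (rule subadditiveD) auto
    moreover have "(U \<inter> E) \<union> (E - U) = E" by blast
    ultimately show ?thesis by simp
  qed
  have open_L: "U \<in> ?L" if "open U" for U
    unfolding P.lambda_system_eq using outer_content_disjoint_superadd[OF m that] subadd
    by (auto simp: Int_commute intro!: antisym)
  have borel_L: "sets borel \<subseteq> ?L"
    unfolding sets_borel using open_L by (intro L.sigma_sets_subset) auto
  define \<mu> where "\<mu> = measure_of UNIV (sets borel) ?\<nu>"
  have ca: "countably_additive ?L ?\<nu>" using ms by (simp add: measure_space_def)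
  have "countably_additive (sets borel) ?\<nu>"
    unfolding countably_additive_def
    using borel_L ca[unfolded countably_additive_def] by (meson subsetD subset_trans)
  then have ms': "measure_space UNIV (sets borel) ?\<nu>"
    using oms(1) sets.sigma_algebra_axioms[of "borel :: 'x measure"]
    by (simp add: measure_space_def positive_def)
  have sets_mu: "sets \<mu> = sets borel" and space_mu: "space \<mu> = UNIV"
    unfolding \<mu>_def using sets.sigma_sets_eq[of borel] by (simp_all add: sets_measure_of space_measure_of)
  have em: "emeasure \<mu> A = ?\<nu> A" if "A \<in> sets borel" for A
  proof (rule emeasure_measure_of[OF \<mu>_def])
    show "A \<in> sets \<mu>" using that sets_mu by simp
    show "positive (sets \<mu>) ?\<nu>" "countably_additive (sets \<mu>) ?\<nu>"
      using ms' unfolding measure_space_def sets_mu by auto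
  qed auto
  have nn: "m A \<ge> 0" for A using m unfolding fin_additive_prob_def by blast
  have m1: "m UNIV = 1" using m unfolding fin_additive_prob_def by blast
  have "?\<nu> UNIV = 1"
    unfolding outer_content_open[OF open_UNIV]
  proof (rule antisym)
    show "1 \<le> inner_content m UNIV" using inner_content_upper[OF X, of UNIV m] m1 by simp
    show "inner_content m UNIV \<le> 1" unfolding inner_content_def
      using fin_additive_mono[OF m, of _ UNIV] m1 by (intro SUP_least) auto
  qed
  then have prob: "prob_space \<mu>" by (intro prob_spaceI) (simp add: space_mu em)
  then interpret prob_space \<mu> .
  have "emeasure \<mu> A = (SUP K\<in>{K. compact K \<and> K \<subseteq> A}. emeasure \<mu> K)" if A: "A \<in> sets borel" for A
  proof (rule antisym)
    have A': "- A \<in> sets borel" using A by auto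
    \<comment> \<open>Inner regularity of \<open>A\<close> is outer regularity of its complement:
      the complement of an open set around \<open>- A\<close> is a compact subset of
      \<open>A\<close>, and the total mass is one.\<close>
    have "1 - (SUP K\<in>{K. compact K \<and> K \<subseteq> A}. emeasure \<mu> K) \<le> ?\<nu> (- A)"
      unfolding outer_content_def
    proof (rule INF_greatest, clarify)
      fix U assume U: "open U" "- A \<subseteq> U"
      have "compact (UNIV - U)" using X U(1) by (simp add: compact_diff)
      then have c: "compact (- U)" by (simp add: Compl_eq_Diff_UNIV)
      have "emeasure \<mu> (- U) \<le> (SUP K\<in>{K. compact K \<and> K \<subseteq> A}. emeasure \<mu> K)"
        using c U by (intro SUP_upper) auto
      moreover have "emeasure \<mu> (- U) = 1 - emeasure \<mu> U"
        using emeasure_compl[of U \<mu>] U emeasure_space_1 by (simp add: space_mu sets_mu Compl_eq_Diff_UNIV)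
      moreover have "emeasure \<mu> U = inner_content m U" using U by (simp add: em outer_content_open)
      ultimately have "1 - (SUP K\<in>{K. compact K \<and> K \<subseteq> A}. emeasure \<mu> K) \<le> 1 - (1 - emeasure \<mu> U)"
        by (intro ennreal_mono_minus) auto
      also have "\<dots> = emeasure \<mu> U" using emeasure_le_1 by (intro diff_diff_ennreal) auto
      also have "\<dots> = inner_content m U" by fact
      finally show "1 - (SUP K\<in>{K. compact K \<and> K \<subseteq> A}. emeasure \<mu> K) \<le> inner_content m U" .
    qed
    also have "\<dots> = emeasure \<mu> (- A)" using em[OF A'] by simp
    also have "\<dots> = 1 - emeasure \<mu> A"
      using emeasure_compl[of A \<mu>] A emeasure_space_1 by (simp add: space_mu sets_mu Compl_eq_Diff_UNIV)
    finally have le: "1 - (SUP K\<in>{K. compact K \<and> K \<subseteq> A}. emeasure \<mu> K) \<le> 1 - emeasure \<mu> A" .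
    have "emeasure \<mu> A = 1 - (1 - emeasure \<mu> A)" using emeasure_le_1[of A] by (simp add: diff_diff_ennreal)
    also have "\<dots> \<le> 1 - (1 - (SUP K\<in>{K. compact K \<and> K \<subseteq> A}. emeasure \<mu> K))"
      by (intro ennreal_mono_minus le)
    also have "\<dots> = (SUP K\<in>{K. compact K \<and> K \<subseteq> A}. emeasure \<mu> K)"
      by (intro diff_diff_ennreal) (auto intro!: SUP_least emeasure_le_1)
    finally show "emeasure \<mu> A \<le> (SUP K\<in>{K. compact K \<and> K \<subseteq> A}. emeasure \<mu> K)" .
    show "(SUP K\<in>{K. compact K \<and> K \<subseteq> A}. emeasure \<mu> K) \<le> emeasure \<mu> A"
      using A sets_mu by (intro SUP_least emeasure_mono) auto
  qed
  then have "\<mu> \<in> regular_probs" using prob sets_mu by (simp add: regular_probs_def)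
  moreover have "m C \<le> measure \<mu> C" if C: "closed C" for C
  proof -
    have "compact C" using compact_Int_closed[OF X C] by simp
    then have "ennreal (m C) \<le> ?\<nu> C"
      unfolding outer_content_def by (intro INF_greatest inner_content_upper) auto
    also have "\<dots> = ennreal (measure \<mu> C)" using em[of C] C by (simp add: emeasure_eq_measure)
    finally show ?thesis by simp
  qed
  ultimately show ?thesis using that by blast
qed

section \<open>Concentration of measures and uniform averaging\<close>

lemma Urysohn_compact_t2:
  fixes x :: "'x::t2_space"
  assumes "compact (UNIV :: 'x set)" "open V" "x \<in> V"
  obtains k :: "'x \<Rightarrow> real" where "continuous_on UNIV k" "k x = 0" "\<And>y. y \<notin> V \<Longrightarrow> k y = 1"
    "\<And>y. 0 \<le> k y" "\<And>y. k y \<le> 1"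
proof -
  have norm: "normal_space (euclidean :: 'x topology)"
    by (rule compact_Hausdorff_or_regular_imp_normal_space) (use assms Hausdorff_space_euclidean_t2 in \<open>auto simp: compact_space_def\<close>)
  have c: "closedin euclidean {x}" "closedin euclidean (- V)" "disjnt {x} (- V)"
    using assms by (auto simp: disjnt_def)
  obtain k where k: "continuous_map euclidean (top_of_set {0..1::real}) k" "k ` {x} \<subseteq> {0}" "k ` (- V) \<subseteq> {1}"
    using Urysohn_lemma[OF norm c, of 0 1] by auto
  show ?thesis
  proof (rule that)
    show "continuous_on UNIV k" "k x = 0" "\<And>y. y \<notin> V \<Longrightarrow> k y = 1"
      using k by (auto simp: continuous_map_in_subtopology)
    show "0 \<le> k y" "k y \<le> 1" for y
      using k(1) by (auto simp: continuous_map_in_subtopology image_subset_iff)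
  qed
qed

lemma openin_weak_star:
  fixes f :: "'x::t2_space \<Rightarrow> complex"
  assumes "continuous_on UNIV f" "open W"
  shows "openin weak_star_topology {\<mu> \<in> regular_probs. integral\<^sup>L \<mu> f \<in> W}"
proof -
  let ?C = "{f :: 'x \<Rightarrow> complex. continuous_on UNIV f}"
  let ?F = "\<lambda>\<mu>. \<lambda>f\<in>?C. integral\<^sup>L \<mu> f"
  have f: "f \<in> ?C" using assms by simp
  have "openin (product_topology (\<lambda>_. euclidean) ?C) {z \<in> topspace (product_topology (\<lambda>_. euclidean) ?C). z f \<in> W}"
    by (rule openin_continuous_map_preimage[OF continuous_map_product_projection[OF f]])
      (use assms in simp)
  then show ?thesis
    unfolding weak_star_topology_def Let_def openin_pullback_topology
    by (intro exI[of _ "{z \<in> topspace (product_topology (\<lambda>_. euclidean) ?C). z f \<in> W}"])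
      (use assms in auto)
qed

text \<open>Strong proximality gives a limit point mass somewhere, not necessarily in
  \<open>V\<close>; minimality provides \<open>h\<close> moving it into \<open>V\<close>. A Urysohn
  function that vanishes at the moved point and is 1 off \<open>V\<close>, pulled back by
  \<open>h\<close>, then has small integral under a translate by some \<open>g\<close>, and the
  witness is the product of \<open>h\<close> and \<open>g\<close>.\<close>

lemma boundary_action_concentrates:
  fixes G :: "('g, 'm) monoid_scheme" and \<phi> :: "'g \<Rightarrow> 'x::t2_space \<Rightarrow> 'x"
  assumes bd: "boundary_action G \<phi>" and V: "open V" "V \<noteq> {}" and d: "d > 0"
    and \<mu>: "\<mu> \<in> regular_probs"
  obtains g where "g \<in> carrier G" "measure \<mu> (\<phi> g -` (- V)) < d"
proof -
  have X: "compact (UNIV :: 'x set)" and ga: "group_action G UNIV \<phi>"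
    and cont: "\<And>g. g \<in> carrier G \<Longrightarrow> continuous_on UNIV (\<phi> g)"
    and min: "minimal_action G \<phi>" and sp: "strongly_proximal G \<phi>"
    using bd by (auto simp: boundary_action_def)
  interpret group_action G UNIV \<phi> by (rule ga)
  interpret group G using group_hom by (simp add: group_hom_def)
  interpret prob_space \<mu> using \<mu> by (simp add: regular_probs_def)
  have sets: "sets \<mu> = sets borel" using \<mu> by (simp add: regular_probs_def)
  have meas: "\<phi> g \<in> borel_measurable \<mu>" if "g \<in> carrier G" for g
    using borel_measurable_continuous_onI[OF cont[OF that]] by (simp add: measurable_cong_sets[OF sets refl])
  obtain x where x: "return borel x \<in>
      weak_star_topology closure_of ((\<lambda>g. distr \<mu> borel (\<phi> g)) ` carrier G)"
    using sp \<mu> by (auto simp: strongly_proximal_def)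
  have "x' \<in> closure (orbit G \<phi> x)" for x' using min by (auto simp: minimal_action_def)
  then obtain h where h: "h \<in> carrier G" "\<phi> h x \<in> V"
    using V by (auto simp: closure_iff_nhds_not_empty orbit_def) blast
  obtain k :: "'x \<Rightarrow> real" where k: "continuous_on UNIV k" "k (\<phi> h x) = 0" "\<And>y. y \<notin> V \<Longrightarrow> k y = 1"
    "\<And>y. 0 \<le> k y" "\<And>y. k y \<le> 1"
    using Urysohn_compact_t2[OF X V(1) h(2)] by blast
  have kh: "continuous_on UNIV (\<lambda>y. k (\<phi> h y))"
    using continuous_on_compose2[OF k(1) cont[OF h(1)]] by auto
  define f where "f y = complex_of_real (k (\<phi> h y))" for y
  have f: "continuous_on UNIV f" unfolding f_def by (intro continuous_on_of_real kh)
  let ?U = "{\<mu> \<in> regular_probs. integral\<^sup>L \<mu> f \<in> {z. Re z < d}}"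
  have U: "openin weak_star_topology ?U" by (rule openin_weak_star[OF f open_halfspace_Re_lt])
  \<comment> \<open>Regularity of the point mass is read off from its membership in the closure,
    which lies in the underlying set of the topology.\<close>
  have "return borel x \<in> regular_probs"
    using x closure_of_subset_topspace[of weak_star_topology] 
    by (auto simp: weak_star_topology_def Let_def topspace_pullback_topology)
  moreover have "integral\<^sup>L (return borel x) f = f x"
    using f by (intro integral_return borel_measurable_continuous_onI) auto
  ultimately have "return borel x \<in> ?U" using d k(2) by (simp add: f_def)
  from conjunct2[OF x[unfolded in_closure_of], rule_format, OF conjI[OF this U]]
  have "\<exists>g\<in>carrier G. distr \<mu> borel (\<phi> g) \<in> ?U" by blast
  then obtain g where g: "g \<in> carrier G" "Re (integral\<^sup>L (distr \<mu> borel (\<phi> g)) f) < d" by auto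
  have fm: "f \<in> borel_measurable borel" by (rule borel_measurable_continuous_onI[OF f])
  have kgm: "(\<lambda>y. k (\<phi> h (\<phi> g y))) \<in> borel_measurable \<mu>"
    using borel_measurable_continuous_onI[OF continuous_on_compose2[OF kh cont[OF g(1)]]]
    by (simp add: measurable_cong_sets[OF sets refl])
  have int: "integral\<^sup>L (distr \<mu> borel (\<phi> g)) f = complex_of_real (\<integral>y. k (\<phi> h (\<phi> g y)) \<partial>\<mu>)"
    using integral_distr[OF meas[OF g(1)] fm] by (simp add: f_def)
  let ?A = "\<phi> (h \<otimes>\<^bsub>G\<^esub> g) -` (- V)"
  have hg: "h \<otimes>\<^bsub>G\<^esub> g \<in> carrier G" using h g by simp
  have comp: "\<phi> (h \<otimes>\<^bsub>G\<^esub> g) y = \<phi> h (\<phi> g y)" for y using h g by (simp add: composition_rule)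
  have "closed ?A" using cont[OF hg] V(1) by (auto intro!: closed_vimage)
  then have A: "?A \<in> sets \<mu>" using sets by simp
  have "measure \<mu> ?A = (\<integral>y. indicator ?A y \<partial>\<mu>)" using A by simp
  also have "\<dots> \<le> (\<integral>y. k (\<phi> h (\<phi> g y)) \<partial>\<mu>)"
  proof (rule integral_mono)
    show "integrable \<mu> (indicator ?A :: 'x \<Rightarrow> real)" using A by (simp add: emeasure_eq_measure)
    show "integrable \<mu> (\<lambda>y. k (\<phi> h (\<phi> g y)))"
      using k(4,5) kgm by (intro integrable_const_bound[of _ 1]) auto
    show "indicator ?A y \<le> k (\<phi> h (\<phi> g y))" for y
      using k(3)[of "\<phi> h (\<phi> g y)"] k(4) by (auto simp: indicator_def comp)
  qed
  also have "\<dots> < d" using g(2) int by simp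
  finally show ?thesis using that[OF hg] by blast
qed

theorem boundary_action_uniform_averaging:
  fixes G :: "('g, 'm) monoid_scheme" and \<phi> :: "'g \<Rightarrow> 'x::t2_space \<Rightarrow> 'x"
  assumes bd: "boundary_action G \<phi>" and V: "open V" "V \<noteq> {}" and d: "d > 0"
  obtains F t where "finite F" "F \<subseteq> carrier G" "\<forall>g\<in>F. t g \<ge> 0" "sum t F = 1"
    "\<And>x. (\<Sum>g\<in>F. t g * indicator (\<phi> g -` (- V)) x) \<le> (d :: real)"
proof (rule ccontr)
  assume nt: "\<not> thesis"
  note thesisI = that
  have no: "\<exists>x. (\<Sum>g\<in>F. t g * indicator (\<phi> g -` (- V)) x) > d"
    if "finite F" "F \<subseteq> carrier G" "\<forall>g\<in>F. t g \<ge> 0" "sum t F = 1" for F t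
    using that thesisI[OF that] nt by (meson not_le)
  obtain m where m: "fin_additive_prob m" "\<And>g. g \<in> carrier G \<Longrightarrow> m (\<phi> g -` (- V)) \<ge> d"
    using fin_additive_minimax[of "carrier G" d "\<lambda>g. \<phi> g -` (- V)"] no by blast
  have "compact (UNIV :: 'x set)" using bd by (simp add: boundary_action_def)
  then obtain \<mu> where \<mu>: "\<mu> \<in> regular_probs" "\<And>C. closed C \<Longrightarrow> m C \<le> measure \<mu> C"
    using fin_additive_regularize[OF _ m(1)] by blast
  obtain g where g: "g \<in> carrier G" "measure \<mu> (\<phi> g -` (- V)) < d"
    using boundary_action_concentrates[OF bd V d \<mu>(1)] by blast
  have "continuous_on UNIV (\<phi> g)" using bd g(1) by (auto simp: boundary_action_def)
  \<comment> \<open>Closedness lets the lower bound pass from \<open>m\<close> to the regular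
    measure.\<close>
  then have "closed (\<phi> g -` (- V))" using V(1) by (auto intro!: closed_vimage)
  then show False using m(2)[OF g(1)] \<mu>(2) g(2) by force
qed

section \<open>Operators on square-summable functions\<close>

lemma ell2_sq_summable: "(\<lambda>i. (cmod (Rep_ell2 \<xi> i))\<^sup>2) summable_on A"
proof -
  have "(\<lambda>i. (cmod (Rep_ell2 \<xi> i))\<^sup>2) summable_on UNIV" using Rep_ell2[of \<xi>] by simp
  then show ?thesis by (rule summable_on_subset_banach) simp
qed

lemma ell2_cinner_summable: "(\<lambda>i. Rep_ell2 \<xi> i * cnj (Rep_ell2 \<eta> i)) summable_on UNIV"
  by (rule ell2_prod_summable) (rule ell2_sq_summable)+

lemma norm_ell2_sq: "(norm \<xi>)\<^sup>2 = (\<Sum>\<^sub>\<infinity>i. (cmod (Rep_ell2 \<xi> i))\<^sup>2)"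
proof -
  have "(norm \<xi>)\<^sup>2 = inner \<xi> \<xi>" by (rule power2_norm_eq_inner)
  also have "\<dots> = (\<Sum>\<^sub>\<infinity>i. (cmod (Rep_ell2 \<xi> i))\<^sup>2)"
    unfolding inner_ell2_def ell2_cinner_def infsum_Re[OF ell2_cinner_summable, symmetric]
    by (simp add: cmod_power2 flip: power2_eq_square)
  finally show ?thesis .
qed

lemma ell2_eqI: "(\<And>i. Rep_ell2 \<xi> i = Rep_ell2 \<eta> i) \<Longrightarrow> \<xi> = \<eta>"
  using Rep_ell2_inject by blast

lemma ell2_finite_sum_le: "finite F \<Longrightarrow> (\<Sum>i\<in>F. (cmod (Rep_ell2 \<xi> i))\<^sup>2) \<le> (norm \<xi>)\<^sup>2"
  unfolding norm_ell2_sq by (rule finite_sum_le_infsum) (auto intro: ell2_sq_summable)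

lemma ell2_coeff_le_norm: "cmod (Rep_ell2 \<xi> i) \<le> norm \<xi>"
  using ell2_finite_sum_le[of "{i}" \<xi>] by (auto intro: power2_le_imp_le)

text \<open>\<open>Abs_ell2\<close> carries information only on square-summable functions. A uniform
  bound on finite partial sums yields membership and the norm estimate together; the adjoint and the
  weighted operators below are built through it.\<close>

lemma ell2_bounded:
  assumes "\<And>F. finite F \<Longrightarrow> (\<Sum>i\<in>F. (cmod (f i))\<^sup>2) \<le> B\<^sup>2" "B \<ge> 0"
  shows "Rep_ell2 (Abs_ell2 f) = f" and "norm (Abs_ell2 f) \<le> B"
proof -
  have s: "(\<lambda>i. (cmod (f i))\<^sup>2) summable_on UNIV"
    by (rule nonneg_bdd_above_summable_on) (auto intro!: bdd_aboveI2 assms)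
  show R: "Rep_ell2 (Abs_ell2 f) = f" using s by (intro Abs_ell2_inverse) simp
  have "(norm (Abs_ell2 f))\<^sup>2 \<le> B\<^sup>2"
    unfolding norm_ell2_sq R by (rule infsum_le_finite_sums[OF s]) (use assms in auto)
  then show "norm (Abs_ell2 f) \<le> B" using assms(2) by (rule power2_le_imp_le)
qed

lemma Rep_ell2_sum: "Rep_ell2 (\<Sum>k\<in>S. f k) i = (\<Sum>k\<in>S. Rep_ell2 (f k) i)"
  by (induction S rule: infinite_finite_induct) (auto simp: zero_ell2.rep_eq plus_ell2.rep_eq)

lift_definition ket :: "'a \<Rightarrow> 'a ell2" is "\<lambda>i j. if j = i then 1 else 0"
proof -
  fix i :: 'a
  have "(\<lambda>j. (cmod (if j = i then 1 else 0))\<^sup>2) summable_on {i}" by simp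
  then show "(\<lambda>j. (cmod (if j = i then 1 else 0))\<^sup>2) summable_on UNIV"
    by (rule summable_on_cong_neutral[THEN iffD1, rotated -1]) auto
qed

text \<open>The type class supplies real scaling only, so complex multiples need their own
  map.\<close>

lift_definition cscale :: "complex \<Rightarrow> 'a ell2 \<Rightarrow> 'a ell2" is "\<lambda>c f i. c * f i"
  by (rule ell2_scale_summable)

lift_definition restr :: "'a set \<Rightarrow> 'a ell2 \<Rightarrow> 'a ell2" is "\<lambda>A f i. if i \<in> A then f i else 0"
proof -
  fix A and f :: "'a \<Rightarrow> complex"
  assume "(\<lambda>i. (cmod (f i))\<^sup>2) summable_on UNIV"
  then show "(\<lambda>i. (cmod (if i \<in> A then f i else 0))\<^sup>2) summable_on UNIV"
    by (rule summable_on_comparison_test) auto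
qed

lemmas ell2_reps = zero_ell2.rep_eq plus_ell2.rep_eq uminus_ell2.rep_eq minus_ell2.rep_eq
  scaleR_ell2.rep_eq ket.rep_eq cscale.rep_eq restr.rep_eq

lemma cinner_cnj: "ell2_cinner \<eta> \<xi> = cnj (ell2_cinner \<xi> \<eta>)"
  unfolding ell2_cinner_def infsum_cnj[symmetric] by (simp add: mult.commute)

lemma cinner_add_left: "ell2_cinner (\<xi> + \<zeta>) \<eta> = ell2_cinner \<xi> \<eta> + ell2_cinner \<zeta> \<eta>"
  unfolding ell2_cinner_def plus_ell2.rep_eq distrib_right
  by (rule infsum_add[OF ell2_cinner_summable ell2_cinner_summable])

lemma cinner_cscale_left: "ell2_cinner (cscale c \<xi>) \<eta> = c * ell2_cinner \<xi> \<eta>"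
  unfolding ell2_cinner_def cscale.rep_eq mult.assoc by (rule infsum_cmult_right')

lemma scaleR_cscaleale: "r *\<^sub>R \<xi> = cscale (complex_of_real r) \<xi>"
  by (rule ell2_eqI) (simp add: ell2_reps)

lemma cinner_diff_left: "ell2_cinner (\<xi> - \<zeta>) \<eta> = ell2_cinner \<xi> \<eta> - ell2_cinner \<zeta> \<eta>"
  using cinner_add_left[of "\<xi> - \<zeta>" \<zeta> \<eta>] by simp

lemma cinner_add_right: "ell2_cinner \<eta> (\<xi> + \<zeta>) = ell2_cinner \<eta> \<xi> + ell2_cinner \<eta> \<zeta>"
  by (simp add: cinner_cnj[of \<eta>] cinner_add_left)

lemma cinner_diff_right: "ell2_cinner \<eta> (\<xi> - \<zeta>) = ell2_cinner \<eta> \<xi> - ell2_cinner \<eta> \<zeta>"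
  by (simp add: cinner_cnj[of \<eta>] cinner_diff_left)

lemma cinner_cscale_right: "ell2_cinner \<eta> (cscale c \<xi>) = cnj c * ell2_cinner \<eta> \<xi>"
  by (simp add: cinner_cnj[of \<eta>] cinner_cscale_left)

lemma cinner_sum_left: "ell2_cinner (\<Sum>k\<in>S. f k) \<eta> = (\<Sum>k\<in>S. ell2_cinner (f k) \<eta>)"
proof (induction S rule: infinite_finite_induct)
  case empty
  show ?case by (simp add: ell2_cinner_def ell2_reps)
next
  case (infinite S)
  then show ?case by (simp add: ell2_cinner_def ell2_reps)
qed (simp add: cinner_add_left)

lemma cinner_ket_right: "ell2_cinner \<xi> (ket i) = Rep_ell2 \<xi> i"
proof -
  have "ell2_cinner \<xi> (ket i) = (\<Sum>\<^sub>\<infinity>j\<in>{i}. Rep_ell2 \<xi> j)"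
    unfolding ell2_cinner_def by (rule infsum_cong_neutral) (auto simp: ell2_reps)
  then show ?thesis by simp
qed

lemma cinner_ket_left: "ell2_cinner (ket i) \<xi> = cnj (Rep_ell2 \<xi> i)"
  using cinner_cnj[of "ket i" \<xi>] by (simp add: cinner_ket_right)

lemma inner_self_cinner: "ell2_cinner \<xi> \<xi> = complex_of_real ((norm \<xi>)\<^sup>2)"
proof (rule complex_eqI)
  show "Re (ell2_cinner \<xi> \<xi>) = Re (complex_of_real ((norm \<xi>)\<^sup>2))"
    by (simp add: power2_norm_eq_inner inner_ell2_def)
  show "Im (ell2_cinner \<xi> \<xi>) = Im (complex_of_real ((norm \<xi>)\<^sup>2))"
    using arg_cong[OF cinner_cnj[of \<xi> \<xi>], of Im] unfolding cnj.sel by simp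
qed

lemma norm_cscaleale: "norm (cscale c \<xi>) = cmod c * norm \<xi>"
proof -
  have "complex_of_real ((norm (cscale c \<xi>))\<^sup>2) = complex_of_real ((cmod c * norm \<xi>)\<^sup>2)"
    unfolding inner_self_cinner[symmetric] cinner_cscale_left cinner_cscale_right
    by (simp add: inner_self_cinner power_mult_distrib complex_norm_square[of c] mult.assoc del: of_real_power)
  then have "(norm (cscale c \<xi>))\<^sup>2 = (cmod c * norm \<xi>)\<^sup>2" by (simp only: of_real_eq_iff)
  then show ?thesis by (simp add: power2_eq_iff_nonneg)
qed

text \<open>A phase \<open>u\<close> rotates the complex inner product onto the nonnegative reals,
  where it is the real inner product and the real inequality applies.\<close>

lemma cinner_Cauchy_Schwarz: "cmod (ell2_cinner \<xi> \<eta>) \<le> norm \<xi> * norm \<eta>"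
proof (cases "ell2_cinner \<xi> \<eta> = 0")
  case False
  define z where "z = ell2_cinner \<xi> \<eta>"
  define u where "u = cnj z / complex_of_real (cmod z)"
  have "z \<noteq> 0" using False by (simp add: z_def)
  moreover have "cnj z * z = complex_of_real (cmod z) * complex_of_real (cmod z)"
    using complex_norm_square[of z] by (simp add: power2_eq_square mult.commute)
  ultimately have u: "cmod u = 1" "u * z = complex_of_real (cmod z)"
    by (simp_all add: u_def norm_divide)
  have "cmod z = Re (ell2_cinner (cscale u \<xi>) \<eta>)" by (simp add: cinner_cscale_left u flip: z_def)
  also have "\<dots> = inner (cscale u \<xi>) \<eta>" by (simp add: inner_ell2_def)
  also have "\<dots> \<le> norm (cscale u \<xi>) * norm \<eta>" by (rule norm_cauchy_schwarz)
  finally show ?thesis using u by (simp add: norm_cscaleale z_def)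
qed simp

lemma norm_restr_sq: "(norm (restr A \<xi>))\<^sup>2 = (\<Sum>\<^sub>\<infinity>i\<in>A. (cmod (Rep_ell2 \<xi> i))\<^sup>2)"
  unfolding norm_ell2_sq by (rule infsum_cong_neutral) (auto simp: ell2_reps)

lemma restr_split: "\<xi> = restr A \<xi> + restr (- A) \<xi>"
  by (rule ell2_eqI) (auto simp: ell2_reps)

lemma norm_restr_Pythagoras: "(norm \<xi>)\<^sup>2 = (norm (restr A \<xi>))\<^sup>2 + (norm (restr (- A) \<xi>))\<^sup>2"
proof -
  have "(\<Sum>\<^sub>\<infinity>i\<in>A \<union> - A. (cmod (Rep_ell2 \<xi> i))\<^sup>2) =
      (\<Sum>\<^sub>\<infinity>i\<in>A. (cmod (Rep_ell2 \<xi> i))\<^sup>2) + (\<Sum>\<^sub>\<infinity>i\<in>- A. (cmod (Rep_ell2 \<xi> i))\<^sup>2)"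
    by (rule infsum_Un_disjoint) (auto intro: ell2_sq_summable)
  then show ?thesis by (simp add: norm_restr_sq norm_ell2_sq[of \<xi>])
qed

lemma norm_restr_le: "norm (restr A \<xi>) \<le> norm \<xi>"
proof (rule power2_le_imp_le)
  show "(norm (restr A \<xi>))\<^sup>2 \<le> (norm \<xi>)\<^sup>2"
    unfolding norm_restr_Pythagoras[of \<xi> A] by (rule add_increasing2) auto
qed simp

lemma restr_finite: "finite F \<Longrightarrow> restr F \<xi> = (\<Sum>i\<in>F. cscale (Rep_ell2 \<xi> i) (ket i))"
  by (rule ell2_eqI) (simp add: Rep_ell2_sum ell2_reps if_distrib[of "\<lambda>z. _ * z"] cong: if_cong)

lemma ell2_truncate:
  assumes "e > 0"
  obtains F where "finite F" "norm (\<xi> - restr F \<xi>) < e"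
proof -
  have "(\<lambda>i. (cmod (Rep_ell2 \<xi> i))\<^sup>2) summable_on UNIV" by (rule ell2_sq_summable)
  then have "((\<lambda>i. (cmod (Rep_ell2 \<xi> i))\<^sup>2) has_sum (norm \<xi>)\<^sup>2) UNIV"
    unfolding norm_ell2_sq by (rule has_sum_infsum)
  then have "((\<lambda>F. \<Sum>i\<in>F. (cmod (Rep_ell2 \<xi> i))\<^sup>2) \<longlongrightarrow> (norm \<xi>)\<^sup>2) (finite_subsets_at_top UNIV)"
    by (simp add: has_sum_def)
  then have "eventually (\<lambda>F. dist (\<Sum>i\<in>F. (cmod (Rep_ell2 \<xi> i))\<^sup>2) ((norm \<xi>)\<^sup>2) < e\<^sup>2) (finite_subsets_at_top UNIV)"
    using assms by (intro tendstoD) auto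
  then obtain F where F: "finite F" "dist (\<Sum>i\<in>F. (cmod (Rep_ell2 \<xi> i))\<^sup>2) ((norm \<xi>)\<^sup>2) < e\<^sup>2"
    unfolding eventually_finite_subsets_at_top by blast
  have "\<xi> - restr F \<xi> = restr (- F) \<xi>" by (rule ell2_eqI) (auto simp: ell2_reps)
  moreover have "(norm (restr (- F) \<xi>))\<^sup>2 < e\<^sup>2"
    using F(2) unfolding norm_restr_Pythagoras[of \<xi> F] dist_real_def
    by (simp add: norm_restr_sq[of F] infsum_finite[OF F(1)])
  ultimately have "norm (\<xi> - restr F \<xi>) < e" using assms by (simp add: power2_less_imp_less)
  with F(1) that show ?thesis by blast
qed

text \<open>The operator type records real linearity only, while an adjoint for the complex inner
  product forces complex linearity; the property has to be carried along separately.\<close>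

definition clinear_op :: "('a ell2 \<Rightarrow>\<^sub>L 'a ell2) \<Rightarrow> bool" where
  "clinear_op T \<longleftrightarrow> (\<forall>c \<xi>. T (cscale c \<xi>) = cscale c (T \<xi>))"

lemma clinear_opD: "clinear_op T \<Longrightarrow> T (cscale c \<xi>) = cscale c (T \<xi>)"
  by (simp add: clinear_op_def)

text \<open>Finitely supported truncations converge to \<open>\<xi>\<close>, and the Lipschitz bound
  transfers the estimate to the limit.\<close>

lemma blinfun_ell2_limit:
  assumes "\<And>F. finite F \<Longrightarrow> cmod (f (restr F \<xi>)) \<le> e"
    and "\<And>\<zeta>. cmod (f \<xi> - f \<zeta>) \<le> B * norm (\<xi> - \<zeta>)" "B \<ge> (0::real)"
  shows "cmod (f \<xi>) \<le> e"
proof (rule field_le_epsilon)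
  fix d :: real assume d: "d > 0"
  \<comment> \<open>The summand 1 keeps the quotient usable when \<open>B = 0\<close>.\<close>
  obtain F where F: "finite F" "norm (\<xi> - restr F \<xi>) < d / (B + 1)"
    using ell2_truncate[of "d / (B + 1)" \<xi>] d assms(3) by auto
  have "cmod (f \<xi>) \<le> cmod (f (restr F \<xi>)) + cmod (f \<xi> - f (restr F \<xi>))"
    by (rule norm_triangle_sub)
  also have "\<dots> \<le> e + B * norm (\<xi> - restr F \<xi>)" by (intro add_mono assms F)
  also have "B * norm (\<xi> - restr F \<xi>) \<le> B * (d / (B + 1))" using F(2) assms(3) by (intro mult_left_mono) auto
  also have "\<dots> \<le> d" using d assms(3) by (simp add: field_simps)
  finally show "cmod (f \<xi>) \<le> e + d" by simp
qed

text \<open>The coefficients of the adjoint vector are forced by pairing with the basis. It remains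
  to see that they are square-summable and that the identity extends from finitely supported
  vectors.\<close>

lemma clinear_op_adjoint_exists:
  fixes T :: "'a ell2 \<Rightarrow>\<^sub>L 'a ell2"
  assumes T: "clinear_op T"
  obtains S :: "'a ell2 \<Rightarrow>\<^sub>L 'a ell2" where "\<And>\<xi> \<eta>. ell2_cinner (T \<xi>) \<eta> = ell2_cinner \<xi> (S \<eta>)"
proof -
  define s where "s \<eta> i = ell2_cinner \<eta> (T (ket i))" for \<eta> i
  have fin: "(\<Sum>i\<in>F. (cmod (s \<eta> i))\<^sup>2) \<le> (norm T * norm \<eta>)\<^sup>2" if F: "finite F" for F \<eta>
  proof -
    \<comment> \<open>Pairing \<open>T \<zeta>\<close> with \<open>\<eta>\<close> gives exactly
      \<open>Q\<close>, which is the squared norm of \<open>\<zeta>\<close>. Cauchy-Schwarz bounds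
      \<open>Q\<close> by \<open>norm T * norm \<zeta> * norm \<eta>\<close>, and one factor
      \<open>norm \<zeta>\<close> cancels.\<close>
    define \<zeta> where "\<zeta> = (\<Sum>i\<in>F. cscale (s \<eta> i) (ket i))"
    define Q where "Q = (\<Sum>i\<in>F. (cmod (s \<eta> i))\<^sup>2)"
    have Rep: "Rep_ell2 \<zeta> i = (if i \<in> F then s \<eta> i else 0)" for i
      using F by (simp add: \<zeta>_def Rep_ell2_sum ell2_reps if_distrib[of "\<lambda>z. _ * z"] cong: if_cong)
    have "(norm \<zeta>)\<^sup>2 = (\<Sum>\<^sub>\<infinity>i\<in>F. (cmod (s \<eta> i))\<^sup>2)"
      unfolding norm_ell2_sq by (rule infsum_cong_neutral) (auto simp: Rep)
    then have n: "(norm \<zeta>)\<^sup>2 = Q" using F by (simp add: Q_def)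
    have "ell2_cinner (T \<zeta>) \<eta> = (\<Sum>i\<in>F. s \<eta> i * ell2_cinner (T (ket i)) \<eta>)"
      unfolding \<zeta>_def blinfun.sum_right cinner_sum_left clinear_opD[OF T] cinner_cscale_left ..
    also have "\<dots> = complex_of_real Q"
      unfolding Q_def of_real_sum by (intro sum.cong refl)
        (simp add: s_def cinner_cnj[of "T _" \<eta>] complex_norm_square del: of_real_power)
    finally have "cmod (ell2_cinner (T \<zeta>) \<eta>) = \<bar>Q\<bar>" by (simp only: norm_of_real)
    moreover have "Q \<ge> 0" by (simp add: Q_def sum_nonneg)
    ultimately have "Q = cmod (ell2_cinner (T \<zeta>) \<eta>)" by simp
    also have "\<dots> \<le> norm (T \<zeta>) * norm \<eta>" by (rule cinner_Cauchy_Schwarz)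
    also have "\<dots> \<le> (norm T * norm \<zeta>) * norm \<eta>" by (intro mult_right_mono norm_blinfun) auto
    finally have "norm \<zeta> * norm \<zeta> \<le> norm \<zeta> * (norm T * norm \<eta>)"
      using n by (simp add: power2_eq_square mult_ac)
    then have "norm \<zeta> \<le> norm T * norm \<eta>"
      by (cases "norm \<zeta> = 0") (auto simp: mult_le_cancel_left)
    then have "(norm \<zeta>)\<^sup>2 \<le> (norm T * norm \<eta>)\<^sup>2" by (rule power_mono) simp
    then show ?thesis unfolding n Q_def .
  qed
  define S where "S \<eta> = Abs_ell2 (s \<eta>)" for \<eta>
  have Rep_S: "Rep_ell2 (S \<eta>) = s \<eta>" and norm_S: "norm (S \<eta>) \<le> norm T * norm \<eta>" for \<eta>
    unfolding S_def using ell2_bounded[OF fin] by auto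
  have "bounded_linear S"
  proof (rule bounded_linear_intro)
    show "S (x + y) = S x + S y" for x y
      by (rule ell2_eqI) (simp add: Rep_S ell2_reps s_def cinner_add_left)
    show "S (r *\<^sub>R x) = r *\<^sub>R S x" for r x
      by (rule ell2_eqI) (simp add: Rep_S ell2_reps s_def scaleR_cscaleale[of _ x] cinner_cscale_left)
    show "norm (S x) \<le> norm x * norm T" for x using norm_S[of x] by (simp add: mult.commute)
  qed
  then have S: "blinfun_apply (Blinfun S) = S" by (rule bounded_linear_Blinfun_apply)
  have "ell2_cinner (T \<xi>) \<eta> = ell2_cinner \<xi> (S \<eta>)" for \<xi> \<eta>
  proof -
    define f where "f \<xi> = ell2_cinner (T \<xi>) \<eta> - ell2_cinner \<xi> (S \<eta>)" for \<xi>
    have fin0: "f (restr F \<xi>) = 0" if "finite F" for F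
      unfolding f_def restr_finite[OF that] blinfun.sum_right cinner_sum_left clinear_opD[OF T] cinner_cscale_left
      by (simp add: cinner_ket_left Rep_S s_def flip: cinner_cnj)
    have "cmod (f \<xi>) \<le> 0"
    proof (rule blinfun_ell2_limit)
      show "cmod (f (restr F \<xi>)) \<le> 0" if "finite F" for F using fin0[OF that] by simp
      fix \<zeta>
      have "f \<xi> - f \<zeta> = ell2_cinner (T (\<xi> - \<zeta>)) \<eta> - ell2_cinner (\<xi> - \<zeta>) (S \<eta>)"
        by (simp add: f_def blinfun.diff_right cinner_diff_left)
      also have "cmod \<dots> \<le> norm (T (\<xi> - \<zeta>)) * norm \<eta> + norm (\<xi> - \<zeta>) * norm (S \<eta>)"
        by (rule order_trans[OF norm_triangle_ineq4]) (intro add_mono cinner_Cauchy_Schwarz)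
      also have "\<dots> \<le> (norm T * norm (\<xi> - \<zeta>)) * norm \<eta> + norm (\<xi> - \<zeta>) * norm (S \<eta>)"
        by (intro add_mono mult_right_mono norm_blinfun) auto
      finally show "cmod (f \<xi> - f \<zeta>) \<le> (norm T * norm \<eta> + norm (S \<eta>)) * norm (\<xi> - \<zeta>)"
        by (simp add: algebra_simps)
    qed simp
    then show ?thesis by (simp add: f_def)
  qed
  then show ?thesis using that[of "Blinfun S"] by (simp add: S)
qed

text \<open>Uniqueness for the \<open>THE\<close>: pairing with basis vectors recovers every
  coefficient.\<close>

lemma ell2_adj_eqI:
  assumes "\<And>\<xi> \<eta>. ell2_cinner (blinfun_apply T \<xi>) \<eta> = ell2_cinner \<xi> (blinfun_apply S \<eta>)"
  shows "ell2_adj T = S"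
  unfolding ell2_adj_def
proof (rule the_equality)
  fix R assume R: "\<forall>\<xi> \<eta>. ell2_cinner (blinfun_apply T \<xi>) \<eta> = ell2_cinner \<xi> (blinfun_apply R \<eta>)"
  show "R = S"
  proof (rule blinfun_eqI, rule ell2_eqI)
    fix \<eta> i
    have "ell2_cinner (ket i) (R \<eta>) = ell2_cinner (ket i) (S \<eta>)" using assms R by metis
    then show "Rep_ell2 (R \<eta>) i = Rep_ell2 (S \<eta>) i" by (simp add: cinner_ket_left)
  qed
qed (use assms in auto)

lemma ell2_adj_spec:
  assumes "clinear_op T"
  shows "ell2_cinner (T \<xi>) \<eta> = ell2_cinner \<xi> (ell2_adj T \<eta>)"
proof -
  obtain S where S: "\<And>\<xi> \<eta>. ell2_cinner (T \<xi>) \<eta> = ell2_cinner \<xi> (blinfun_apply S \<eta>)"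
    using clinear_op_adjoint_exists[OF assms] by blast
  then show ?thesis using ell2_adj_eqI[of T S] by simp
qed

lemma ell2_adj_coeff:
  assumes "clinear_op T"
  shows "Rep_ell2 (ell2_adj T (ket i)) j = cnj (Rep_ell2 (T (ket j)) i)"
proof -
  have "ell2_cinner (ket j) (ell2_adj T (ket i)) = Rep_ell2 (T (ket j)) i"
    using ell2_adj_spec[OF assms, of "ket j" "ket i"] by (simp add: cinner_ket_right)
  then show ?thesis by (simp add: cinner_ket_left complex_eq_iff)
qed

lemma clinear_op_adj:
  assumes "clinear_op T"
  shows "clinear_op (ell2_adj T)"
  unfolding clinear_op_def
proof (intro allI, rule ell2_eqI)
  fix c \<xi> i
  have "ell2_cinner (ket i) (ell2_adj T (cscale c \<xi>)) = ell2_cinner (ket i) (cscale c (ell2_adj T \<xi>))"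
    by (simp add: ell2_adj_spec[OF assms, symmetric] cinner_cscale_right)
  then show "Rep_ell2 (ell2_adj T (cscale c \<xi>)) i = Rep_ell2 (cscale c (ell2_adj T \<xi>)) i"
    by (simp add: cinner_ket_left)
qed

lemma norm_ell2_adj_le:
  assumes "clinear_op T"
  shows "norm (ell2_adj T) \<le> norm T"
proof (rule norm_blinfun_bound)
  fix \<xi>
  let ?S = "ell2_adj T"
  have "(norm (?S \<xi>))\<^sup>2 = cmod (ell2_cinner (?S \<xi>) (?S \<xi>))" by (simp add: inner_self_cinner norm_power)
  also have "\<dots> = cmod (ell2_cinner (T (?S \<xi>)) \<xi>)" by (simp add: ell2_adj_spec[OF assms])
  also have "\<dots> \<le> norm (T (?S \<xi>)) * norm \<xi>" by (rule cinner_Cauchy_Schwarz)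
  also have "\<dots> \<le> (norm T * norm (?S \<xi>)) * norm \<xi>" by (intro mult_right_mono norm_blinfun) auto
  finally have "norm (?S \<xi>) * norm (?S \<xi>) \<le> norm (?S \<xi>) * (norm T * norm \<xi>)"
    by (simp add: power2_eq_square mult_ac)
  then show "norm (?S \<xi>) \<le> norm T * norm \<xi>"
    by (cases "norm (?S \<xi>) = 0") (auto simp: mult_le_cancel_left)
qed simp

lemma ell2_adj_add:
  assumes "clinear_op T" "clinear_op S"
  shows "ell2_adj (T + S) = ell2_adj T + ell2_adj S"
  by (rule ell2_adj_eqI)
    (simp add: blinfun.add_left cinner_add_left cinner_add_right ell2_adj_spec assms)

lemma ell2_adj_diff:
  assumes "clinear_op T" "clinear_op S"
  shows "ell2_adj (T - S) = ell2_adj T - ell2_adj S"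
  by (rule ell2_adj_eqI)
    (simp add: blinfun.diff_left cinner_diff_left cinner_diff_right ell2_adj_spec assms)

lemma clinear_op_diff: "clinear_op T \<Longrightarrow> clinear_op S \<Longrightarrow> clinear_op (T - S)"
  unfolding clinear_op_def blinfun.diff_left
  by (auto intro!: ell2_eqI simp: ell2_reps algebra_simps)

lemma clinear_op_add: "clinear_op T \<Longrightarrow> clinear_op S \<Longrightarrow> clinear_op (T + S)"
  unfolding clinear_op_def blinfun.add_left
  by (auto intro!: ell2_eqI simp: ell2_reps algebra_simps)

lemma clinear_op_0: "clinear_op 0"
  unfolding clinear_op_def by (auto intro!: ell2_eqI simp: ell2_reps)

text \<open>Equal matrix entries make the adjoints agree on basis vectors; pairing an arbitrary
  \<open>\<xi>\<close> with these vectors then recovers all coefficients of \<open>T \<xi>\<close>,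
  so no separate density argument is needed.\<close>

lemma clinear_op_eqI:
  assumes "clinear_op T" "clinear_op S" "\<And>i j. Rep_ell2 (T (ket j)) i = Rep_ell2 (S (ket j)) i"
  shows "T = S"
proof -
  have "ell2_adj T (ket i) = ell2_adj S (ket i)" for i
    using assms by (intro ell2_eqI) (simp add: ell2_adj_coeff)
  then have "ell2_cinner (T \<xi>) (ket i) = ell2_cinner (S \<xi>) (ket i)" for \<xi> i
    using assms by (simp add: ell2_adj_spec)
  then show ?thesis by (intro blinfun_eqI ell2_eqI) (simp add: cinner_ket_right)
qed

definition weighted_op :: "('a \<Rightarrow> complex) \<Rightarrow> ('a \<Rightarrow> 'a) \<Rightarrow> 'a ell2 \<Rightarrow>\<^sub>L 'a ell2" where
  "weighted_op w \<sigma> = Blinfun (\<lambda>\<xi>. Abs_ell2 (\<lambda>i. w i * Rep_ell2 \<xi> (\<sigma> i)))"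

text \<open>Injectivity on the support of the weight means that each coordinate of
  \<open>\<xi>\<close> is used at most once, so the norm is bounded by the supremum of the
  weight.\<close>

lemma
  assumes inj: "inj_on \<sigma> {i. w i \<noteq> 0}" and bnd: "\<And>i. cmod (w i) \<le> B" "B \<ge> 0"
  shows weighted_op_apply: "Rep_ell2 (weighted_op w \<sigma> \<xi>) i = w i * Rep_ell2 \<xi> (\<sigma> i)"
    and norm_weighted_op_le: "norm (weighted_op w \<sigma> \<xi>) \<le> B * norm \<xi>"
    and clinear_op_weighted_op: "clinear_op (weighted_op w \<sigma>)"
proof -
  have fin: "(\<Sum>i\<in>F. (cmod (w i * Rep_ell2 \<xi> (\<sigma> i)))\<^sup>2) \<le> (B * norm \<xi>)\<^sup>2" if F: "finite F" for F \<xi>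
  proof -
    let ?F = "F \<inter> {i. w i \<noteq> 0}"
    have "(\<Sum>i\<in>F. (cmod (w i * Rep_ell2 \<xi> (\<sigma> i)))\<^sup>2) = (\<Sum>i\<in>?F. (cmod (w i * Rep_ell2 \<xi> (\<sigma> i)))\<^sup>2)"
      using F by (intro sum.mono_neutral_right) auto
    also have "\<dots> \<le> (\<Sum>i\<in>?F. B\<^sup>2 * (cmod (Rep_ell2 \<xi> (\<sigma> i)))\<^sup>2)"
      unfolding norm_mult power_mult_distrib using bnd by (intro sum_mono mult_right_mono power_mono) auto
    also have "\<dots> = B\<^sup>2 * (\<Sum>j\<in>\<sigma> ` ?F. (cmod (Rep_ell2 \<xi> j))\<^sup>2)"
      by (subst sum.reindex) (auto simp: sum_distrib_left intro: inj_on_subset[OF inj])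
    also have "\<dots> \<le> B\<^sup>2 * (norm \<xi>)\<^sup>2"
      using F by (intro mult_left_mono ell2_finite_sum_le) auto
    finally show ?thesis by (simp add: power_mult_distrib)
  qed
  define W where "W \<xi> = Abs_ell2 (\<lambda>i. w i * Rep_ell2 \<xi> (\<sigma> i))" for \<xi>
  have W: "Rep_ell2 (W \<xi>) = (\<lambda>i. w i * Rep_ell2 \<xi> (\<sigma> i))" "norm (W \<xi>) \<le> B * norm \<xi>" for \<xi>
    unfolding W_def using ell2_bounded[OF fin] bnd(2) by auto
  have "bounded_linear W"
  proof (rule bounded_linear_intro)
    show "W (x + y) = W x + W y" for x y
      by (rule ell2_eqI) (simp add: W ell2_reps algebra_simps)
    show "W (r *\<^sub>R x) = r *\<^sub>R W x" for r x
      by (rule ell2_eqI) (simp add: W ell2_reps)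
    show "norm (W x) \<le> norm x * B" for x using W(2)[of x] by (simp add: mult.commute)
  qed
  then have app: "blinfun_apply (weighted_op w \<sigma>) = W"
    unfolding weighted_op_def W_def[symmetric] by (rule bounded_linear_Blinfun_apply)
  show "Rep_ell2 (weighted_op w \<sigma> \<xi>) i = w i * Rep_ell2 \<xi> (\<sigma> i)" "norm (weighted_op w \<sigma> \<xi>) \<le> B * norm \<xi>"
    by (simp_all add: app W)
  show "clinear_op (weighted_op w \<sigma>)"
    unfolding clinear_op_def app by (auto intro!: ell2_eqI simp: W ell2_reps)
qed

section \<open>The convolution algebra of germs\<close>

lemma has_sum_sum:
  fixes f :: "'i \<Rightarrow> 'a \<Rightarrow> 'b::topological_comm_monoid_add"
  assumes "\<And>i. i \<in> I \<Longrightarrow> (f i has_sum S i) A"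
  shows "((\<lambda>x. \<Sum>i\<in>I. f i x) has_sum (\<Sum>i\<in>I. S i)) A"
  using assms by (induction I rule: infinite_finite_induct) (auto intro: has_sum_add)

locale compact_action = group_action G UNIV \<phi>
  for G :: "('g, 'm) monoid_scheme" (structure) and \<phi> :: "'g \<Rightarrow> 'x::t2_space \<Rightarrow> 'x" +
  assumes cont: "g \<in> carrier G \<Longrightarrow> continuous_on UNIV (\<phi> g)"
    and compact_UNIV: "compact (UNIV :: 'x set)"
begin

lemma group_G: "group G"
  using group_hom by (simp add: group_hom_def)

sublocale group G by (rule group_G)

lemma group_action_self: "group_action G UNIV \<phi>" ..

lemma act_mult: "g \<in> carrier G \<Longrightarrow> h \<in> carrier G \<Longrightarrow> \<phi> (g \<otimes> h) x = \<phi> g (\<phi> h x)"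
  by (simp add: composition_rule)

lemma act_inv_left: "g \<in> carrier G \<Longrightarrow> \<phi> (inv g) (\<phi> g x) = x"
  using orbit_sym_aux[OF _ UNIV_I refl] by simp

lemma act_inv_right: "g \<in> carrier G \<Longrightarrow> \<phi> g (\<phi> (inv g) x) = x"
  using act_inv_left[of "inv g" x] by simp

lemma act_one: "\<phi> \<one> x = x"
  using act_inv_left[of \<one> "\<phi> \<one> x"] act_mult[of \<one> \<one> x] act_inv_left[of \<one> x] by simp

abbreviation "gm \<equiv> germ G \<phi>"
abbreviation "src \<equiv> germ_src :: ('g \<times> 'x) set \<Rightarrow> 'x"
abbreviation "rng \<equiv> germ_rng \<phi>"

lemma src_gm: "g \<in> carrier G \<Longrightarrow> src (gm g x) = x"
  by (rule germ_src_germ[OF group_action_self])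

lemma rng_gm: "g \<in> carrier G \<Longrightarrow> rng (gm g x) = \<phi> g x"
  by (rule germ_rng_germ[OF group_action_self])

lemma gm_eq_iff:
  assumes "g \<in> carrier G" "h \<in> carrier G"
  shows "gm g x = gm h y \<longleftrightarrow> x = y \<and> (\<exists>V. open V \<and> x \<in> V \<and> (\<forall>z\<in>V. \<phi> g z = \<phi> h z))"
proof -
  have "gm g x = gm h y \<longleftrightarrow> ((g, x), (h, y)) \<in> germ_rel G \<phi>"
    unfolding germ_def
    by (rule eq_equiv_class_iff[OF germ_rel_equiv[OF group_action_self]]) (use assms in auto)
  then show ?thesis using assms by (simp add: germ_rel_iff[OF group_action_self])
qed

lemma germs_eq: "germs G \<phi> = (\<lambda>(g, x). gm g x) ` (carrier G \<times> UNIV)"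
  by (auto simp: germs_def quotient_def germ_def)

lemma gm_in_germs: "g \<in> carrier G \<Longrightarrow> gm g x \<in> germs G \<phi>"
  by (auto simp: germs_eq)

lemma germsE:
  assumes "\<gamma> \<in> germs G \<phi>"
  obtains g where "g \<in> carrier G" "\<gamma> = gm g (src \<gamma>)"
  using assms by (auto simp: germs_eq src_gm)

lemma germ_mult_gm:
  "g \<in> carrier G \<Longrightarrow> h \<in> carrier G \<Longrightarrow> germ_mult G \<phi> (gm g (\<phi> h x)) (gm h x) = gm (g \<otimes> h) x"
  using germ_mult_germ[OF group_action_self] cont by blast

text \<open>Among the germs of \<open>s\<close> exactly one is composable with
  \<open>\<gamma>\<close>, the one at the range of \<open>\<gamma>\<close>. Multiplication by it
  makes \<open>G\<close> act on the germs from the left.\<close>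

definition lact :: "'g \<Rightarrow> ('g \<times> 'x) set \<Rightarrow> ('g \<times> 'x) set" where
  "lact s \<gamma> = germ_mult G \<phi> (gm s (rng \<gamma>)) \<gamma>"

lemma lact_gm: "s \<in> carrier G \<Longrightarrow> g \<in> carrier G \<Longrightarrow> lact s (gm g x) = gm (s \<otimes> g) x"
  by (simp add: lact_def rng_gm germ_mult_gm)

lemma lact_germs:
  assumes "s \<in> carrier G" "\<gamma> \<in> germs G \<phi>"
  shows "lact s \<gamma> \<in> germs G \<phi>" "src (lact s \<gamma>) = src \<gamma>" "rng (lact s \<gamma>) = \<phi> s (rng \<gamma>)"
proof -
  obtain g where g: "g \<in> carrier G" "\<gamma> = gm g (src \<gamma>)" using assms(2) by (rule germsE)
  have l: "lact s \<gamma> = gm (s \<otimes> g) (src \<gamma>)" using assms(1) g lact_gm by metis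
  have r: "rng \<gamma> = \<phi> g (src \<gamma>)" using g rng_gm by metis
  show "lact s \<gamma> \<in> germs G \<phi>" "src (lact s \<gamma>) = src \<gamma>" "rng (lact s \<gamma>) = \<phi> s (rng \<gamma>)"
    using assms(1) g(1) unfolding l r by (simp_all add: gm_in_germs src_gm rng_gm act_mult)
qed

lemma lact_lact:
  assumes "s \<in> carrier G" "t \<in> carrier G" "\<gamma> \<in> germs G \<phi>"
  shows "lact s (lact t \<gamma>) = lact (s \<otimes> t) \<gamma>"
proof -
  obtain g where g: "g \<in> carrier G" "\<gamma> = gm g (src \<gamma>)" using assms(3) by (rule germsE)
  have "lact s (lact t (gm g (src \<gamma>))) = lact (s \<otimes> t) (gm g (src \<gamma>))"
    using assms g(1) by (simp add: lact_gm m_assoc)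
  then show ?thesis using g(2) by simp
qed

lemma lact_one: "\<gamma> \<in> germs G \<phi> \<Longrightarrow> lact \<one> \<gamma> = \<gamma>"
  by (metis germsE lact_gm l_one one_closed)

lemma lact_inv:
  assumes "s \<in> carrier G" "\<gamma> \<in> germs G \<phi>"
  shows "lact (inv s) (lact s \<gamma>) = \<gamma>" "lact s (lact (inv s) \<gamma>) = \<gamma>"
  using assms by (simp_all add: lact_lact lact_one)

lemma inj_on_lact: "s \<in> carrier G \<Longrightarrow> inj_on (lact s) (germs G \<phi>)"
  by (rule inj_on_inverseI[of _ "lact (inv s)"]) (rule lact_inv)

lemma lact_eq_iff:
  assumes "s \<in> carrier G" "\<gamma> \<in> germs G \<phi>" "\<delta> \<in> germs G \<phi>"
  shows "lact (inv s) \<gamma> = \<delta> \<longleftrightarrow> lact s \<delta> = \<gamma>"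
  using assms lact_inv by metis

text \<open>This is the crossed product element "h times u_s" pushed down to germs. The coefficient
  is read at the range, so multiplication by \<open>h\<close> follows translation by
  \<open>s\<close>.\<close>

definition monomial :: "('x \<Rightarrow> complex) \<Rightarrow> 'g \<Rightarrow> ('g \<times> 'x) set \<Rightarrow> complex" where
  "monomial h s \<gamma> = (if \<gamma> \<in> range (gm s) then h (rng \<gamma>) else 0)"

text \<open>The index type also contains sets that are not germs. The weight vanishes there, so
  monomial operators are zero on that summand.\<close>

definition germ_weight :: "('x \<Rightarrow> complex) \<Rightarrow> ('g \<times> 'x) set \<Rightarrow> complex" where
  "germ_weight h \<gamma> = (if \<gamma> \<in> germs G \<phi> then h (rng \<gamma>) else 0)"

text \<open>Unique factorization: once the left factor is a germ of \<open>s\<close>, the right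
  factor must be the translate of \<open>\<gamma>\<close> by the inverse of \<open>s\<close>.
  Convolution with a monomial therefore has a single term.\<close>

lemma germ_conv_set_eq:
  assumes s: "s \<in> carrier G" and \<gamma>: "\<gamma> \<in> germs G \<phi>"
  shows "{(\<eta>, \<delta>). \<eta> \<in> germs G \<phi> \<and> \<delta> \<in> germs G \<phi> \<and> src \<eta> = rng \<delta> \<and>
      germ_mult G \<phi> \<eta> \<delta> = \<gamma> \<and> \<eta> \<in> range (gm s)} =
    {(gm s (rng (lact (inv s) \<gamma>)), lact (inv s) \<gamma>)}" (is "?L = {(?\<eta>, ?\<delta>)}")
proof (intro subset_antisym subsetI)
  fix p assume "p \<in> ?L"
  then obtain \<eta> \<delta> y where p: "p = (\<eta>, \<delta>)" "\<eta> = gm s y" "\<delta> \<in> germs G \<phi>" "src \<eta> = rng \<delta>"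
    "germ_mult G \<phi> \<eta> \<delta> = \<gamma>" by auto
  have "y = rng \<delta>" using p(2,4) s by (simp add: src_gm)
  then have "lact s \<delta> = \<gamma>" using p by (simp add: lact_def)
  then have "\<delta> = lact (inv s) \<gamma>" using lact_inv(1)[OF s p(3)] by simp
  then show "p \<in> {(?\<eta>, ?\<delta>)}" using p \<open>y = rng \<delta>\<close> by simp
next
  fix p assume "p \<in> {(?\<eta>, ?\<delta>)}"
  moreover have "germ_mult G \<phi> ?\<eta> ?\<delta> = \<gamma>"
    using lact_inv(2)[OF s \<gamma>] unfolding lact_def[of s] .
  ultimately show "p \<in> ?L"
    using s \<gamma> by (auto simp: gm_in_germs src_gm lact_germs)
qed

lemma germ_conv_monomial_has_sum:
  assumes s: "s \<in> carrier G"
  shows "((\<lambda>(\<eta>, \<delta>). monomial h s \<eta> * \<xi> \<delta>) has_sum germ_weight h \<gamma> * \<xi> (lact (inv s) \<gamma>))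
     {(\<eta>, \<delta>). \<eta> \<in> germs G \<phi> \<and> \<delta> \<in> germs G \<phi> \<and> src \<eta> = rng \<delta> \<and> germ_mult G \<phi> \<eta> \<delta> = \<gamma>}"
    (is "(?f has_sum ?v) ?A")
proof (cases "\<gamma> \<in> germs G \<phi>")
  case True
  let ?p = "(gm s (rng (lact (inv s) \<gamma>)), lact (inv s) \<gamma>)"
  have eq: "{p \<in> ?A. fst p \<in> range (gm s)} = {?p}"
    unfolding germ_conv_set_eq[OF s True, symmetric]
    by (rule Collect_cong) (simp only: mem_Collect_eq case_prod_unfold conj_assoc)
  have "?v = ?f ?p"
    using s True by (simp add: monomial_def germ_weight_def rng_gm lact_germs act_inv_right)
  then have "(?f has_sum ?v) {?p}" by (intro has_sum_finiteI) simp_all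
  then have "(?f has_sum ?v) {p \<in> ?A. fst p \<in> range (gm s)}" unfolding eq .
  then show ?thesis
    by (rule has_sum_cong_neutral[THEN iffD1, rotated -1]) (auto simp: monomial_def)
next
  case False
  have "?A = {}"
  proof (rule ccontr)
    assume "?A \<noteq> {}"
    then obtain \<eta> \<delta> where p: "\<eta> \<in> germs G \<phi>" "\<delta> \<in> germs G \<phi>" "src \<eta> = rng \<delta>" "germ_mult G \<phi> \<eta> \<delta> = \<gamma>"
      by auto
    obtain g where "g \<in> carrier G" "\<eta> = gm g (src \<eta>)" using p(1) by (rule germsE)
    then have "\<gamma> = lact g \<delta>" using p by (simp add: lact_def)
    then show False using False lact_germs(1) \<open>g \<in> carrier G\<close> p(2) by blast
  qed
  then show ?thesis using False by (simp only: has_sum_empty germ_weight_def if_False mult_zero_left)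
qed

lemma germ_conv_sum_monomial:
  assumes "\<And>i. i < n \<Longrightarrow> s i \<in> carrier G"
  shows "germ_conv G \<phi> (\<lambda>\<gamma>. \<Sum>i<n. monomial (h i) (s i) \<gamma>) \<xi> \<gamma> =
     (\<Sum>i<n. germ_weight (h i) \<gamma> * \<xi> (lact (inv (s i)) \<gamma>))"
proof -
  let ?A = "{(\<eta>, \<delta>). \<eta> \<in> germs G \<phi> \<and> \<delta> \<in> germs G \<phi> \<and> src \<eta> = rng \<delta> \<and> germ_mult G \<phi> \<eta> \<delta> = \<gamma>}"
  have "((\<lambda>p. \<Sum>i<n. (\<lambda>(\<eta>, \<delta>). monomial (h i) (s i) \<eta> * \<xi> \<delta>) p) has_sum
      (\<Sum>i<n. germ_weight (h i) \<gamma> * \<xi> (lact (inv (s i)) \<gamma>))) ?A"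
    using assms by (intro has_sum_sum germ_conv_monomial_has_sum) auto
  moreover have "(\<lambda>p. \<Sum>i<n. (\<lambda>(\<eta>, \<delta>). monomial (h i) (s i) \<eta> * \<xi> \<delta>) p) =
      (\<lambda>(\<eta>, \<delta>). (\<Sum>i<n. monomial (h i) (s i) \<eta>) * \<xi> \<delta>)"
    by (auto simp: fun_eq_iff sum_distrib_right)
  ultimately show ?thesis
    unfolding germ_conv_def by (simp add: infsumI)
qed

definition monomial_op :: "('x \<Rightarrow> complex) \<Rightarrow> 'g \<Rightarrow> ('g, 'x) germ_op" where
  "monomial_op h s = weighted_op (germ_weight h) (lact (inv s))"

lemma continuous_bounded:
  fixes h :: "'x \<Rightarrow> complex"
  assumes "continuous_on UNIV h"
  obtains B where "B \<ge> 0" "\<And>x. cmod (h x) \<le> B"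
proof -
  have "compact (h ` UNIV)" using assms compact_UNIV by (rule compact_continuous_image)
  then obtain B where "\<And>x. cmod (h x) \<le> B" using compact_imp_bounded by (force simp: bounded_iff)
  then show ?thesis using that[of B] norm_ge_zero order_trans by blast
qed

lemma germ_weight_le: "(\<And>x. cmod (h x) \<le> B) \<Longrightarrow> B \<ge> 0 \<Longrightarrow> cmod (germ_weight h \<gamma>) \<le> B"
  by (simp add: germ_weight_def)

lemma germ_weight_inj: "s \<in> carrier G \<Longrightarrow> inj_on (lact (inv s)) {\<gamma>. germ_weight h \<gamma> \<noteq> 0}"
  by (rule inj_on_subset[OF inj_on_lact]) (auto simp: germ_weight_def)

lemma monomial_op_apply:
  assumes "continuous_on UNIV h" "s \<in> carrier G"
  shows "Rep_ell2 (monomial_op h s \<xi>) \<gamma> = germ_weight h \<gamma> * Rep_ell2 \<xi> (lact (inv s) \<gamma>)"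
proof -
  obtain B where "B \<ge> 0" "\<And>x. cmod (h x) \<le> B" using continuous_bounded[OF assms(1)] by blast
  then show ?thesis unfolding monomial_op_def using germ_weight_inj assms(2) by (intro weighted_op_apply[of _ _ B] germ_weight_le)
qed

lemma clinear_op_monomial_op:
  assumes "continuous_on UNIV h" "s \<in> carrier G"
  shows "clinear_op (monomial_op h s)"
proof -
  obtain B where "B \<ge> 0" "\<And>x. cmod (h x) \<le> B" using continuous_bounded[OF assms(1)] by blast
  then show ?thesis unfolding monomial_op_def using germ_weight_inj assms(2) by (intro clinear_op_weighted_op[of _ _ B] germ_weight_le)
qed

text \<open>\<open>Blinfun\<close> is meaningful only on bounded linear maps. Convolution is
  identified coordinatewise with an operator already known to be bounded, which settles this along
  with the formula.\<close>

lemma lreg_sum_monomial: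
  assumes "\<And>i. i < n \<Longrightarrow> s i \<in> carrier G" "\<And>i. i < n \<Longrightarrow> continuous_on UNIV (h i)"
  shows "lreg G \<phi> (\<lambda>\<gamma>. \<Sum>i<n. monomial (h i) (s i) \<gamma>) = (\<Sum>i<n. monomial_op (h i) (s i))"
proof -
  have "Abs_ell2 (germ_conv G \<phi> (\<lambda>\<gamma>. \<Sum>i<n. monomial (h i) (s i) \<gamma>) (Rep_ell2 \<xi>)) = (\<Sum>i<n. monomial_op (h i) (s i)) \<xi>" for \<xi>
  proof -
    have "germ_conv G \<phi> (\<lambda>\<gamma>. \<Sum>i<n. monomial (h i) (s i) \<gamma>) (Rep_ell2 \<xi>) = Rep_ell2 ((\<Sum>i<n. monomial_op (h i) (s i)) \<xi>)"
      using assms by (auto simp: fun_eq_iff germ_conv_sum_monomial blinfun.sum_left Rep_ell2_sum monomial_op_apply)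
    then show ?thesis by (simp add: Rep_ell2_inverse)
  qed
  then show ?thesis unfolding lreg_def by (simp add: blinfun_apply_inverse)
qed

text \<open>The covariance relation of the crossed product: moving \<open>k\<close> to the left past
  the unitary of \<open>s\<close> composes it with the inverse of \<open>s\<close>.\<close>

lemma monomial_op_mult:
  assumes "continuous_on UNIV h" "s \<in> carrier G" "continuous_on UNIV k" "t \<in> carrier G"
  shows "monomial_op h s o\<^sub>L monomial_op k t = monomial_op (\<lambda>y. h y * k (\<phi> (inv s) y)) (s \<otimes> t)"
    and "continuous_on UNIV (\<lambda>y. h y * k (\<phi> (inv s) y))"
proof -
  show c: "continuous_on UNIV (\<lambda>y. h y * k (\<phi> (inv s) y))"
    using assms cont[of "inv s"] by (intro continuous_on_mult) (auto intro: continuous_on_compose2)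
  show "monomial_op h s o\<^sub>L monomial_op k t = monomial_op (\<lambda>y. h y * k (\<phi> (inv s) y)) (s \<otimes> t)"
  proof (rule blinfun_eqI, rule ell2_eqI)
    fix \<xi> \<gamma>
    show "Rep_ell2 ((monomial_op h s o\<^sub>L monomial_op k t) \<xi>) \<gamma> = Rep_ell2 (monomial_op (\<lambda>y. h y * k (\<phi> (inv s) y)) (s \<otimes> t) \<xi>) \<gamma>"
      using assms c by (cases "\<gamma> \<in> germs G \<phi>")
        (simp_all add: monomial_op_apply germ_weight_def lact_germs lact_lact inv_mult_group)
  qed
qed

lemma monomial_op_adj:
  assumes "continuous_on UNIV h" "s \<in> carrier G"
  shows "ell2_adj (monomial_op h s) = monomial_op (\<lambda>y. cnj (h (\<phi> s y))) (inv s)"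
    and "continuous_on UNIV (\<lambda>y. cnj (h (\<phi> s y)))"
proof -
  show c: "continuous_on UNIV (\<lambda>y. cnj (h (\<phi> s y)))"
    using assms cont[of s] by (intro continuous_on_cnj) (auto intro: continuous_on_compose2)
  show "ell2_adj (monomial_op h s) = monomial_op (\<lambda>y. cnj (h (\<phi> s y))) (inv s)"
  proof (rule clinear_op_eqI)
    fix i j
    have "Rep_ell2 (ell2_adj (monomial_op h s) (ket j)) i = cnj (germ_weight h j * (if lact (inv s) j = i then 1 else 0))"
      using assms by (simp add: ell2_adj_coeff clinear_op_monomial_op monomial_op_apply ket.rep_eq)
    also have "\<dots> = germ_weight (\<lambda>y. cnj (h (\<phi> s y))) i * (if lact s i = j then 1 else 0)"
      using lact_eq_iff[OF assms(2), of j i] lact_germs[OF assms(2), of i] lact_germs(1)[of "inv s" j] assms(2)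
      by (auto simp: germ_weight_def)
    also have "\<dots> = Rep_ell2 (monomial_op (\<lambda>y. cnj (h (\<phi> s y))) (inv s) (ket j)) i"
      using c assms(2) by (simp add: monomial_op_apply ket.rep_eq)
    finally show "Rep_ell2 (ell2_adj (monomial_op h s) (ket j)) i = Rep_ell2 (monomial_op (\<lambda>y. cnj (h (\<phi> s y))) (inv s) (ket j)) i" .
  qed (use assms c in \<open>auto intro: clinear_op_adj clinear_op_monomial_op\<close>)
qed

section \<open>The topology on germs and bisections of group elements\<close>

lemma openin_trans_iff:
  "openin (trans_topology G :: ('g \<times> 'x) topology) S \<longleftrightarrow>
     S \<subseteq> carrier G \<times> UNIV \<and> (\<forall>g\<in>carrier G. open {x. (g, x) \<in> S})"
proof (intro iffI conjI ballI)
  assume S: "openin (trans_topology G) S"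
  show "S \<subseteq> carrier G \<times> UNIV" using openin_subset[OF S] by (simp add: trans_topology_topspace)
  fix g assume g: "g \<in> carrier G"
  have "continuous_map euclidean (trans_topology G :: ('g \<times> 'x) topology) (\<lambda>x. (g, x))"
    unfolding trans_topology_def by (rule continuous_map_pairedI) (use g in auto)
  from openin_continuous_map_preimage[OF this S] show "open {x. (g, x) \<in> S}"
    by simp
next
  assume S: "S \<subseteq> carrier G \<times> UNIV \<and> (\<forall>g\<in>carrier G. open {x. (g, x) \<in> S})"
  show "openin (trans_topology G) S"
    unfolding trans_topology_def openin_prod_topology_alt
  proof (intro allI impI)
    fix g x assume "(g, x) \<in> S"
    then show "\<exists>U V. openin (discrete_topology (carrier G)) U \<and> openin euclidean V \<and>
        g \<in> U \<and> x \<in> V \<and> U \<times> V \<subseteq> S"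
      using S by (intro exI[of _ "{g}"] exI[of _ "{x. (g, x) \<in> S}"]) auto
  qed
qed

lemma openin_germ_iff:
  "openin (germ_topology G \<phi>) W \<longleftrightarrow> W \<subseteq> germs G \<phi> \<and> (\<forall>g\<in>carrier G. open {x. gm g x \<in> W})"
  unfolding openin_germ_topology openin_trans_iff by (auto cong: conj_cong)

lemma topspace_germ_topology: "topspace (germ_topology G \<phi>) = germs G \<phi>"
proof (rule antisym)
  show "topspace (germ_topology G \<phi>) \<subseteq> germs G \<phi>"
    using openin_topspace[of "germ_topology G \<phi>"] by (simp only: openin_germ_iff)
  have "openin (germ_topology G \<phi>) (germs G \<phi>)" by (auto simp: openin_germ_iff gm_in_germs)
  then show "germs G \<phi> \<subseteq> topspace (germ_topology G \<phi>)" by (rule openin_subset)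
qed

lemma continuous_map_gm: "s \<in> carrier G \<Longrightarrow> continuous_map euclidean (germ_topology G \<phi>) (gm s)"
  unfolding continuous_map_def topspace_germ_topology openin_germ_iff
  by (auto simp: gm_in_germs)

lemma continuous_map_src: "continuous_map (germ_topology G \<phi>) euclidean src"
  unfolding continuous_map_def topspace_germ_topology openin_germ_iff
  by (auto simp: gm_in_germs src_gm cong: conj_cong)

lemma continuous_map_rng: "continuous_map (germ_topology G \<phi>) euclidean rng"
  unfolding continuous_map_def topspace_germ_topology openin_germ_iff
proof (intro conjI allI impI ballI)
  fix W g assume "openin euclidean (W :: 'x set)" and g: "g \<in> carrier G"
  then have "open (\<phi> g -` W)" using cont[OF g] by (auto intro: open_vimage)
  moreover have "{x. gm g x \<in> {\<gamma> \<in> germs G \<phi>. rng \<gamma> \<in> W}} = \<phi> g -` W"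
    using g by (auto simp: gm_in_germs rng_gm)
  ultimately show "open {x. gm g x \<in> {\<gamma> \<in> germs G \<phi>. rng \<gamma> \<in> W}}" by simp
qed auto

text \<open>Equal germs at a point stay equal nearby. The set need not be closed, which is the
  failure of the Hausdorff property and the reason why diagonals are only Borel functions.\<close>

lemma open_fix_germ:
  assumes "g \<in> carrier G" "s \<in> carrier G"
  shows "open {x. gm g x \<in> range (gm s)}"
proof (subst open_subopen, rule ballI)
  fix x assume "x \<in> {x. gm g x \<in> range (gm s)}"
  then obtain y where "gm g x = gm s y" by auto
  then obtain V where V: "open V" "x \<in> V" "\<forall>z\<in>V. \<phi> g z = \<phi> s z" using assms by (auto simp: gm_eq_iff)
  have "gm g z = gm s z" if "z \<in> V" for z using V that assms by (auto simp: gm_eq_iff)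
  then show "\<exists>T. open T \<and> x \<in> T \<and> T \<subseteq> {x. gm g x \<in> range (gm s)}" using V by blast
qed

text \<open>Source and range are inverted explicitly, by \<open>gm s\<close> and by
  \<open>gm s\<close> after the inverse of \<open>s\<close>.\<close>

lemma range_gm_bisection:
  assumes s: "s \<in> carrier G"
  shows "open_bisection G \<phi> (range (gm s))"
proof -
  let ?T = "germ_topology G \<phi>" and ?U = "range (gm s)"
  have sub: "?U \<subseteq> germs G \<phi>" using s by (auto simp: gm_in_germs)
  have op: "openin ?T ?U" using sub s by (simp add: openin_germ_iff open_fix_germ)
  have im: "src ` ?U = UNIV" "rng ` ?U = UNIV"
    using s act_inv_right[OF s] by (auto simp: image_image src_gm rng_gm surj_def) metis
  have cgm: "continuous_map euclidean (subtopology ?T ?U) (gm s)"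
    using continuous_map_gm[OF s] by (simp add: continuous_map_in_subtopology)
  have "homeomorphic_maps (subtopology ?T ?U) euclidean src (gm s)"
    unfolding homeomorphic_maps_def
    using s cgm continuous_map_from_subtopology[OF continuous_map_src] by (auto simp: src_gm)
  moreover have "homeomorphic_maps (subtopology ?T ?U) euclidean rng (gm s \<circ> \<phi> (inv s))"
    unfolding homeomorphic_maps_def
  proof (intro conjI)
    have "continuous_map euclidean euclidean (\<phi> (inv s))" using cont[of "inv s"] s by simp
    then show "continuous_map euclidean (subtopology ?T ?U) (gm s \<circ> \<phi> (inv s))"
      using cgm by (rule continuous_map_compose)
    show "continuous_map (subtopology ?T ?U) euclidean rng"
      by (rule continuous_map_from_subtopology[OF continuous_map_rng])
  qed (use s in \<open>auto simp: rng_gm act_inv_left act_inv_right\<close>)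
  ultimately show ?thesis
    unfolding open_bisection_def im using op homeomorphic_map_maps by auto
qed

lemma monomial_Cc:
  assumes s: "s \<in> carrier G" and h: "continuous_on UNIV h"
  shows "monomial h s \<in> Cc G \<phi> (range (gm s))"
proof -
  let ?T = "germ_topology G \<phi>" and ?U = "range (gm s)"
  have "continuous_map (subtopology ?T ?U) euclidean (h \<circ> rng)"
    by (rule continuous_map_compose[OF continuous_map_from_subtopology[OF continuous_map_rng]]) (use h in simp)
  then have "continuous_map (subtopology ?T ?U) euclidean (monomial h s)"
    by (rule continuous_map_eq) (auto simp: monomial_def)
  moreover have "compactin ?T ?U"
    by (rule image_compactin[OF _ continuous_map_gm[OF s]]) (use compact_UNIV in simp)
  ultimately show ?thesis unfolding Cc_def by (auto simp: monomial_def intro!: exI[of _ ?U])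
qed

text \<open>Finite sums of monomials are kept as lists, so that sums, products and adjoints can be
  handled by concatenation and induction; the representation of a function as such a sum is not
  unique.\<close>

definition valid_terms :: "(('x \<Rightarrow> complex) \<times> 'g) list \<Rightarrow> bool" where
  "valid_terms xs \<longleftrightarrow> (\<forall>(h, s)\<in>set xs. continuous_on UNIV h \<and> s \<in> carrier G)"

definition term_fun :: "(('x \<Rightarrow> complex) \<times> 'g) list \<Rightarrow> ('g \<times> 'x) set \<Rightarrow> complex" where
  "term_fun xs \<gamma> = (\<Sum>(h, s)\<leftarrow>xs. monomial h s \<gamma>)"

definition term_op :: "(('x \<Rightarrow> complex) \<times> 'g) list \<Rightarrow> ('g, 'x) germ_op" where
  "term_op xs = (\<Sum>(h, s)\<leftarrow>xs. monomial_op h s)"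

lemma valid_terms_simps [simp]:
  "valid_terms []" "valid_terms ((h, s) # xs) \<longleftrightarrow> continuous_on UNIV h \<and> s \<in> carrier G \<and> valid_terms xs"
  "valid_terms (xs @ ys) \<longleftrightarrow> valid_terms xs \<and> valid_terms ys"
  by (auto simp: valid_terms_def)

lemma term_simps [simp]:
  "term_fun [] \<gamma> = 0" "term_fun ((h, s) # xs) \<gamma> = monomial h s \<gamma> + term_fun xs \<gamma>"
  "term_fun (xs @ ys) \<gamma> = term_fun xs \<gamma> + term_fun ys \<gamma>"
  "term_op [] = 0" "term_op ((h, s) # xs) = monomial_op h s + term_op xs"
  "term_op (xs @ ys) = term_op xs + term_op ys"
  by (simp_all add: term_fun_def term_op_def)

lemma term_fun_nth: "term_fun xs \<gamma> = (\<Sum>i<length xs. monomial (fst (xs ! i)) (snd (xs ! i)) \<gamma>)"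
  by (simp add: term_fun_def sum_list_sum_nth atLeast0LessThan case_prod_unfold)

lemma valid_terms_nth:
  assumes "valid_terms xs" "i < length xs"
  shows "continuous_on UNIV (fst (xs ! i))" "snd (xs ! i) \<in> carrier G"
  using assms nth_mem[of i xs] by (auto simp: valid_terms_def case_prod_unfold)

lemma lreg_term_fun:
  assumes "valid_terms xs"
  shows "lreg G \<phi> (term_fun xs) = term_op xs"
proof -
  have "lreg G \<phi> (term_fun xs) = (\<Sum>i<length xs. monomial_op (fst (xs ! i)) (snd (xs ! i)))"
    unfolding term_fun_nth[abs_def] using assms by (intro lreg_sum_monomial valid_terms_nth)
  also have "\<dots> = term_op xs"
    by (simp add: term_op_def sum_list_sum_nth atLeast0LessThan case_prod_unfold)
  finally show ?thesis .
qed

text \<open>Over a neighbourhood of each source of the support, the bisection \<open>U\<close>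
  coincides with the germs of one group element. Finitely many such neighbourhoods cover the compact
  set of sources, and a partition of unity cuts \<open>f\<close> into monomials.\<close>

lemma Cc_decompose:
  assumes U: "open_bisection G \<phi> U" and f: "f \<in> Cc G \<phi> U"
  obtains xs where "valid_terms xs" "f = term_fun xs"
proof -
  let ?T = "germ_topology G \<phi>"
  obtain K where K: "K \<subseteq> U" "compactin ?T K" "\<And>\<gamma>. \<gamma> \<notin> K \<Longrightarrow> f \<gamma> = 0"
    and fc: "continuous_map (subtopology ?T U) euclidean f"
    using f by (auto simp: Cc_def)
  have opU: "openin ?T U" and hom: "homeomorphic_map (subtopology ?T U) (top_of_set (src ` U)) src"
    using U by (auto simp: open_bisection_def)
  have Ug: "U \<subseteq> germs G \<phi>" using opU by (simp add: openin_germ_iff)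
  have inj: "inj_on src U"
    using homeomorphic_imp_injective_map[OF hom] Ug by (simp add: topspace_germ_topology Int_absorb1)
  define C where "C = src ` K"
  have C: "compact C" using image_compactin[OF K(2) continuous_map_src] by (simp add: C_def)
  have "\<forall>x\<in>C. \<exists>s\<in>carrier G. gm s x \<in> K"
  proof
    fix x assume "x \<in> C"
    then obtain \<gamma> where "\<gamma> \<in> K" "x = src \<gamma>" by (auto simp: C_def)
    moreover obtain g where "g \<in> carrier G" "\<gamma> = gm g (src \<gamma>)"
      using germsE[of \<gamma>] \<open>\<gamma> \<in> K\<close> K(1) Ug by blast
    ultimately show "\<exists>s\<in>carrier G. gm s x \<in> K" by metis
  qed
  then obtain s where s: "\<And>x. x \<in> C \<Longrightarrow> s x \<in> carrier G" "\<And>x. x \<in> C \<Longrightarrow> gm (s x) x \<in> K"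
    by metis
  define W where "W x = {y. gm (s x) y \<in> U}" for x
  have W: "open (W x)" "x \<in> W x" if "x \<in> C" for x
    using that opU s K(1) by (auto simp: W_def openin_germ_iff)
  have "\<forall>x\<in>C. \<exists>k :: 'x \<Rightarrow> real. continuous_on UNIV k \<and> k x = 0 \<and> (\<forall>y. y \<notin> W x \<longrightarrow> k y = 1)"
  proof
    fix x assume "x \<in> C"
    with Urysohn_compact_t2[OF compact_UNIV W(1) W(2)]
    show "\<exists>k :: 'x \<Rightarrow> real. continuous_on UNIV k \<and> k x = 0 \<and> (\<forall>y. y \<notin> W x \<longrightarrow> k y = 1)" by metis
  qed
  then obtain k :: "'x \<Rightarrow> 'x \<Rightarrow> real" where k: "\<And>x. x \<in> C \<Longrightarrow> continuous_on UNIV (k x)"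
    "\<And>x. x \<in> C \<Longrightarrow> k x x = 0" "\<And>x y. x \<in> C \<Longrightarrow> y \<notin> W x \<Longrightarrow> k x y = 1"
    by metis
  \<comment> \<open>\<open>q x\<close> vanishes where \<open>k x > 1/2\<close>, an open set which
    together with \<open>W x\<close> covers the space. This margin makes extension by zero
    continuous.\<close>
  define q where "q x y = max 0 (1 - 2 * k x y)" for x y
  have q: "continuous_on UNIV (q x)" if "x \<in> C" for x
    unfolding q_def by (intro continuous_intros k that)
  have q0: "q x y \<ge> 0" for x y by (simp add: q_def)
  have "open {y. q x y > 1/2}" if "x \<in> C" for x
    using open_Collect_less[OF continuous_on_const q[OF that]] .
  moreover have "C \<subseteq> (\<Union>x\<in>C. {y. q x y > 1/2})" using k(2) by (auto simp: q_def)
  ultimately obtain F where F: "F \<subseteq> C" "finite F" "C \<subseteq> (\<Union>x\<in>F. {y. q x y > 1/2})"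
    using compactE_image[OF C, of C "\<lambda>x. {y. q x y > 1/2}"] by blast
  \<comment> \<open>The lower bound \<open>1/2\<close> keeps the denominator positive everywhere and
    changes nothing on \<open>C\<close>, where some \<open>q x\<close> exceeds it.\<close>
  define S where "S y = max (\<Sum>x\<in>F. q x y) (1/2)" for y
  have S: "continuous_on UNIV S" "\<And>y. S y > 0"
    unfolding S_def using F(1) by (auto intro!: continuous_intros q)
  define p where "p x y = q x y / S y" for x y
  have p: "continuous_on UNIV (p x)" if "x \<in> C" for x
    unfolding p_def using S(2) by (intro continuous_on_divide q[OF that] S(1)) (auto simp: less_imp_neq[symmetric])
  have p_sum: "(\<Sum>x\<in>F. p x y) = 1" if y: "y \<in> C" for y
  proof -
    obtain x where x: "x \<in> F" "q x y > 1/2" using subsetD[OF F(3) y] by auto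
    have "q x y \<le> (\<Sum>x\<in>F. q x y)" using x(1) F(2) q0 by (intro member_le_sum) auto
    then have "S y = (\<Sum>x\<in>F. q x y)" using x(2) by (simp add: S_def)
    then show ?thesis using S(2)[of y] by (simp add: p_def flip: sum_divide_distrib)
  qed
  have p_out: "p x y = 0" if "x \<in> C" "y \<notin> W x" for x y
    using k(3)[OF that] by (simp add: p_def q_def)
  define h' where "h' x y = (if y \<in> W x then complex_of_real (p x y) * f (gm (s x) y) else 0)" for x y
  have h': "continuous_on UNIV (h' x)" if x: "x \<in> C" for x
  proof -
    have "continuous_map (top_of_set (W x)) (subtopology ?T U) (gm (s x))"
      using continuous_map_from_subtopology[OF continuous_map_gm[OF s(1)[OF x]]]
      by (auto simp: continuous_map_in_subtopology W_def)
    then have "continuous_map (top_of_set (W x)) euclidean (f \<circ> gm (s x))"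
      using fc by (rule continuous_map_compose)
    then have "continuous_on (W x) (\<lambda>y. f (gm (s x) y))" by (simp add: o_def)
    then have "continuous_on (W x) (\<lambda>y. complex_of_real (p x y) * f (gm (s x) y))"
      using continuous_on_subset[OF p[OF x]] by (intro continuous_intros) auto
    then have 1: "continuous_on (W x) (h' x)"
      by (rule continuous_on_eq) (simp add: h'_def)
    have 2: "continuous_on {y. k x y > 1/2} (h' x)"
      by (rule continuous_on_eq[OF continuous_on_const[of _ 0]]) (auto simp: h'_def p_def q_def)
    have "open {y. k x y > 1/2}" using open_Collect_less[OF continuous_on_const k(1)[OF x]] .
    moreover have "W x \<union> {y. k x y > 1/2} = UNIV" using k(3)[OF x] by force
    ultimately show ?thesis using continuous_on_open_Un[OF W(1)[OF x] _ 1 2] by simp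
  qed
  \<comment> \<open>The pieces were built in the source coordinate, while monomials read their
    coefficient at the range.\<close>
  define h where "h x y = h' x (\<phi> (inv (s x)) y)" for x y
  have h: "continuous_on UNIV (h x)" if "x \<in> C" for x
    unfolding h_def using h'[OF that] cont[of "inv (s x)"] s(1)[OF that]
    by (auto intro: continuous_on_compose2)
  have mon: "monomial (h x) (s x) (gm (s x) y) = h' x y" if "x \<in> C" for x y
    using s(1)[OF that] by (simp add: monomial_def h_def rng_gm act_inv_left)
  have eq: "f \<gamma> = (\<Sum>x\<in>F. monomial (h x) (s x) \<gamma>)" for \<gamma>
  proof (cases "\<gamma> \<in> K")
    case True
    define y where "y = src \<gamma>"
    have y: "y \<in> C" using True by (simp add: C_def y_def)
    have "monomial (h x) (s x) \<gamma> = complex_of_real (p x y) * f \<gamma>" if x: "x \<in> F" for x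
    proof (cases "y \<in> W x")
      case True
      have xC: "x \<in> C" using x F(1) by blast
      have "gm (s x) y \<in> U" using True by (simp add: W_def)
      moreover have "src (gm (s x) y) = src \<gamma>" using s(1)[OF xC] by (simp add: src_gm y_def)
      ultimately have "gm (s x) y = \<gamma>" using inj \<open>\<gamma> \<in> K\<close> K(1) by (auto dest: inj_onD)
      then show ?thesis using mon[OF xC, of y] True by (simp add: h'_def)
    next
      case False
      have xC: "x \<in> C" using x F(1) by blast
      have "\<gamma> \<notin> range (gm (s x))"
      proof
        assume "\<gamma> \<in> range (gm (s x))"
        then obtain z where "\<gamma> = gm (s x) z" by auto
        then have "\<gamma> = gm (s x) y" using s(1)[OF xC] by (simp add: y_def src_gm)
        then show False using False \<open>\<gamma> \<in> K\<close> K(1) by (auto simp: W_def)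
      qed
      then show ?thesis using p_out[OF xC False] by (simp add: monomial_def)
    qed
    then have "(\<Sum>x\<in>F. monomial (h x) (s x) \<gamma>) = complex_of_real (\<Sum>x\<in>F. p x y) * f \<gamma>"
      by (simp add: sum_distrib_right)
    then show ?thesis using p_sum[OF y] by simp
  next
    case False
    have "monomial (h x) (s x) \<gamma> = 0" if x: "x \<in> F" for x
    proof (cases "\<gamma> \<in> range (gm (s x))")
      case True
      then obtain y where y: "\<gamma> = gm (s x) y" by auto
      have "x \<in> C" using x F(1) by blast
      then show ?thesis using mon[of x y] K(3)[OF False] unfolding y by (simp add: h'_def)
    qed (simp add: monomial_def)
    then show ?thesis using K(3)[OF False] by simp
  qed
  obtain zs where zs: "set zs = F" "distinct zs" using finite_distinct_list[OF F(2)] by blast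
  have "valid_terms (map (\<lambda>x. (h x, s x)) zs)"
    using F(1) h s(1) by (auto simp: valid_terms_def zs(1))
  moreover have "f = term_fun (map (\<lambda>x. (h x, s x)) zs)"
    using zs by (auto simp: fun_eq_iff term_fun_def o_def eq sum_list_distinct_conv_sum_set)
  ultimately show ?thesis using that by blast
qed

lemma valid_terms_scale: "valid_terms xs \<Longrightarrow> valid_terms (map (\<lambda>(h, s). (\<lambda>y. c * h y, s)) xs)"
  by (auto simp: valid_terms_def intro!: continuous_intros)

lemma term_fun_scale: "term_fun (map (\<lambda>(h, s). (\<lambda>y. c * h y, s)) xs) \<gamma> = c * term_fun xs \<gamma>"
  by (induction xs) (auto simp: monomial_def algebra_simps)

text \<open>Arbitrary open bisections disappear from here on: the convolution algebra is the image
  of the algebraic crossed product of the continuous functions by \<open>G\<close>.\<close>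

lemma conv_alg_eq: "conv_alg G \<phi> = {term_fun xs | xs. valid_terms xs}"
proof (intro subset_antisym subsetI)
  fix f assume "f \<in> conv_alg G \<phi>"
  then obtain n :: nat and c k where f: "f = (\<lambda>\<gamma>. \<Sum>i<n. c i * k i \<gamma>)"
    and k: "\<And>i. i < n \<Longrightarrow> \<exists>U. open_bisection G \<phi> U \<and> k i \<in> Cc G \<phi> U"
    unfolding conv_alg_def by blast
  have "\<exists>xs. valid_terms xs \<and> (\<lambda>\<gamma>. \<Sum>i<m. c i * k i \<gamma>) = term_fun xs" if "m \<le> n" for m
    using that
  proof (induction m)
    case 0
    show ?case by (intro exI[of _ "[]"]) (simp add: fun_eq_iff)
  next
    case (Suc m)
    obtain xs where xs: "valid_terms xs" "(\<lambda>\<gamma>. \<Sum>i<m. c i * k i \<gamma>) = term_fun xs"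
      using Suc by auto
    obtain U where U: "open_bisection G \<phi> U" "k m \<in> Cc G \<phi> U" using k[of m] Suc.prems by auto
    obtain ys where ys: "valid_terms ys" "k m = term_fun ys" by (rule Cc_decompose[OF U])
    show ?case using xs ys
      by (intro exI[of _ "xs @ map (\<lambda>(h, s). (\<lambda>y. c m * h y, s)) ys"])
        (auto simp: fun_eq_iff term_fun_scale intro: valid_terms_scale)
  qed
  then show "f \<in> {term_fun xs | xs. valid_terms xs}" unfolding f by blast
next
  fix f assume "f \<in> {term_fun xs | xs. valid_terms xs}"
  then obtain xs where xs: "f = term_fun xs" "valid_terms xs" by blast
  have "f = (\<lambda>\<gamma>. \<Sum>i<length xs. 1 * monomial (fst (xs ! i)) (snd (xs ! i)) \<gamma>)"
    unfolding xs(1) by (simp add: fun_eq_iff term_fun_nth)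
  moreover have "\<forall>i<length xs. \<exists>U. open_bisection G \<phi> U \<and> monomial (fst (xs ! i)) (snd (xs ! i)) \<in> Cc G \<phi> U"
    using range_gm_bisection monomial_Cc valid_terms_nth[OF xs(2)] by blast
  ultimately show "f \<in> conv_alg G \<phi>"
    unfolding conv_alg_def
    by (intro CollectI exI[of _ "length xs"] exI[of _ "\<lambda>_. 1"]
        exI[of _ "\<lambda>i. monomial (fst (xs ! i)) (snd (xs ! i))"] conjI)
qed

lemma lreg_conv_alg: "lreg G \<phi> ` conv_alg G \<phi> = {term_op xs | xs. valid_terms xs}"
  unfolding conv_alg_eq using lreg_term_fun by (auto simp: image_iff) metis

section \<open>Closure of finite sums under scaling, products and adjoints\<close>

lemma term_op_scale:
  assumes "valid_terms xs"
  shows "term_op (map (\<lambda>(h, s). (\<lambda>y. complex_of_real c * h y, s)) xs) = c *\<^sub>R term_op xs"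
proof -
  have "monomial_op (\<lambda>y. complex_of_real c * h y) s = c *\<^sub>R monomial_op h s" if "continuous_on UNIV h" "s \<in> carrier G" for h s
    by (intro blinfun_eqI ell2_eqI)
      (use that in \<open>simp add: monomial_op_apply continuous_on_mult blinfun.scaleR_left ell2_reps germ_weight_def\<close>)
  then show ?thesis using assms by (induction xs) (auto simp: scaleR_add_right)
qed

lemma term_op_mult:
  assumes "valid_terms xs" "valid_terms ys"
  obtains zs where "valid_terms zs" "term_op xs o\<^sub>L term_op ys = term_op zs"
proof -
  have one: "\<exists>zs. valid_terms zs \<and> monomial_op h s o\<^sub>L term_op ys = term_op zs"
    if "continuous_on UNIV h" "s \<in> carrier G" for h s
    using assms(2)
  proof (induction ys)
    case Nil
    show ?case by (intro exI[of _ "[]"]) (auto intro: blinfun_eqI)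
  next
    case (Cons y ys)
    obtain k t where y: "y = (k, t)" by (cases y)
    obtain zs where zs: "valid_terms zs" "monomial_op h s o\<^sub>L term_op ys = term_op zs" using Cons y by auto
    have "monomial_op h s o\<^sub>L term_op (y # ys) = term_op (((\<lambda>y. h y * k (\<phi> (inv s) y)), s \<otimes> t) # zs)"
      using monomial_op_mult(1)[OF that] Cons.prems y zs(2)
      by (simp add: y bounded_bilinear.add_right[OF bounded_bilinear_blinfun_compose] flip: zs(2))
    then show ?case using monomial_op_mult(2)[OF that] Cons.prems y zs(1) that(2)
      by (intro exI[of _ "((\<lambda>y. h y * k (\<phi> (inv s) y)), s \<otimes> t) # zs"]) auto
  qed
  have "\<exists>zs. valid_terms zs \<and> term_op xs o\<^sub>L term_op ys = term_op zs"
    using assms(1)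
  proof (induction xs)
    case Nil
    show ?case by (intro exI[of _ "[]"]) (auto intro: blinfun_eqI)
  next
    case (Cons x xs)
    obtain h s where x: "x = (h, s)" by (cases x)
    obtain zs where zs: "valid_terms zs" "term_op xs o\<^sub>L term_op ys = term_op zs" using Cons x by auto
    obtain ws where ws: "valid_terms ws" "monomial_op h s o\<^sub>L term_op ys = term_op ws" using one[of h s] Cons.prems x by auto
    show ?case using zs ws
      by (intro exI[of _ "ws @ zs"])
        (simp add: x bounded_bilinear.add_left[OF bounded_bilinear_blinfun_compose])
  qed
  then show ?thesis using that by blast
qed

lemma clinear_op_term_op: "valid_terms xs \<Longrightarrow> clinear_op (term_op xs)"
proof (induction xs)
  case (Cons x xs)
  then show ?case by (cases x) (auto intro!: clinear_op_add clinear_op_monomial_op)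
qed (simp add: clinear_op_0)

lemma term_op_adj:
  assumes "valid_terms xs"
  obtains zs where "valid_terms zs" "ell2_adj (term_op xs) = term_op zs"
proof -
  have "\<exists>zs. valid_terms zs \<and> ell2_adj (term_op xs) = term_op zs"
    using assms
  proof (induction xs)
    case Nil
    have "ell2_adj 0 = (0 :: ('g, 'x) germ_op)"
      by (rule ell2_adj_eqI) (simp add: ell2_cinner_def ell2_reps)
    then show ?case by (intro exI[of _ "[]"]) simp
  next
    case (Cons x xs)
    obtain h s where x: "x = (h, s)" by (cases x)
    obtain zs where zs: "valid_terms zs" "ell2_adj (term_op xs) = term_op zs" using Cons x by auto
    show ?case using zs Cons.prems monomial_op_adj[of h s]
      by (intro exI[of _ "(\<lambda>y. cnj (h (\<phi> s y)), inv s) # zs"])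
        (simp add: x ell2_adj_add clinear_op_monomial_op clinear_op_term_op)
  qed
  then show ?thesis using that by blast
qed

end

section \<open>Meager sets and the Dixmier algebra\<close>

lemma meager_subset: "meager S \<Longrightarrow> T \<subseteq> S \<Longrightarrow> meager T"
  unfolding meager_def by (meson subset_trans)

lemma meager_nowhere_dense: "interior (closure N) = {} \<Longrightarrow> meager N"
  unfolding meager_def by (intro exI[of _ "\<lambda>_. N"]) auto

lemma meager_empty: "meager {}"
  by (rule meager_nowhere_dense) simp

lemma meager_countable_UN:
  assumes I: "countable I" and S: "\<And>i. i \<in> I \<Longrightarrow> meager (S i)"
  shows "meager (\<Union>i\<in>I. S i)"
proof (cases "I = {}")
  case False
  have "\<forall>i\<in>I. \<exists>N :: nat \<Rightarrow> 'b set. (\<forall>n. interior (closure (N n)) = {}) \<and> S i \<subseteq> (\<Union>n. N n)"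
    using S by (auto simp: meager_def)
  then obtain N :: "'a \<Rightarrow> nat \<Rightarrow> 'b set" where
    N: "\<And>i n. i \<in> I \<Longrightarrow> interior (closure (N i n)) = {}" "\<And>i. i \<in> I \<Longrightarrow> S i \<subseteq> (\<Union>n. N i n)"
    by metis
  define K where "K m = N (from_nat_into I (fst (prod_decode m))) (snd (prod_decode m))" for m
  have "interior (closure (K m)) = {}" for m
    unfolding K_def by (rule N(1)) (rule from_nat_into[OF False])
  moreover have "(\<Union>i\<in>I. S i) \<subseteq> (\<Union>m. K m)"
  proof
    fix x assume "x \<in> (\<Union>i\<in>I. S i)"
    then obtain i n where i: "i \<in> I" "x \<in> N i n" using N(2) by blast
    obtain j where j: "from_nat_into I j = i" using from_nat_into_surj[OF I i(1)] by blast
    have "x \<in> K (prod_encode (j, n))" using i(2) j by (simp add: K_def)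
    then show "x \<in> (\<Union>m. K m)" by blast
  qed
  ultimately show ?thesis unfolding meager_def by blast
qed (simp add: meager_empty)

lemma meager_Un: "meager S \<Longrightarrow> meager T \<Longrightarrow> meager (S \<union> T)"
  using meager_countable_UN[of "{True, False}" "\<lambda>b. if b then S else T"] by (simp add: Un_commute)

text \<open>Needed to translate meager sets by group elements: an open set in the closure of the
  preimage of \<open>N n\<close> is carried by the homeomorphism into the closure of
  \<open>N n\<close>.\<close>

lemma meager_vimage_homeo:
  assumes f: "continuous_on UNIV f" and g: "continuous_on UNIV g"
    and fg: "\<And>y. f (g y) = y" "\<And>x. g (f x) = x" and S: "meager S"
  shows "meager (f -` S)"
proof -
  obtain N where N: "\<And>n :: nat. interior (closure (N n)) = {}" "S \<subseteq> (\<Union>n. N n)"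
    using S by (auto simp: meager_def)
  have "interior (closure (f -` N n)) = {}" for n
  proof (rule ccontr)
    assume "interior (closure (f -` N n)) \<noteq> {}"
    then obtain U x where U: "open U" "x \<in> U" "U \<subseteq> closure (f -` N n)"
      by (auto simp: interior_def)
    have "g -` U \<subseteq> closure (N n)"
    proof
      fix y assume y: "y \<in> g -` U"
      show "y \<in> closure (N n)" unfolding closure_iff_nhds_not_empty
      proof (intro allI impI)
        fix A W assume W: "W \<subseteq> A" "open W" "y \<in> W"
        have "open (f -` W)" "g y \<in> f -` W" using W f fg by (auto intro: open_vimage)
        moreover have "g y \<in> closure (f -` N n)" using y U(3) by blast
        ultimately have "f -` N n \<inter> f -` W \<noteq> {}" unfolding closure_iff_nhds_not_empty by blast
        then show "N n \<inter> A \<noteq> {}" using W by auto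
      qed
    qed
    moreover have "open (g -` U)" using U g by (auto intro: open_vimage)
    moreover have "f x \<in> g -` U" using U fg by simp
    ultimately have "f x \<in> interior (closure (N n))" by (auto intro: interiorI)
    then show False using N(1) by simp
  qed
  moreover have "f -` S \<subseteq> (\<Union>n. f -` N n)" using N(2) unfolding vimage_def by blast
  ultimately show ?thesis unfolding meager_def by (intro exI[of _ "\<lambda>n. f -` N n"] conjI allI)
qed

lemma bounded_borelI:
  "f \<in> borel_measurable borel \<Longrightarrow> (\<And>x. cmod (f x) \<le> B) \<Longrightarrow> f \<in> bounded_borel"
  by (auto simp: bounded_borel_def bounded_iff)

lemma dix_class_iff:
  "f \<in> bounded_borel \<Longrightarrow> g \<in> dix_class f \<longleftrightarrow> g \<in> bounded_borel \<and> meager {x. f x \<noteq> g x}"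
  by (simp add: dix_class_def dix_rel_def)

lemma dix_class_eq_iff:
  assumes "f \<in> bounded_borel" "g \<in> bounded_borel"
  shows "dix_class f = dix_class g \<longleftrightarrow> meager {x. f x \<noteq> g x}"
proof
  assume "dix_class f = dix_class g"
  moreover have "g \<in> dix_class g" using assms(2) by (simp add: dix_class_iff meager_empty)
  ultimately show "meager {x. f x \<noteq> g x}" using dix_class_iff[OF assms(1)] by blast
next
  assume m: "meager {x. f x \<noteq> g x}"
  have "meager {x. f x \<noteq> k x} \<longleftrightarrow> meager {x. g x \<noteq> k x}" for k
  proof
    assume "meager {x. f x \<noteq> k x}"
    from meager_Un[OF m this] show "meager {x. g x \<noteq> k x}" by (rule meager_subset) auto
  next
    assume "meager {x. g x \<noteq> k x}"
    from meager_Un[OF m this] show "meager {x. f x \<noteq> k x}" by (rule meager_subset) auto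
  qed
  then show "dix_class f = dix_class g" using assms by (auto simp: dix_class_iff)
qed

lemma Dix_iff: "D \<in> Dix \<longleftrightarrow> (\<exists>f\<in>bounded_borel. D = dix_class f)"
  by (auto simp: Dix_def quotient_def dix_class_def)

lemma bounded_borel_diff_bdd:
  assumes "f \<in> bounded_borel" "g \<in> bounded_borel"
  shows "bdd_above (range (\<lambda>x. cmod (f x - g x)))"
proof -
  obtain B C where "\<And>x. cmod (f x) \<le> B" "\<And>x. cmod (g x) \<le> C"
    using assms by (auto simp: bounded_borel_def bounded_iff)
  then have "cmod (f x - g x) \<le> B + C" for x
    by (meson add_mono norm_triangle_ineq4 order_trans)
  then show ?thesis by (intro bdd_aboveI2)
qed

lemma dix_class_subset: "f \<in> bounded_borel \<Longrightarrow> dix_class f \<subseteq> bounded_borel"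
  by (auto simp: dix_class_iff)

lemma dix_SUP_nonneg:
  assumes "f \<in> bounded_borel" "g \<in> bounded_borel"
  shows "0 \<le> (SUP x. cmod (f x - g x))"
  by (rule cSUP_upper2[OF bounded_borel_diff_bdd[OF assms] UNIV_I[of undefined]]) simp

text \<open>The infimum ranges over representatives, which may be altered on meager sets. A uniform
  bound on one pair therefore bounds the distance, whereas a small distance controls a given pair
  only off a meager set.\<close>

lemma
  assumes "f \<in> bounded_borel" "g \<in> bounded_borel"
  shows dix_dist_nonneg: "0 \<le> dix_dist (dix_class f) (dix_class g)"
    and dix_dist_le: "(\<And>x. cmod (f x - g x) \<le> c) \<Longrightarrow> dix_dist (dix_class f) (dix_class g) \<le> c"
    and dix_dist_less: "dix_dist (dix_class f) (dix_class g) < e \<Longrightarrow> meager {x. \<not> cmod (f x - g x) < e}"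
proof -
  let ?S = "\<lambda>(d, d'). SUP x. cmod (d x - d' x)"
  have ne: "(f, g) \<in> dix_class f \<times> dix_class g" using assms by (simp add: dix_class_iff meager_empty)
  have nn: "0 \<le> ?S p" if "p \<in> dix_class f \<times> dix_class g" for p
    using that assms by (auto intro!: dix_SUP_nonneg dest: dix_class_subset)
  have bdd: "bdd_below (?S ` (dix_class f \<times> dix_class g))" using nn by (rule bdd_belowI2)
  show "0 \<le> dix_dist (dix_class f) (dix_class g)"
    unfolding dix_dist_def using ne nn by (intro cINF_greatest) auto
  show "dix_dist (dix_class f) (dix_class g) \<le> c" if "\<And>x. cmod (f x - g x) \<le> c"
  proof -
    have "dix_dist (dix_class f) (dix_class g) \<le> ?S (f, g)"
      unfolding dix_dist_def by (rule cINF_lower[OF bdd ne])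
    also have "\<dots> \<le> c" using that by (auto intro: cSUP_least)
    finally show ?thesis .
  qed
  assume "dix_dist (dix_class f) (dix_class g) < e"
  then obtain p where "p \<in> dix_class f \<times> dix_class g" "?S p < e"
    unfolding dix_dist_def using ne by (subst (asm) cINF_less_iff[OF _ bdd]) blast+
  then obtain d d' where d: "d \<in> dix_class f" "d' \<in> dix_class g" "(SUP x. cmod (d x - d' x)) < e"
    by auto
  have "cmod (d x - d' x) < e" for x
    using cSUP_upper[OF UNIV_I bounded_borel_diff_bdd, of d d' x] d assms
    by (meson dix_class_subset le_less_trans subsetD)
  then have "{x. \<not> cmod (f x - g x) < e} \<subseteq> {x. f x \<noteq> d x} \<union> {x. g x \<noteq> d' x}" by auto
  moreover have "meager ({x. f x \<noteq> d x} \<union> {x. g x \<noteq> d' x})"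
    using d assms by (intro meager_Un) (auto simp: dix_class_iff)
  ultimately show "meager {x. \<not> cmod (f x - g x) < e}" by (rule meager_subset[rotated])
qed

section \<open>The conditional expectation and the essential ideal\<close>

lemma ell2_coeff_tendsto:
  assumes "T \<longlonglongrightarrow> a"
  shows "(\<lambda>n. Rep_ell2 (blinfun_apply (T n) \<xi>) i) \<longlonglongrightarrow> Rep_ell2 (blinfun_apply a \<xi>) i"
proof (rule LIM_zero_cancel, rule Lim_null_comparison)
  show "\<forall>\<^sub>F n in sequentially. norm (Rep_ell2 (T n \<xi>) i - Rep_ell2 (a \<xi>) i) \<le> norm (T n \<xi> - a \<xi>)"
    using ell2_coeff_le_norm[of "T _ \<xi> - a \<xi>" i] by (simp add: ell2_reps)
  have "(\<lambda>n. T n \<xi>) \<longlonglongrightarrow> a \<xi>" using assms by (intro tendsto_intros)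
  then have "(\<lambda>n. T n \<xi> - a \<xi>) \<longlonglongrightarrow> 0" by (rule LIM_zero)
  then show "(\<lambda>n. norm (T n \<xi> - a \<xi>)) \<longlonglongrightarrow> 0" by (rule tendsto_norm_zero)
qed

lemma clinear_op_limit:
  assumes "T \<longlonglongrightarrow> a" "\<And>n. clinear_op (T n)"
  shows "clinear_op a"
  unfolding clinear_op_def
proof (intro allI, rule ell2_eqI)
  fix c \<xi> i
  have "(\<lambda>n. Rep_ell2 (T n (cscale c \<xi>)) i) \<longlonglongrightarrow> Rep_ell2 (a (cscale c \<xi>)) i"
    by (rule ell2_coeff_tendsto[OF assms(1)])
  moreover have "(\<lambda>n. Rep_ell2 (T n (cscale c \<xi>)) i) \<longlonglongrightarrow> c * Rep_ell2 (a \<xi>) i"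
    unfolding clinear_opD[OF assms(2)] cscale.rep_eq
    by (intro tendsto_mult_left ell2_coeff_tendsto assms(1))
  ultimately show "Rep_ell2 (a (cscale c \<xi>)) i = Rep_ell2 (cscale c (a \<xi>)) i"
    unfolding cscale.rep_eq by (rule LIMSEQ_unique)
qed

locale countable_compact_action = compact_action G \<phi>
  for G :: "('g, 'm) monoid_scheme" (structure) and \<phi> :: "'g \<Rightarrow> 'x::t2_space \<Rightarrow> 'x" +
  assumes countable_G: "countable (carrier G)"
begin

section \<open>Algebraic closure and matrix coefficients of the reduced algebra\<close>

abbreviation "CR \<equiv> Cred G \<phi>"
abbreviation "I \<equiv> ess_ideal G \<phi>"

lemma Cred_iff: "a \<in> CR \<longleftrightarrow> (\<exists>xs. (\<forall>n. valid_terms (xs n)) \<and> (\<lambda>n. term_op (xs n)) \<longlonglongrightarrow> a)"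
proof
  assume "a \<in> CR"
  then obtain T where T: "\<And>n. T n \<in> {term_op xs | xs. valid_terms xs}" "T \<longlonglongrightarrow> a"
    unfolding Cred_def lreg_conv_alg closure_sequential by blast
  then have "\<forall>n. \<exists>xs. valid_terms xs \<and> T n = term_op xs" by blast
  then obtain xs where "\<And>n. valid_terms (xs n)" "\<And>n. T n = term_op (xs n)" by metis
  then show "\<exists>xs. (\<forall>n. valid_terms (xs n)) \<and> (\<lambda>n. term_op (xs n)) \<longlonglongrightarrow> a"
    using T(2) by (intro exI[of _ xs]) (simp add: ext[of T "\<lambda>n. term_op (xs n)"])
next
  assume "\<exists>xs. (\<forall>n. valid_terms (xs n)) \<and> (\<lambda>n. term_op (xs n)) \<longlonglongrightarrow> a"
  then obtain xs where "\<forall>n. valid_terms (xs n)" "(\<lambda>n. term_op (xs n)) \<longlonglongrightarrow> a" by blast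
  then show "a \<in> CR" unfolding Cred_def lreg_conv_alg closure_sequential
    by (intro exI[of _ "\<lambda>n. term_op (xs n)"]) blast
qed

lemma CredE:
  assumes "a \<in> CR"
  obtains xs where "\<And>n. valid_terms (xs n)" "(\<lambda>n. term_op (xs n)) \<longlonglongrightarrow> a"
  using assms unfolding Cred_iff by blast

lemma Cred_term_op: "valid_terms xs \<Longrightarrow> term_op xs \<in> CR"
  unfolding Cred_iff by (intro exI[of _ "\<lambda>_. xs"]) simp

lemma Cred_monomial_op: "continuous_on UNIV h \<Longrightarrow> s \<in> carrier G \<Longrightarrow> monomial_op h s \<in> CR"
  using Cred_term_op[of "[(h, s)]"] by simp

lemma Cred_0: "0 \<in> CR"
  using Cred_term_op[of "[]"] by simp

lemma clinear_op_Cred: "a \<in> CR \<Longrightarrow> clinear_op a"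
  by (erule CredE) (rule clinear_op_limit, assumption, rule clinear_op_term_op)

lemma Cred_add: "a \<in> CR \<Longrightarrow> b \<in> CR \<Longrightarrow> a + b \<in> CR"
proof (elim CredE)
  fix xs ys assume "\<And>n. valid_terms (xs n)" "(\<lambda>n. term_op (xs n)) \<longlonglongrightarrow> a"
    "\<And>n. valid_terms (ys n)" "(\<lambda>n. term_op (ys n)) \<longlonglongrightarrow> b"
  then show ?thesis unfolding Cred_iff
    by (intro exI[of _ "\<lambda>n. xs n @ ys n"]) (auto intro: tendsto_add)
qed

lemma Cred_scaleR: "a \<in> CR \<Longrightarrow> c *\<^sub>R a \<in> CR"
proof (elim CredE)
  fix xs assume "\<And>n. valid_terms (xs n)" "(\<lambda>n. term_op (xs n)) \<longlonglongrightarrow> a"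
  then show ?thesis unfolding Cred_iff
    by (intro exI[of _ "\<lambda>n. map (\<lambda>(h, s). (\<lambda>y. complex_of_real c * h y, s)) (xs n)"])
      (auto simp: term_op_scale intro: valid_terms_scale tendsto_scaleR)
qed

lemma Cred_mult: "a \<in> CR \<Longrightarrow> b \<in> CR \<Longrightarrow> a o\<^sub>L b \<in> CR"
proof (elim CredE)
  fix xs ys assume x: "\<And>n. valid_terms (xs n)" "(\<lambda>n. term_op (xs n)) \<longlonglongrightarrow> a"
    and y: "\<And>n. valid_terms (ys n)" "(\<lambda>n. term_op (ys n)) \<longlonglongrightarrow> b"
  have "\<forall>n. \<exists>zs. valid_terms zs \<and> term_op (xs n) o\<^sub>L term_op (ys n) = term_op zs"
    using term_op_mult[OF x(1) y(1)] by metis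
  then obtain zs where zs: "\<And>n. valid_terms (zs n)" "\<And>n. term_op (xs n) o\<^sub>L term_op (ys n) = term_op (zs n)"
    by metis
  have "(\<lambda>n. term_op (xs n) o\<^sub>L term_op (ys n)) \<longlonglongrightarrow> (a o\<^sub>L b)"
    by (rule bounded_bilinear.tendsto[OF bounded_bilinear_blinfun_compose x(2) y(2)])
  then show ?thesis unfolding Cred_iff zs(2) using zs(1) by blast
qed

lemma Cred_adj: "a \<in> CR \<Longrightarrow> ell2_adj a \<in> CR"
proof -
  assume a: "a \<in> CR"
  then obtain xs where x: "\<And>n. valid_terms (xs n)" "(\<lambda>n. term_op (xs n)) \<longlonglongrightarrow> a" by (rule CredE) blast
  have "\<forall>n. \<exists>zs. valid_terms zs \<and> ell2_adj (term_op (xs n)) = term_op zs"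
    using term_op_adj[OF x(1)] by metis
  then obtain zs where zs: "\<And>n. valid_terms (zs n)" "\<And>n. ell2_adj (term_op (xs n)) = term_op (zs n)"
    by metis
  have "(\<lambda>n. term_op (zs n) - ell2_adj a) \<longlonglongrightarrow> 0"
  proof (rule Lim_null_comparison)
    show "\<forall>\<^sub>F n in sequentially. norm (term_op (zs n) - ell2_adj a) \<le> norm (term_op (xs n) - a)"
      using a x(1) by (auto simp: clinear_op_term_op clinear_op_Cred
          simp flip: zs(2) ell2_adj_diff intro!: always_eventually norm_ell2_adj_le clinear_op_diff)
    show "(\<lambda>n. norm (term_op (xs n) - a)) \<longlonglongrightarrow> 0"
      using x(2) by (intro tendsto_norm_zero LIM_zero)
  qed
  then have "(\<lambda>n. term_op (zs n)) \<longlonglongrightarrow> ell2_adj a" by (rule LIM_zero_cancel)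
  with zs(1) show ?thesis unfolding Cred_iff by blast
qed

text \<open>Equality of two matrix coefficients survives finite sums and norm limits, so it has to
  be checked on monomials only.\<close>

lemma Cred_coeff_eqI:
  assumes a: "a \<in> CR"
    and eq: "\<And>h s. continuous_on UNIV h \<Longrightarrow> s \<in> carrier G \<Longrightarrow> Rep_ell2 (monomial_op h s \<xi>) i = Rep_ell2 (monomial_op h s \<eta>) j"
  shows "Rep_ell2 (a \<xi>) i = Rep_ell2 (a \<eta>) j"
proof -
  obtain xs where x: "\<And>n. valid_terms (xs n)" "(\<lambda>n. term_op (xs n)) \<longlonglongrightarrow> a" using a by (rule CredE) blast
  have "Rep_ell2 (term_op ys \<xi>) i = Rep_ell2 (term_op ys \<eta>) j" if "valid_terms ys" for ys
    using that
  proof (induction ys)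
    case (Cons y ys)
    then show ?case by (cases y) (simp add: blinfun.add_left ell2_reps eq)
  qed (simp add: ell2_reps)
  then have "(\<lambda>n. Rep_ell2 (term_op (xs n) \<xi>) i) = (\<lambda>n. Rep_ell2 (term_op (xs n) \<eta>) j)"
    using x(1) by auto
  then show ?thesis
    using ell2_coeff_tendsto[OF x(2), of \<xi> i] ell2_coeff_tendsto[OF x(2), of \<eta> j]
    by (simp add: LIMSEQ_unique)
qed

lemma Cred_coeff_zero:
  assumes "a \<in> CR" "\<not> (i \<in> germs G \<phi> \<and> j \<in> germs G \<phi> \<and> src i = src j)"
  shows "Rep_ell2 (a (ket j)) i = 0"
proof -
  \<comment> \<open>Comparison with the zero vector turns the vanishing statement into an equality
    of coefficients.\<close>
  have "Rep_ell2 (a (ket j)) i = Rep_ell2 (a 0) i"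
  proof (rule Cred_coeff_eqI[OF assms(1)])
    fix h :: "'x \<Rightarrow> complex" and s assume h: "continuous_on UNIV h" "s \<in> carrier G"
    show "Rep_ell2 (monomial_op h s (ket j)) i = Rep_ell2 (monomial_op h s 0) i"
    proof (cases "i \<in> germs G \<phi>")
      case True
      then have "lact (inv s) i \<noteq> j" using assms(2) h lact_germs[of "inv s" i] by auto
      then show ?thesis using h by (simp add: monomial_op_apply ell2_reps)
    qed (use h in \<open>simp add: monomial_op_apply ell2_reps germ_weight_def\<close>)
  qed
  then show ?thesis by (simp add: ell2_reps)
qed

lemma gm_translate_aux:
  assumes "a \<in> carrier G" "b \<in> carrier G" "g \<in> carrier G" "gm a x = gm b x"
  shows "gm (a \<otimes> inv g) (\<phi> g x) = gm (b \<otimes> inv g) (\<phi> g x)"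
proof -
  obtain V where V: "open V" "x \<in> V" "\<forall>z\<in>V. \<phi> a z = \<phi> b z" using assms by (auto simp: gm_eq_iff)
  have "open (\<phi> (inv g) -` V)" using cont[of "inv g"] V assms by (auto intro: open_vimage)
  then show ?thesis using V assms
    by (auto simp: gm_eq_iff act_mult act_inv_left intro!: exI[of _ "\<phi> (inv g) -` V"])
qed

text \<open>Right multiplication by the inverse germ of \<open>g\<close> identifies the source fibre
  at \<open>x\<close> with the one at \<open>\<phi> g x\<close>; the converse is the same
  translation by the inverse of \<open>g\<close>.\<close>

lemma gm_translate:
  assumes "a \<in> carrier G" "b \<in> carrier G" "g \<in> carrier G"
  shows "gm a x = gm b x \<longleftrightarrow> gm (a \<otimes> inv g) (\<phi> g x) = gm (b \<otimes> inv g) (\<phi> g x)"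
  using gm_translate_aux[OF assms, of x] gm_translate_aux[of "a \<otimes> inv g" "b \<otimes> inv g" "inv g" "\<phi> g x"] assms
  by (auto simp: m_assoc act_inv_left)

text \<open>The regular representation commutes with right translation by \<open>g\<close>.\<close>

lemma Cred_coeff_translate:
  assumes a: "a \<in> CR" and g: "g \<in> carrier G" and k: "k \<in> carrier G"
  shows "Rep_ell2 (a (ket (gm g x))) (gm k x) =
     Rep_ell2 (a (ket (gm \<one> (\<phi> g x)))) (gm (k \<otimes> inv g) (\<phi> g x))"
proof (rule Cred_coeff_eqI[OF a])
  fix h :: "'x \<Rightarrow> complex" and s assume h: "continuous_on UNIV h" "s \<in> carrier G"
  have "gm (inv s \<otimes> k) x = gm g x \<longleftrightarrow> gm (inv s \<otimes> (k \<otimes> inv g)) (\<phi> g x) = gm \<one> (\<phi> g x)"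
    using gm_translate[of "inv s \<otimes> k" g g x] g k h by (simp add: m_assoc)
  then show "Rep_ell2 (monomial_op h s (ket (gm g x))) (gm k x) =
     Rep_ell2 (monomial_op h s (ket (gm \<one> (\<phi> g x)))) (gm (k \<otimes> inv g) (\<phi> g x))"
    using g k h by (simp add: monomial_op_apply ket.rep_eq lact_gm germ_weight_def gm_in_germs rng_gm act_mult act_inv_left)
qed

text \<open>The column at \<open>gm g x\<close> is a relabelling of the column at the unit over
  \<open>\<phi> g x\<close>, and entries outside the source fibre vanish.\<close>

lemma ket_eq_0_translate:
  assumes a: "a \<in> CR" and g: "g \<in> carrier G" and z: "a (ket (gm \<one> (\<phi> g x))) = 0"
  shows "a (ket (gm g x)) = 0"
proof (rule ell2_eqI)
  fix i
  show "Rep_ell2 (a (ket (gm g x))) i = Rep_ell2 0 i"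
  proof (cases "i \<in> germs G \<phi> \<and> src i = x")
    case True
    then obtain k where k: "k \<in> carrier G" "i = gm k x" by (metis germsE)
    then show ?thesis using Cred_coeff_translate[OF a g k(1), of x] z by (simp add: ell2_reps)
  next
    case False
    then show ?thesis using Cred_coeff_zero[OF a, of i "gm g x"] g by (simp add: src_gm ell2_reps)
  qed
qed

text \<open>The pointwise conditional expectation. It is defined for every operator and contractive
  in the supremum norm, and it will represent the class \<open>E_red\<close>.\<close>

definition diag_coeff :: "('g, 'x) germ_op \<Rightarrow> 'x \<Rightarrow> complex" where
  "diag_coeff a x = Rep_ell2 (a (ket (gm \<one> x))) (gm \<one> x)"

lemma norm_ket: "norm (ket i) = 1"
proof -
  have "complex_of_real ((norm (ket i))\<^sup>2) = 1"
    unfolding inner_self_cinner[symmetric] cinner_ket_right by (simp add: ket.rep_eq)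
  then have "(norm (ket i))\<^sup>2 = 1" by (simp only: of_real_eq_1_iff)
  then show ?thesis using norm_ge_zero[of "ket i"] by (simp add: power2_eq_1_iff)
qed

lemma diag_coeff_le: "cmod (diag_coeff a x) \<le> norm a"
proof -
  have "cmod (diag_coeff a x) \<le> norm (a (ket (gm \<one> x)))" unfolding diag_coeff_def by (rule ell2_coeff_le_norm)
  also have "\<dots> \<le> norm a * norm (ket (gm \<one> x))" by (rule norm_blinfun)
  finally show ?thesis by (simp add: norm_ket)
qed

lemma diag_coeff_diff: "diag_coeff (a - b) x = diag_coeff a x - diag_coeff b x"
  by (simp add: diag_coeff_def blinfun.diff_left ell2_reps)

lemma diag_coeff_add: "diag_coeff (a + b) x = diag_coeff a x + diag_coeff b x"
  by (simp add: diag_coeff_def blinfun.add_left ell2_reps)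

lemma diag_coeff_monomial_op:
  assumes "continuous_on UNIV h" "s \<in> carrier G"
  shows "diag_coeff (monomial_op h s) x = monomial h s (gm \<one> x)"
proof -
  have "gm \<one> x \<in> range (gm s) \<longleftrightarrow> gm s x = gm \<one> x"
    using assms(2) by (auto simp: gm_eq_iff image_iff)
  moreover have "gm s x = gm \<one> x \<longleftrightarrow> gm (inv s) x = gm \<one> x"
    using lact_eq_iff[of s "gm \<one> x" "gm \<one> x"] assms(2) by (auto simp: lact_gm gm_in_germs)
  ultimately show ?thesis using assms
    by (auto simp: diag_coeff_def monomial_op_apply ket.rep_eq lact_gm germ_weight_def monomial_def gm_in_germs)
qed

lemma diag_coeff_term_op: "valid_terms xs \<Longrightarrow> diag_coeff (term_op xs) = unit_restrict G \<phi> (term_fun xs)"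
proof (induction xs)
  case Nil
  show ?case by (auto simp: diag_coeff_def unit_restrict_def ell2_reps)
next
  case (Cons y xs)
  then show ?case by (cases y) (auto simp: fun_eq_iff unit_restrict_def diag_coeff_add diag_coeff_monomial_op)
qed

lemma diag_coeff_monomial_op_borel:
  assumes "continuous_on UNIV h" "s \<in> carrier G"
  shows "diag_coeff (monomial_op h s) \<in> borel_measurable borel"
proof -
  have "diag_coeff (monomial_op h s) = (\<lambda>x. if x \<in> {x. gm \<one> x \<in> range (gm s)} then h x else 0)"
    using assms by (auto simp: fun_eq_iff diag_coeff_monomial_op monomial_def rng_gm act_one)
  moreover have "{x. gm \<one> x \<in> range (gm s)} \<in> sets borel" using assms by (simp add: open_fix_germ)
  ultimately show ?thesis
    using borel_measurable_continuous_onI[OF assms(1)] by (simp only:) (rule measurable_If_set, auto)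
qed

lemma diag_coeff_term_op_borel: "valid_terms xs \<Longrightarrow> diag_coeff (term_op xs) \<in> borel_measurable borel"
proof (induction xs)
  case Nil
  show ?case by (simp add: diag_coeff_def[abs_def] ell2_reps)
next
  case (Cons y xs)
  obtain h s where y: "y = (h, s)" by (cases y)
  have "(\<lambda>x. diag_coeff (monomial_op h s) x + diag_coeff (term_op xs) x) \<in> borel_measurable borel"
    using Cons y diag_coeff_monomial_op_borel[of h s] by (intro borel_measurable_add) auto
  then show ?case by (simp add: y diag_coeff_add[abs_def])
qed

lemma diag_coeff_bounded_borel:
  assumes "a \<in> CR"
  shows "diag_coeff a \<in> bounded_borel"
proof (rule bounded_borelI[OF _ diag_coeff_le])
  obtain xs where x: "\<And>n. valid_terms (xs n)" "(\<lambda>n. term_op (xs n)) \<longlonglongrightarrow> a" using assms by (rule CredE) blast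
  show "diag_coeff a \<in> borel_measurable borel"
  proof (rule borel_measurable_LIMSEQ_metric)
    show "diag_coeff (term_op (xs n)) \<in> borel_measurable borel" for n by (rule diag_coeff_term_op_borel[OF x(1)])
    show "(\<lambda>n. diag_coeff (term_op (xs n)) y) \<longlonglongrightarrow> diag_coeff a y" for y
      unfolding diag_coeff_def by (rule ell2_coeff_tendsto[OF x(2)])
  qed
qed

text \<open>Existence: norm convergence of operators gives uniform convergence of diagonals.
  Uniqueness: any other limit class differs from the diagonal by less than each
  \<open>inverse (real (Suc m))\<close> off a meager set, and countably many such sets have meager
  union.\<close>

lemma E_red_eq:
  assumes a: "a \<in> CR"
  shows "E_red G \<phi> a = dix_class (diag_coeff a)"
  unfolding E_red_def
proof (rule the_equality)
  have cfa: "diag_coeff a \<in> bounded_borel" by (rule diag_coeff_bounded_borel[OF a])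
  have rep: "\<exists>xs. (\<forall>n. valid_terms (xs n)) \<and> f = (\<lambda>n. term_fun (xs n))"
    if "range f \<subseteq> conv_alg G \<phi>" for f :: "nat \<Rightarrow> _"
  proof -
    have "\<forall>n. \<exists>xs. valid_terms xs \<and> f n = term_fun xs" using that by (auto simp: conv_alg_eq)
    then show ?thesis by (auto simp: fun_eq_iff[where f = f] dest!: choice)
  qed
  show "dix_class (diag_coeff a) \<in> Dix \<and>
     (\<forall>f. range f \<subseteq> conv_alg G \<phi> \<longrightarrow> (\<lambda>n. lreg G \<phi> (f n)) \<longlonglongrightarrow> a \<longrightarrow>
        (\<lambda>n :: nat. dix_dist (dix_class (unit_restrict G \<phi> (f n))) (dix_class (diag_coeff a))) \<longlonglongrightarrow> 0)"
  proof (intro conjI allI impI)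
    show "dix_class (diag_coeff a) \<in> Dix" using cfa by (auto simp: Dix_iff)
    fix f :: "nat \<Rightarrow> _" assume f: "range f \<subseteq> conv_alg G \<phi>" and lim: "(\<lambda>n. lreg G \<phi> (f n)) \<longlonglongrightarrow> a"
    obtain xs where x: "\<And>n. valid_terms (xs n)" "f = (\<lambda>n. term_fun (xs n))" using rep[OF f] by blast
    have lim: "(\<lambda>n. norm (term_op (xs n) - a)) \<longlonglongrightarrow> 0"
      using lim x(1) by (intro tendsto_norm_zero LIM_zero) (simp add: x(2) lreg_term_fun)
    have bb: "diag_coeff (term_op (xs n)) \<in> bounded_borel" for n
      using x(1) by (intro diag_coeff_bounded_borel Cred_term_op)
    have "dix_dist (dix_class (diag_coeff (term_op (xs n)))) (dix_class (diag_coeff a)) \<le> norm (term_op (xs n) - a)" for n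
      using diag_coeff_le[of "term_op (xs n) - a"] by (intro dix_dist_le bb cfa) (simp add: diag_coeff_diff)
    then show "(\<lambda>n. dix_dist (dix_class (unit_restrict G \<phi> (f n))) (dix_class (diag_coeff a))) \<longlonglongrightarrow> 0"
      using dix_dist_nonneg[OF bb cfa] x
      by (intro tendsto_sandwich[OF _ _ tendsto_const lim]) (auto simp: diag_coeff_term_op[symmetric])
  qed
  fix D assume D: "D \<in> Dix \<and>
     (\<forall>f. range f \<subseteq> conv_alg G \<phi> \<longrightarrow> (\<lambda>n. lreg G \<phi> (f n)) \<longlonglongrightarrow> a \<longrightarrow>
        (\<lambda>n :: nat. dix_dist (dix_class (unit_restrict G \<phi> (f n))) D) \<longlonglongrightarrow> 0)"
  obtain d where d: "d \<in> bounded_borel" "D = dix_class d" using D by (auto simp: Dix_iff)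
  obtain xs where x: "\<And>n. valid_terms (xs n)" "(\<lambda>n. term_op (xs n)) \<longlonglongrightarrow> a" using a by (rule CredE) blast
  have "(\<lambda>n. dix_dist (dix_class (unit_restrict G \<phi> (term_fun (xs n)))) D) \<longlonglongrightarrow> 0"
    using D[THEN conjunct2, rule_format, of "\<lambda>n. term_fun (xs n)"] x by (auto simp: lreg_term_fun conv_alg_eq)
  then have lim: "(\<lambda>n. dix_dist (dix_class (diag_coeff (term_op (xs n)))) (dix_class d)) \<longlonglongrightarrow> 0"
    using x(1) by (simp add: diag_coeff_term_op d(2))
  have bb: "diag_coeff (term_op (xs n)) \<in> bounded_borel" for n
    using x(1) by (intro diag_coeff_bounded_borel Cred_term_op)
  have "meager {x. \<not> cmod (diag_coeff a x - d x) < inverse (real (Suc m))}" for m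
  proof -
    \<comment> \<open>One half is spent on the distance from the approximant to \<open>d\<close>,
      the other on its operator distance from \<open>a\<close>.\<close>
    let ?e = "inverse (real (Suc m)) / 2"
    have "\<forall>\<^sub>F n in sequentially. dix_dist (dix_class (diag_coeff (term_op (xs n)))) (dix_class d) < ?e"
      using lim by (rule order_tendstoD) simp
    moreover have "\<forall>\<^sub>F n in sequentially. norm (term_op (xs n) - a) < ?e"
      using x(2) by (intro order_tendstoD[of _ 0] tendsto_norm_zero LIM_zero) auto
    ultimately have "\<forall>\<^sub>F n in sequentially. dix_dist (dix_class (diag_coeff (term_op (xs n)))) (dix_class d) < ?e \<and>
        norm (term_op (xs n) - a) < ?e" by (rule eventually_conj)
    then obtain n where n: "dix_dist (dix_class (diag_coeff (term_op (xs n)))) (dix_class d) < ?e"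
      "norm (term_op (xs n) - a) < ?e" using eventually_happens'[OF sequentially_bot] by blast
    have "meager {x. \<not> cmod (diag_coeff (term_op (xs n)) x - d x) < ?e}" by (rule dix_dist_less[OF bb d(1) n(1)])
    then show ?thesis
    proof (rule meager_subset, safe)
      fix y assume y: "cmod (diag_coeff (term_op (xs n)) y - d y) < ?e" and ny: "\<not> cmod (diag_coeff a y - d y) < inverse (real (Suc m))"
      have "cmod (diag_coeff (term_op (xs n)) y - diag_coeff a y) < ?e"
        using diag_coeff_le[of "term_op (xs n) - a" y] n(2) by (simp add: diag_coeff_diff)
      then show False using norm_triangle_ineq4[of "diag_coeff (term_op (xs n)) y - d y" "diag_coeff (term_op (xs n)) y - diag_coeff a y"] y ny
        by simp
    qed
  qed
  then have "meager (\<Union>m. {x. \<not> cmod (diag_coeff a x - d x) < inverse (real (Suc m))})"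
    by (intro meager_countable_UN) auto
  then have "meager {x. d x \<noteq> diag_coeff a x}"
  proof (rule meager_subset, safe)
    fix y assume "d y \<noteq> diag_coeff a y"
    then have "0 < cmod (diag_coeff a y - d y)" by simp
    then obtain m where "inverse (real (Suc m)) < cmod (diag_coeff a y - d y)" using reals_Archimedean by blast
    then show "y \<in> (\<Union>m. {x. \<not> cmod (diag_coeff a x - d x) < inverse (real (Suc m))})" by (auto intro!: exI[of _ m])
  qed
  then show "D = dix_class (diag_coeff a)" unfolding d(2) using dix_class_eq_iff[OF d(1) cfa] by simp
qed

section \<open>The essential ideal and its description by columns\<close>

lemma zero_bounded_borel: "(\<lambda>_. 0) \<in> bounded_borel"
  by (rule bounded_borelI[of _ 0]) auto

lemma E_red_eq_0_iff: "a \<in> CR \<Longrightarrow> E_red G \<phi> a = dix_class (\<lambda>_. 0) \<longleftrightarrow> meager {x. diag_coeff a x \<noteq> 0}"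
  by (simp add: E_red_eq dix_class_eq_iff diag_coeff_bounded_borel zero_bounded_borel)

lemma diag_coeff_adj_mult:
  assumes "clinear_op a"
  shows "diag_coeff (ell2_adj a o\<^sub>L a) x = complex_of_real ((norm (a (ket (gm \<one> x))))\<^sup>2)"
proof -
  let ?v = "ket (gm \<one> x)"
  have "diag_coeff (ell2_adj a o\<^sub>L a) x = ell2_cinner (ell2_adj a (a ?v)) ?v" by (simp add: diag_coeff_def cinner_ket_right)
  also have "\<dots> = cnj (ell2_cinner (a ?v) (a ?v))"
    unfolding ell2_adj_spec[OF assms] by (rule cinner_cnj)
  finally show ?thesis by (simp add: inner_self_cinner)
qed

text \<open>The diagonal of the product of the adjoint of \<open>n\<close> with \<open>n\<close> is
  the squared norm of the column at the unit.\<close>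

lemma ess_ideal_iff: "n \<in> I \<longleftrightarrow> n \<in> CR \<and> meager {x. n (ket (gm \<one> x)) \<noteq> 0}"
proof -
  have "E_red G \<phi> (ell2_adj n o\<^sub>L n) = dix_class (\<lambda>_. 0) \<longleftrightarrow> meager {x. n (ket (gm \<one> x)) \<noteq> 0}" if n: "n \<in> CR"
    using n by (subst E_red_eq_0_iff) (auto intro: Cred_mult Cred_adj simp: diag_coeff_adj_mult clinear_op_Cred)
  then show ?thesis by (auto simp: ess_ideal_def)
qed

text \<open>For \<open>n\<close> in the reduced algebra, these are the points at which the regular
  representation of \<open>n\<close> on the source fibre is nonzero. Unlike the condition on unit
  columns, this one is invariant under adjoints.\<close>

definition live_points :: "('g, 'x) germ_op \<Rightarrow> 'x set" where
  "live_points n = {x. \<exists>g\<in>carrier G. n (ket (gm g x)) \<noteq> 0}"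

text \<open>Every column is a translate of a unit column, so the larger set is a union of
  homeomorphic preimages of the smaller one; countability of \<open>G\<close> keeps it
  meager.\<close>

lemma ess_ideal_iff_live_points: "n \<in> I \<longleftrightarrow> n \<in> CR \<and> meager (live_points n)"
proof (cases "n \<in> CR")
  case n: True
  have "meager (live_points n) \<longleftrightarrow> meager {x. n (ket (gm \<one> x)) \<noteq> 0}"
  proof
    assume "meager (live_points n)"
    then show "meager {x. n (ket (gm \<one> x)) \<noteq> 0}" by (rule meager_subset) (auto simp: live_points_def)
  next
    assume m: "meager {x. n (ket (gm \<one> x)) \<noteq> 0}"
    have "meager (\<Union>g\<in>carrier G. \<phi> g -` {x. n (ket (gm \<one> x)) \<noteq> 0})"
    proof (rule meager_countable_UN[OF countable_G])
      fix g assume g: "g \<in> carrier G"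
      show "meager (\<phi> g -` {x. n (ket (gm \<one> x)) \<noteq> 0})"
        by (rule meager_vimage_homeo[OF cont[OF g] cont[OF inv_closed[OF g]] _ _ m])
          (use g in \<open>simp_all add: act_inv_left act_inv_right\<close>)
    qed
    then show "meager (live_points n)"
      by (rule meager_subset) (auto simp: live_points_def dest: ket_eq_0_translate[OF n])
  qed
  then show ?thesis using n by (simp add: ess_ideal_iff)
qed (simp add: ess_ideal_iff)

text \<open>At such a point the whole block of the matrix over the source fibre is zero, hence so is
  its conjugate transpose.\<close>

lemma adj_ket_eq_0:
  assumes n: "n \<in> CR" and x: "x \<notin> live_points n" and k: "k \<in> carrier G"
  shows "ell2_adj n (ket (gm k x)) = 0"
proof (rule ell2_eqI)
  fix j
  have "Rep_ell2 (n (ket j)) (gm k x) = 0"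
  proof (cases "j \<in> germs G \<phi> \<and> src j = x")
    case True
    then obtain g where "g \<in> carrier G" "j = gm g x" by (metis germsE)
    then show ?thesis using x by (simp add: live_points_def ell2_reps)
  next
    case False
    then show ?thesis using Cred_coeff_zero[OF n, of "gm k x" j] k by (auto simp: src_gm)
  qed
  then show "Rep_ell2 (ell2_adj n (ket (gm k x))) j = Rep_ell2 0 j"
    by (simp add: ell2_adj_coeff clinear_op_Cred n ell2_reps)
qed

lemma ess_ideal_adj: "n \<in> I \<Longrightarrow> ell2_adj n \<in> I"
proof -
  assume n: "n \<in> I"
  have "live_points (ell2_adj n) \<subseteq> live_points n"
    using adj_ket_eq_0[of n] n by (auto simp: live_points_def[of "ell2_adj n"] ess_ideal_iff_live_points)
  then show ?thesis using n by (auto simp: ess_ideal_iff_live_points intro: Cred_adj meager_subset)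
qed

lemma ess_ideal_mult_left: "n \<in> I \<Longrightarrow> a \<in> CR \<Longrightarrow> a o\<^sub>L n \<in> I"
  unfolding ess_ideal_iff_live_points
  by (auto intro: Cred_mult elim!: meager_subset simp: live_points_def) (metis blinfun.zero_right)

text \<open>The columns of the product still live in the source fibre of \<open>x\<close>. Their
  entries are pairings with columns of the adjoint of \<open>n\<close>, which vanish there.\<close>

lemma ess_ideal_mult_right:
  assumes n: "n \<in> I" and a: "a \<in> CR"
  shows "n o\<^sub>L a \<in> I"
proof -
  have nC: "n \<in> CR" and na: "n o\<^sub>L a \<in> CR" using n a by (auto simp: ess_ideal_iff_live_points intro: Cred_mult)
  have "(n o\<^sub>L a) (ket (gm g x)) = 0" if x: "x \<notin> live_points n" and g: "g \<in> carrier G" for g x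
  proof (rule ell2_eqI)
    fix i
    show "Rep_ell2 ((n o\<^sub>L a) (ket (gm g x))) i = Rep_ell2 0 i"
    proof (cases "i \<in> germs G \<phi> \<and> src i = x")
      case True
      then obtain k where k: "k \<in> carrier G" "i = gm k x" by (metis germsE)
      have "Rep_ell2 ((n o\<^sub>L a) (ket (gm g x))) i = ell2_cinner (a (ket (gm g x))) (ell2_adj n (ket i))"
        by (simp add: cinner_ket_right flip: ell2_adj_spec[OF clinear_op_Cred[OF nC]])
      also have "\<dots> = 0" unfolding k(2) adj_ket_eq_0[OF nC x k(1)] by (simp add: ell2_cinner_def ell2_reps)
      finally show ?thesis by (simp add: ell2_reps)
    next
      case False
      then show ?thesis using Cred_coeff_zero[OF na, of i "gm g x"] g by (simp add: src_gm ell2_reps)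
    qed
  qed
  then have "live_points (n o\<^sub>L a) \<subseteq> live_points n" unfolding live_points_def[of "n o\<^sub>L a"] by blast
  then show ?thesis using n na by (auto simp: ess_ideal_iff_live_points intro: meager_subset)
qed

lemma ess_ideal_0: "0 \<in> I"
  by (simp add: ess_ideal_iff Cred_0 meager_empty)

lemma ess_ideal_add:
  assumes "n \<in> I" "m \<in> I"
  shows "n + m \<in> I"
proof -
  have "meager ({x. n (ket (gm \<one> x)) \<noteq> 0} \<union> {x. m (ket (gm \<one> x)) \<noteq> 0})"
    using assms by (intro meager_Un) (auto simp: ess_ideal_iff)
  then have "meager {x. (n + m) (ket (gm \<one> x)) \<noteq> 0}"
    by (rule meager_subset) (auto simp: blinfun.add_left)
  then show ?thesis using assms by (auto simp: ess_ideal_iff intro: Cred_add)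
qed

lemma ess_ideal_scaleR: "n \<in> I \<Longrightarrow> c *\<^sub>R n \<in> I"
  unfolding ess_ideal_iff
  by (auto intro: Cred_scaleR simp: blinfun.scaleR_left elim!: meager_subset)

lemma ess_ideal_minus: "n \<in> I \<Longrightarrow> - n \<in> I"
  using ess_ideal_scaleR[of n "- 1"] by simp

lemma ess_ideal_Cred: "n \<in> I \<Longrightarrow> n \<in> CR"
  by (simp add: ess_ideal_iff)

end

section \<open>Averaging in the reduced algebra\<close>

lemma norm_ell2_dominated:
  assumes "\<And>i. cmod (Rep_ell2 \<eta> i) \<le> c * cmod (Rep_ell2 \<xi> i)" "c \<ge> 0"
  shows "norm \<eta> \<le> c * norm \<xi>"
proof (rule power2_le_imp_le)
  have "(norm \<eta>)\<^sup>2 \<le> (\<Sum>\<^sub>\<infinity>i. c\<^sup>2 * (cmod (Rep_ell2 \<xi> i))\<^sup>2)"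
    unfolding norm_ell2_sq
  proof (rule infsum_mono[OF ell2_sq_summable summable_on_cmult_right[OF ell2_sq_summable]])
    fix i
    show "(cmod (Rep_ell2 \<eta> i))\<^sup>2 \<le> c\<^sup>2 * (cmod (Rep_ell2 \<xi> i))\<^sup>2"
      using power_mono[OF assms(1), of i 2] by (simp add: power_mult_distrib)
  qed
  also have "\<dots> = (c * norm \<xi>)\<^sup>2"
    by (simp add: infsum_cmult_right[OF ell2_sq_summable] norm_ell2_sq power_mult_distrib)
  finally show "(norm \<eta>)\<^sup>2 \<le> (c * norm \<xi>)\<^sup>2" .
qed (use assms in simp)

lemma inner_restr: "inner \<xi> (restr A \<eta>) = inner (restr A \<xi>) \<eta>"
  unfolding inner_ell2_def ell2_cinner_def
  by (intro arg_cong[of _ _ Re] infsum_cong) (simp add: ell2_reps)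

text \<open>Squared norms are sums over coordinates; exchanging the two sums leaves the weighted
  indicator sum as coefficient, and this is where its uniform bound enters.\<close>

lemma sum_norm_restr_le:
  fixes t :: "'i \<Rightarrow> real"
  assumes t: "\<And>g. g \<in> F \<Longrightarrow> t g \<ge> 0" and d: "\<And>i. (\<Sum>g\<in>F. t g * indicator (B g) i) \<le> d"
  shows "(\<Sum>g\<in>F. t g * (norm (restr (B g) \<xi>))\<^sup>2) \<le> d * (norm \<xi>)\<^sup>2"
proof -
  have hs: "((\<lambda>i. c * (cmod (Rep_ell2 \<zeta> i))\<^sup>2) has_sum c * (norm \<zeta>)\<^sup>2) UNIV" for c and \<zeta> :: "'a ell2"
    unfolding norm_ell2_sq by (intro has_sum_cmult_right has_sum_infsum ell2_sq_summable)
  have "((\<lambda>i. \<Sum>g\<in>F. t g * (cmod (Rep_ell2 (restr (B g) \<xi>) i))\<^sup>2) has_sum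
      (\<Sum>g\<in>F. t g * (norm (restr (B g) \<xi>))\<^sup>2)) UNIV"
    by (intro has_sum_sum hs)
  then show ?thesis
  proof (rule has_sum_mono[OF _ hs])
    fix i
    have "(\<Sum>g\<in>F. t g * (cmod (Rep_ell2 (restr (B g) \<xi>) i))\<^sup>2) =
        (\<Sum>g\<in>F. t g * indicator (B g) i) * (cmod (Rep_ell2 \<xi> i))\<^sup>2"
      unfolding sum_distrib_right by (intro sum.cong refl) (simp add: ell2_reps indicator_def)
    then show "(\<Sum>g\<in>F. t g * (cmod (Rep_ell2 (restr (B g) \<xi>) i))\<^sup>2) \<le> d * (cmod (Rep_ell2 \<xi> i))\<^sup>2"
      using mult_right_mono[OF d] by simp
  qed
qed

text \<open>Cauchy-Schwarz with each weight split into two square roots, one of which contributes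
  the total weight one.\<close>

lemma weighted_mean_le_rms:
  fixes t q :: "'i \<Rightarrow> real"
  assumes "\<And>g. g \<in> F \<Longrightarrow> t g \<ge> 0" "sum t F = 1" "(\<Sum>g\<in>F. t g * (q g)\<^sup>2) \<le> c\<^sup>2" "c \<ge> 0"
  shows "(\<Sum>g\<in>F. t g * q g) \<le> c"
proof (rule power2_le_imp_le[OF _ assms(4)])
  have "(\<Sum>g\<in>F. sqrt (t g) * (sqrt (t g) * q g))\<^sup>2 \<le>
      (\<Sum>g\<in>F. (sqrt (t g))\<^sup>2) * (\<Sum>g\<in>F. (sqrt (t g) * q g)\<^sup>2)"
    by (rule Cauchy_Schwarz_ineq_sum)
  also have "(\<Sum>g\<in>F. (sqrt (t g))\<^sup>2) = 1" using assms(1,2) by simp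
  also have "(\<Sum>g\<in>F. (sqrt (t g) * q g)\<^sup>2) = (\<Sum>g\<in>F. t g * (q g)\<^sup>2)"
    using assms(1) by (intro sum.cong) (auto simp: power_mult_distrib)
  also have "(\<Sum>g\<in>F. sqrt (t g) * (sqrt (t g) * q g)) = (\<Sum>g\<in>F. t g * q g)"
    using assms(1) by (intro sum.cong) (auto simp: mult.assoc[symmetric])
  finally show "(\<Sum>g\<in>F. t g * q g)\<^sup>2 \<le> c\<^sup>2" using assms(3) by simp
qed

text \<open>Baire category in its locally compact regular form, since the space need not be
  metrizable.\<close>

lemma not_meager_UNIV:
  assumes "compact (UNIV :: 'x::t2_space set)"
  shows "\<not> meager (UNIV :: 'x set)"
proof
  assume "meager (UNIV :: 'x set)"
  then obtain N :: "nat \<Rightarrow> 'x set" where N: "\<And>n. interior (closure (N n)) = {}" "UNIV \<subseteq> (\<Union>n. N n)"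
    by (auto simp: meager_def)
  have cs: "compact_space (euclidean :: 'x topology)" using assms by (simp add: compact_space_def)
  have "(euclidean :: 'x topology) interior_of \<Union> (range (\<lambda>n. closure (N n))) = {}"
  proof (rule Baire_category_alt)
    show "completely_metrizable_space (euclidean :: 'x topology) \<or>
        locally_compact_space (euclidean :: 'x topology) \<and> regular_space (euclidean :: 'x topology)"
      using cs Hausdorff_space_euclidean_t2 compact_imp_locally_compact_space
        compact_Hausdorff_imp_regular_space by blast
  qed (use N(1) in auto)
  moreover have "\<Union> (range (\<lambda>n. closure (N n))) = UNIV" using N(2) closure_subset by blast
  ultimately show False by simp
qed

lemma meager_frontier_closed:
  assumes "closed C"
  shows "meager (frontier C)"
proof (rule meager_nowhere_dense)
  have "interior (frontier C) \<subseteq> interior C"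
    using assms by (intro interior_mono) (simp add: frontier_subset_closed)
  moreover have "interior (frontier C) \<subseteq> frontier C" by (rule interior_subset)
  ultimately have "interior (frontier C) = {}" by (auto simp: frontier_def)
  then show "interior (closure (frontier C)) = {}" by (simp only: closure_closed[OF frontier_closed])
qed

context countable_compact_action
begin

section \<open>Arithmetic of cosets and the unitaries of the group\<close>

abbreviation "coset \<equiv> ess_coset G \<phi>"

abbreviation u :: "'g \<Rightarrow> ('g, 'x) germ_op" where "u g \<equiv> monomial_op (\<lambda>_. 1) g"

lemma coset_mem: "b \<in> coset a \<longleftrightarrow> b - a \<in> I"
  by (auto simp: ess_coset_def image_iff intro: bexI[of _ "b - a"])

lemma coset_eqI:
  assumes "b - a \<in> I"
  shows "coset b = coset a"
proof -
  have "c - b \<in> I \<longleftrightarrow> c - a \<in> I" for c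
    using ess_ideal_add[OF assms, of "c - b"] ess_ideal_add[OF ess_ideal_minus[OF assms], of "c - a"]
    by (auto simp: algebra_simps)
  then show ?thesis by (auto simp: coset_mem)
qed

lemma coset_self: "a \<in> coset a"
  by (simp add: coset_mem ess_ideal_0)

lemma coset_Cred: "a \<in> CR \<Longrightarrow> b \<in> coset a \<Longrightarrow> b \<in> CR"
  using Cred_add[of a "b - a"] ess_ideal_Cred[of "b - a"] by (simp add: coset_mem)

text \<open>Operations on cosets are unions over representatives; they are well defined because all
  members of the union coincide. The next three lemmas follow the same pattern.\<close>

lemma ess_add_coset: "ess_add G \<phi> (coset a) (coset b) = coset (a + b)"
proof -
  have "coset (a' + b') = coset (a + b)" if "a' \<in> coset a" "b' \<in> coset b" for a' b'
    using that ess_ideal_add[of "a' - a" "b' - b"] by (intro coset_eqI) (simp add: coset_mem algebra_simps)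
  then have "ess_add G \<phi> (coset a) (coset b) = (\<Union>a'\<in>coset a. \<Union>b'\<in>coset b. coset (a + b))"
    unfolding ess_add_def by (intro SUP_cong refl) auto
  then show ?thesis using coset_self by auto
qed

lemma ess_scaleR_coset: "ess_scaleR G \<phi> t (coset a) = coset (t *\<^sub>R a)"
proof -
  have "coset (t *\<^sub>R a') = coset (t *\<^sub>R a)" if "a' \<in> coset a" for a'
    using that ess_ideal_scaleR[of "a' - a" t] by (intro coset_eqI) (simp add: coset_mem algebra_simps)
  then have "ess_scaleR G \<phi> t (coset a) = (\<Union>a'\<in>coset a. coset (t *\<^sub>R a))"
    unfolding ess_scaleR_def by (intro SUP_cong refl) auto
  then show ?thesis using coset_self by auto
qed

lemma ess_mult_coset:
  assumes a: "a \<in> CR" and b: "b \<in> CR"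
  shows "ess_mult G \<phi> (coset a) (coset b) = coset (a o\<^sub>L b)"
proof -
  have "coset (a' o\<^sub>L b') = coset (a o\<^sub>L b)" if a': "a' \<in> coset a" and b': "b' \<in> coset b" for a' b'
  proof (rule coset_eqI)
    have "(a' o\<^sub>L b') - (a o\<^sub>L b) = ((a' - a) o\<^sub>L b') + (a o\<^sub>L (b' - b))"
      by (simp add: bounded_bilinear.diff_left[OF bounded_bilinear_blinfun_compose]
          bounded_bilinear.diff_right[OF bounded_bilinear_blinfun_compose])
    also have "\<dots> \<in> I"
      using a' b' coset_Cred[OF b b'] a by (intro ess_ideal_add ess_ideal_mult_right ess_ideal_mult_left) (auto simp: coset_mem)
    finally show "(a' o\<^sub>L b') - (a o\<^sub>L b) \<in> I" .
  qed
  then have "ess_mult G \<phi> (coset a) (coset b) = (\<Union>a'\<in>coset a. \<Union>b'\<in>coset b. coset (a o\<^sub>L b))"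
    unfolding ess_mult_def by (intro SUP_cong refl) auto
  then show ?thesis using coset_self by auto
qed

lemma ess_adj_coset:
  assumes a: "a \<in> CR"
  shows "ess_adj G \<phi> (coset a) = coset (ell2_adj a)"
proof -
  have "coset (ell2_adj a') = coset (ell2_adj a)" if a': "a' \<in> coset a" for a'
  proof (rule coset_eqI)
    have "ell2_adj a' - ell2_adj a = ell2_adj (a' - a)"
      using a coset_Cred[OF a a'] by (simp add: ell2_adj_diff clinear_op_Cred)
    then show "ell2_adj a' - ell2_adj a \<in> I" using a' ess_ideal_adj by (simp add: coset_mem)
  qed
  then have "ess_adj G \<phi> (coset a) = (\<Union>a'\<in>coset a. coset (ell2_adj a))"
    unfolding ess_adj_def by (intro SUP_cong refl) auto
  then show ?thesis using coset_self by auto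
qed

lemma coset_Cess: "a \<in> CR \<Longrightarrow> coset a \<in> Cess G \<phi>"
  by (simp add: Cess_def)

lemma ess_norm_coset_le: "ess_norm (coset a) \<le> norm a"
  unfolding ess_norm_def using coset_self by (intro cINF_lower bdd_belowI2[of _ 0]) auto

text \<open>Convexity is stated for two cosets, so a longer combination is built by splitting off
  one term and renormalizing the remaining weights.\<close>

lemma ess_convex_sum:
  assumes T: "ess_convex G \<phi> T" and "finite F" "F \<noteq> {}"
    and "\<And>g. g \<in> F \<Longrightarrow> coset (c g) \<in> T" "\<And>g. g \<in> F \<Longrightarrow> t g \<ge> 0" "sum t F = 1"
  shows "coset (\<Sum>g\<in>F. t g *\<^sub>R c g) \<in> T"
  using assms(2-)
proof (induction F arbitrary: t rule: finite_ne_induct)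
  case (singleton g)
  then show ?case by simp
next
  case (insert g F)
  show ?case
  \<comment> \<open>If the remaining weights sum to zero they cannot be renormalized, but then they
    all vanish.\<close>
  proof (cases "sum t F = 0")
    case True
    then have "\<forall>g\<in>F. t g = 0" using insert.prems insert.hyps by (subst (asm) sum_nonneg_eq_0_iff) auto
    then show ?thesis using insert True by simp
  next
    case False
    define s where "s = sum t F"
    have s: "s > 0" unfolding s_def using False insert.prems by (simp add: less_le sum_nonneg)
    have tg: "t g + s = 1" "t g \<ge> 0" using insert by (auto simp: s_def)
    have "coset (\<Sum>h\<in>F. (t h / s) *\<^sub>R c h) \<in> T"
      using insert.prems s by (intro insert.IH) (auto simp: s_def sum_divide_distrib[symmetric])
    then have "ess_add G \<phi> (ess_scaleR G \<phi> (t g) (coset (c g)))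
        (ess_scaleR G \<phi> s (coset (\<Sum>h\<in>F. (t h / s) *\<^sub>R c h))) \<in> T"
      using T insert.prems(1) s tg unfolding ess_convex_def by (meson insertI1 less_imp_le)
    moreover have "s *\<^sub>R (\<Sum>h\<in>F. (t h / s) *\<^sub>R c h) = (\<Sum>h\<in>F. t h *\<^sub>R c h)"
      using s by (simp add: scaleR_sum_right)
    ultimately show ?thesis using insert.hyps by (simp add: ess_add_coset ess_scaleR_coset)
  qed
qed

lemma ess_rep_eq:
  assumes "g \<in> carrier G"
  shows "ess_rep G \<phi> g = coset (u g)"
proof -
  have "(indicator (range (gm g)) :: _ \<Rightarrow> complex) = term_fun [(\<lambda>_. 1, g)]"
    by (auto simp: fun_eq_iff monomial_def indicator_def)
  moreover have "lreg G \<phi> (term_fun [(\<lambda>_. 1, g)]) = u g"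
    using assms by (subst lreg_term_fun) auto
  ultimately show ?thesis by (simp add: ess_rep_def)
qed

lemma u_adj: "g \<in> carrier G \<Longrightarrow> ell2_adj (u g) = u (inv g)"
  by (simp add: monomial_op_adj)

lemma norm_u_apply: "g \<in> carrier G \<Longrightarrow> norm (u g \<xi>) \<le> norm \<xi>"
  using norm_weighted_op_le[of "lact (inv g)" "germ_weight (\<lambda>_. 1)" 1 \<xi>] germ_weight_inj[of g "\<lambda>_. 1"] germ_weight_le[of "\<lambda>_. 1" 1]
  by (simp add: monomial_op_def)

lemma norm_u: "g \<in> carrier G \<Longrightarrow> norm (u g) \<le> 1"
  using norm_u_apply by (intro norm_blinfun_bound) auto

lemma Cred_u: "g \<in> carrier G \<Longrightarrow> u g \<in> CR"
  by (intro Cred_monomial_op) auto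

lemma inner_u:
  assumes "g \<in> carrier G"
  shows "inner (u (inv g) \<xi>) \<eta> = inner \<xi> (u g \<eta>)"
  using ell2_adj_spec[OF clinear_op_Cred[OF Cred_u[of "inv g"]], of \<xi> \<eta>] assms u_adj[of "inv g"]
  by (simp add: inner_ell2_def)

section \<open>Compression to a neighbourhood and averaging of operators\<close>

lemma term_op_coeff:
  assumes "valid_terms xs"
  shows "Rep_ell2 (term_op xs \<xi>) \<gamma> = (\<Sum>(h, s)\<leftarrow>xs. germ_weight h \<gamma> * Rep_ell2 \<xi> (lact (inv s) \<gamma>))"
  using assms
proof (induction xs)
  case (Cons y xs)
  then show ?case by (cases y) (simp add: blinfun.add_left ell2_reps monomial_op_apply)
qed (simp add: ell2_reps)

text \<open>Off the meager set of points at which some group element of \<open>xs\<close> fixes the point but no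
  neighbourhood of it, each of these elements acts trivially near the point or moves a
  neighbourhood off itself. Compressing to the germs with range in such a neighbourhood leaves
  only the diagonal part of the operator.\<close>

lemma compression_small:
  assumes xs: "valid_terms xs" and S: "meager S" and e: "e > 0"
    and small: "\<And>x. x \<notin> S \<Longrightarrow> cmod (diag_coeff (term_op xs) x) \<le> e"
  obtains V where "open V" "V \<noteq> {}"
    "\<And>\<xi>. norm (restr {\<gamma>\<in>germs G \<phi>. rng \<gamma> \<in> V} (term_op xs (restr {\<gamma>\<in>germs G \<phi>. rng \<gamma> \<in> V} \<xi>)))
       \<le> 2 * e * norm \<xi>"
proof -
  have xsD: "continuous_on UNIV h \<and> s \<in> carrier G" if "(h, s) \<in> set xs" for h s
    using that xs by (auto simp: valid_terms_def)
  define E where "E = snd ` set xs"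
  have E: "finite E" "E \<subseteq> carrier G" using xsD by (auto simp: E_def)
  have cl: "closed {x. \<phi> s x = x}" if "s \<in> E" for s
    using that E cont[of s] by (intro closed_Collect_eq) (auto intro: continuous_on_id)
  have "meager (S \<union> (\<Union>s\<in>E. frontier {x. \<phi> s x = x}))"
    using S E by (intro meager_Un meager_countable_UN meager_frontier_closed cl countable_finite) auto
  then have "S \<union> (\<Union>s\<in>E. frontier {x. \<phi> s x = x}) \<noteq> UNIV"
    using not_meager_UNIV[OF compact_UNIV] by metis
  then obtain x0 where x0: "x0 \<notin> S" "\<And>s. s \<in> E \<Longrightarrow> x0 \<notin> frontier {x. \<phi> s x = x}" by blast
  have "\<forall>s\<in>E. \<exists>W. open W \<and> x0 \<in> W \<and>
      (if \<phi> s x0 = x0 then \<forall>y\<in>W. \<phi> s y = y else \<forall>y\<in>W. \<phi> s y \<notin> W)"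
  proof
    fix s assume s: "s \<in> E"
    show "\<exists>W. open W \<and> x0 \<in> W \<and> (if \<phi> s x0 = x0 then \<forall>y\<in>W. \<phi> s y = y else \<forall>y\<in>W. \<phi> s y \<notin> W)"
    proof (cases "\<phi> s x0 = x0")
      case True
      then have "x0 \<in> interior {x. \<phi> s x = x}"
        using x0(2)[OF s] closure_subset[of "{x. \<phi> s x = x}"] by (auto simp: frontier_def)
      then show ?thesis using True interior_subset[of "{x. \<phi> s x = x}"]
        by (intro exI[of _ "interior {x. \<phi> s x = x}"]) auto
    next
      case False
      then obtain P Q where PQ: "open P" "open Q" "x0 \<in> P" "\<phi> s x0 \<in> Q" "P \<inter> Q = {}"
        using hausdorff[of x0 "\<phi> s x0"] by auto
      have "open (\<phi> s -` Q)" using cont[of s] s E PQ by (auto intro: open_vimage)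
      then show ?thesis using False PQ by (intro exI[of _ "P \<inter> \<phi> s -` Q"]) auto
    qed
  qed
  from bchoice[OF this] obtain W where W': "\<forall>s\<in>E. open (W s) \<and> x0 \<in> W s \<and>
      (if \<phi> s x0 = x0 then \<forall>y\<in>W s. \<phi> s y = y else \<forall>y\<in>W s. \<phi> s y \<notin> W s)" ..
  have W: "open (W s)" "x0 \<in> W s" if "s \<in> E" for s using W' that by blast+
  have W_fix: "\<phi> s y = y" if "s \<in> E" "\<phi> s x0 = x0" "y \<in> W s" for s y
    using W' that by (simp split: if_splits)
  have W_move: "\<phi> s y \<notin> W s" if "s \<in> E" "\<phi> s x0 \<noteq> x0" "y \<in> W s" for s y
    using bspec[OF W' that(1)] that(2,3) by simp
  \<comment> \<open>The diagonal may jump, but near \<open>x0\<close> the set of contributing terms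
    is constant. Freezing the choice made at \<open>x0\<close> gives a continuous function with the
    same value there.\<close>
  define D where "D y = (\<Sum>(h, s)\<leftarrow>xs. if \<phi> s x0 = x0 then h y else 0)" for y
  have D: "continuous_on UNIV D"
    using xs unfolding D_def[abs_def]
  proof (induction xs)
    case (Cons p xs)
    then show ?case
      by (cases p; cases "\<phi> (snd p) x0 = x0") (auto intro: continuous_on_add)
  qed simp
  have "diag_coeff (term_op xs) x0 = term_fun xs (gm \<one> x0)"
    using diag_coeff_term_op[OF xs] by (simp add: unit_restrict_def)
  also have "\<dots> = D x0"
    unfolding term_fun_def D_def
  proof (intro arg_cong[of _ _ sum_list] map_cong refl, clarify)
    fix h s assume "(h, s) \<in> set xs"
    then have s: "s \<in> E" "s \<in> carrier G" using xsD by (auto simp: E_def intro: rev_image_eqI)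
    have "gm \<one> x0 \<in> range (gm s) \<longleftrightarrow> \<phi> s x0 = x0"
    proof
      assume "gm \<one> x0 \<in> range (gm s)"
      then show "\<phi> s x0 = x0" using s(2) by (auto simp: gm_eq_iff act_one)
    next
      assume fx: "\<phi> s x0 = x0"
      have "gm \<one> x0 = gm s x0"
        using W[OF s(1)] W_fix[OF s(1)] fx s(2) by (auto simp: gm_eq_iff act_one)
      then show "gm \<one> x0 \<in> range (gm s)" by blast
    qed
    then show "monomial h s (gm \<one> x0) = (if \<phi> s x0 = x0 then h x0 else 0)"
      by (simp add: monomial_def rng_gm act_one)
  qed
  finally have "cmod (D x0) \<le> e" using small[OF x0(1)] by simp
  \<comment> \<open>At \<open>x0\<close> the value is at most \<open>e\<close>; the factor 2 leaves
    room for a strict inequality on a neighbourhood.\<close>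
  define V where "V = {y. cmod (D y) < 2 * e} \<inter> (\<Inter>s\<in>E. W s)"
  have V_open: "open V"
    unfolding V_def using E(1) W(1)
    by (intro open_Int open_INT open_Collect_less continuous_on_norm D continuous_on_const) auto
  have V_x0: "x0 \<in> V" using W(2) \<open>cmod (D x0) \<le> e\<close> e by (auto simp: V_def)
  let ?A = "{\<gamma>\<in>germs G \<phi>. rng \<gamma> \<in> V}"
  have coeff: "Rep_ell2 (term_op xs (restr ?A \<xi>)) \<gamma> = D (rng \<gamma>) * Rep_ell2 \<xi> \<gamma>"
    if \<gamma>: "\<gamma> \<in> ?A" for \<xi> \<gamma>
  proof -
    have "germ_weight h \<gamma> * Rep_ell2 (restr ?A \<xi>) (lact (inv s) \<gamma>) =
        (if \<phi> s x0 = x0 then h (rng \<gamma>) else 0) * Rep_ell2 \<xi> \<gamma>" if "(h, s) \<in> set xs" for h s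
    proof -
      have s: "s \<in> E" "s \<in> carrier G" using that xsD by (auto simp: E_def intro: rev_image_eqI)
      show ?thesis
      proof (cases "\<phi> s x0 = x0")
        case True
        obtain g where g: "g \<in> carrier G" "\<gamma> = gm g (src \<gamma>)" using \<gamma> germsE[of \<gamma>] by blast
        have rng: "rng \<gamma> = \<phi> g (src \<gamma>)" using g rng_gm by metis
        have fixV: "\<phi> (inv s) y = y" if "y \<in> V" for y
          using W_fix[OF s(1) True, of y] that s act_inv_left[OF s(2), of y] by (auto simp: V_def)
        have "open (\<phi> g -` V)" using cont[OF g(1)] V_open by (auto intro: open_vimage)
        \<comment> \<open>\<open>s\<close> fixes \<open>V\<close> pointwise, so translating a germ
          with range in \<open>V\<close> does not change it as a germ: this term acts by
          multiplication.\<close>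
        then have "gm (inv s \<otimes> g) z = gm g z" if "\<phi> g z \<in> V" for z
          using g(1) s fixV that unfolding gm_eq_iff[OF m_closed[OF inv_closed[OF s(2)] g(1)] g(1)]
          by (intro conjI refl exI[of _ "\<phi> g -` V"]) (simp_all add: act_mult)
        then have "gm (inv s \<otimes> g) (src \<gamma>) = gm g (src \<gamma>)" using \<gamma> rng by simp
        then have "lact (inv s) \<gamma> = \<gamma>" using g s lact_gm by (metis inv_closed)
        then show ?thesis using \<gamma> True by (simp add: germ_weight_def ell2_reps)
      next
        case False
        \<comment> \<open>An element that moves \<open>W s\<close> off itself carries no germ with
          range in \<open>V\<close> to another such germ, so the compression kills the term.\<close>
        have "rng (lact (inv s) \<gamma>) \<notin> V"
        proof
          assume "rng (lact (inv s) \<gamma>) \<in> V"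
          then have "\<phi> (inv s) (rng \<gamma>) \<in> W s" using \<gamma> s by (auto simp: lact_germs V_def)
          then have "rng \<gamma> \<notin> W s" using W_move[OF s(1) False] s(2) act_inv_right by metis
          then show False using \<gamma> s(1) by (auto simp: V_def)
        qed
        then show ?thesis using False by (simp add: ell2_reps)
      qed
    qed
    then have "Rep_ell2 (term_op xs (restr ?A \<xi>)) \<gamma> =
        (\<Sum>(h, s)\<leftarrow>xs. (if \<phi> s x0 = x0 then h (rng \<gamma>) else 0) * Rep_ell2 \<xi> \<gamma>)"
      unfolding term_op_coeff[OF xs] by (intro arg_cong[of _ _ sum_list] map_cong refl) auto
    also have "\<dots> = D (rng \<gamma>) * Rep_ell2 \<xi> \<gamma>"
      unfolding D_def by (simp add: sum_list_mult_const[symmetric] case_prod_unfold)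
    finally show ?thesis .
  qed
  have "norm (restr ?A (term_op xs (restr ?A \<xi>))) \<le> 2 * e * norm \<xi>" for \<xi>
  proof (rule norm_ell2_dominated)
    fix \<gamma>
    show "cmod (Rep_ell2 (restr ?A (term_op xs (restr ?A \<xi>))) \<gamma>) \<le> 2 * e * cmod (Rep_ell2 \<xi> \<gamma>)"
    proof (cases "\<gamma> \<in> ?A")
      case True
      then have "cmod (D (rng \<gamma>)) \<le> 2 * e" by (auto simp: V_def)
      then show ?thesis
        unfolding restr.rep_eq if_P[OF True] coeff[OF True] norm_mult by (rule mult_right_mono) simp
    next
      case False
      then show ?thesis unfolding restr.rep_eq if_not_P[OF False] using e by simp
    qed
  qed (use e in simp)
  then show ?thesis using that[of V] V_open V_x0 by blast
qed

text \<open>Each conjugate is tested on a pair of vectors and split by the projection onto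
  \<open>A\<close>. The compressed part is small for every \<open>g\<close>; the two remaining parts
  contain the mass of a translated vector outside \<open>A\<close>, which is small only after
  averaging.\<close>

lemma average_small:
  assumes bd: "boundary_action G \<phi>" and xs: "valid_terms xs" and S: "meager S" and e: "e > 0"
    and small: "\<And>x. x \<notin> S \<Longrightarrow> cmod (diag_coeff (term_op xs) x) \<le> e"
  obtains F t where "finite F" "F \<subseteq> carrier G" "\<And>g. g \<in> F \<Longrightarrow> t g \<ge> 0" "sum t F = 1"
    "norm (\<Sum>g\<in>F. t g *\<^sub>R (u (inv g) o\<^sub>L term_op xs o\<^sub>L u g)) \<le> 4 * e"
proof -
  define T where "T = term_op xs"
  obtain V where V: "open V" "V \<noteq> {}"
    "\<And>\<xi>. norm (restr {\<gamma>\<in>germs G \<phi>. rng \<gamma> \<in> V} (T (restr {\<gamma>\<in>germs G \<phi>. rng \<gamma> \<in> V} \<xi>)))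
       \<le> 2 * e * norm \<xi>"
    using compression_small[OF xs S e small] unfolding T_def by blast
  define A where "A = {\<gamma>\<in>germs G \<phi>. rng \<gamma> \<in> V}"
  \<comment> \<open>Chosen so that \<open>norm T * r \<le> e\<close>; the summand 1 covers
    \<open>T = 0\<close>. The indicators are averaged below \<open>r\<^sup>2\<close> because they
    control squared norms.\<close>
  define r where "r = e / (norm T + 1)"
  have T1: "norm T + 1 > 0" by (simp add: add_nonneg_pos)
  have r: "r > 0" "norm T * r \<le> e"
    using e T1 by (simp_all add: r_def pos_divide_le_eq algebra_simps)
  obtain F t where F: "finite F" "F \<subseteq> carrier G" "\<forall>g\<in>F. t g \<ge> 0" "sum t F = 1"
    and avg: "\<And>x. (\<Sum>g\<in>F. t g * indicator (\<phi> g -` (- V)) x) \<le> r\<^sup>2"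
    by (rule boundary_action_uniform_averaging[OF bd V(1,2) zero_less_power[OF r(1)]]) blast
  define q where "q \<xi> g = norm (restr (- A) (u g \<xi>))" for \<xi> g
  have q_mean: "(\<Sum>g\<in>F. t g * q \<xi> g) \<le> r * norm \<xi>" for \<xi>
  proof (rule weighted_mean_le_rms)
    define B where "B g = {\<gamma>\<in>germs G \<phi>. \<phi> g (rng \<gamma>) \<notin> V}" for g
    have "q \<xi> g \<le> norm (restr (B g) \<xi>)" if g: "g \<in> F" for g
    proof -
      have g: "g \<in> carrier G" using g F(2) by blast
      \<comment> \<open>Translating first and then cutting outside \<open>A\<close> is cutting at
        the germs whose range \<open>g\<close> carries outside \<open>V\<close>, and then
        translating.\<close>
      have "restr (- A) (u g \<xi>) = u g (restr (B g) \<xi>)"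
      proof (rule ell2_eqI)
        fix \<gamma>
        show "Rep_ell2 (restr (- A) (u g \<xi>)) \<gamma> = Rep_ell2 (u g (restr (B g) \<xi>)) \<gamma>"
          using g by (cases "\<gamma> \<in> germs G \<phi>")
            (simp_all add: restr.rep_eq monomial_op_apply germ_weight_def A_def B_def lact_germs act_inv_right)
      qed
      then show ?thesis using norm_u_apply[OF g] by (simp add: q_def)
    qed
    then have "(\<Sum>g\<in>F. t g * (q \<xi> g)\<^sup>2) \<le> (\<Sum>g\<in>F. t g * (norm (restr (B g) \<xi>))\<^sup>2)"
      using F(3) by (intro sum_mono mult_left_mono power_mono) (auto simp: q_def)
    also have "\<dots> \<le> r\<^sup>2 * (norm \<xi>)\<^sup>2"
    proof (rule sum_norm_restr_le)
      fix \<gamma>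
      have "(\<Sum>g\<in>F. t g * indicator (B g) \<gamma>) \<le> (\<Sum>g\<in>F. t g * indicator (\<phi> g -` (- V)) (rng \<gamma>))"
        using F(3) by (intro sum_mono mult_left_mono) (auto simp: B_def indicator_def)
      then show "(\<Sum>g\<in>F. t g * indicator (B g) \<gamma>) \<le> r\<^sup>2" using avg by (rule order_trans)
    qed (use F(3) in auto)
    finally show "(\<Sum>g\<in>F. t g * (q \<xi> g)\<^sup>2) \<le> (r * norm \<xi>)\<^sup>2" by (simp add: power_mult_distrib)
  qed (use F r in auto)
  define b where "b = (\<Sum>g\<in>F. t g *\<^sub>R (u (inv g) o\<^sub>L T o\<^sub>L u g))"
  have term_le: "inner (T \<xi>) \<eta> \<le> 2 * e * norm \<xi> * norm \<eta> +
      norm T * norm \<xi> * norm (restr (- A) \<eta>) + norm T * norm (restr (- A) \<xi>) * norm \<eta>" for \<xi> \<eta>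
  proof -
    have "inner (T \<xi>) \<eta> = inner (T (restr A \<xi>) + T (restr (- A) \<xi>)) \<eta>"
      by (simp flip: restr_split blinfun.add_right)
    also have "\<dots> = inner (T (restr A \<xi>)) (restr A \<eta> + restr (- A) \<eta>) + inner (T (restr (- A) \<xi>)) \<eta>"
      by (simp add: inner_add_left flip: restr_split)
    also have "\<dots> = inner (restr A (T (restr A \<xi>))) \<eta> + inner (T (restr A \<xi>)) (restr (- A) \<eta>) +
        inner (T (restr (- A) \<xi>)) \<eta>"
      by (simp add: inner_add_right inner_restr)
    also have "inner (restr A (T (restr A \<xi>))) \<eta> \<le> (2 * e * norm \<xi>) * norm \<eta>"
      using V(3)[of \<xi>] unfolding A_def[symmetric]
      by (intro order_trans[OF norm_cauchy_schwarz] mult_right_mono) auto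
    also have "inner (T (restr A \<xi>)) (restr (- A) \<eta>) \<le> (norm T * norm \<xi>) * norm (restr (- A) \<eta>)"
      by (intro order_trans[OF norm_cauchy_schwarz] mult_right_mono order_trans[OF norm_blinfun]
          mult_left_mono norm_restr_le) auto
    also have "inner (T (restr (- A) \<xi>)) \<eta> \<le> (norm T * norm (restr (- A) \<xi>)) * norm \<eta>"
      by (intro order_trans[OF norm_cauchy_schwarz] mult_right_mono norm_blinfun) auto
    finally show ?thesis by simp
  qed
  have bound: "inner (b \<xi>) \<eta> \<le> 4 * e * norm \<xi> * norm \<eta>" for \<xi> \<eta>
  proof -
    have "inner (b \<xi>) \<eta> = (\<Sum>g\<in>F. t g * inner (T (u g \<xi>)) (u g \<eta>))"
      unfolding b_def blinfun.sum_left inner_sum_left using F(2)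
      by (intro sum.cong refl) (auto simp: blinfun.scaleR_left inner_u)
    also have "\<dots> \<le> (\<Sum>g\<in>F. t g * (2 * e * norm \<xi> * norm \<eta> + norm T * norm \<xi> * q \<eta> g + norm T * q \<xi> g * norm \<eta>))"
    proof (intro sum_mono mult_left_mono)
      fix g assume g: "g \<in> F"
      then have gc: "g \<in> carrier G" using F(2) by blast
      note n = norm_u_apply[OF gc]
      have "inner (T (u g \<xi>)) (u g \<eta>) \<le> 2 * e * norm (u g \<xi>) * norm (u g \<eta>) +
          norm T * norm (u g \<xi>) * q \<eta> g + norm T * q \<xi> g * norm (u g \<eta>)"
        unfolding q_def by (rule term_le)
      also have "\<dots> \<le> 2 * e * norm \<xi> * norm \<eta> + norm T * norm \<xi> * q \<eta> g + norm T * q \<xi> g * norm \<eta>"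
        using e by (intro add_mono mult_mono n mult_nonneg_nonneg) (auto simp: q_def)
      finally show "inner (T (u g \<xi>)) (u g \<eta>) \<le> 2 * e * norm \<xi> * norm \<eta> +
          norm T * norm \<xi> * q \<eta> g + norm T * q \<xi> g * norm \<eta>" .
      show "0 \<le> t g" using g F(3) by blast
    qed
    also have "\<dots> = 2 * e * norm \<xi> * norm \<eta> * sum t F + norm T * norm \<xi> * (\<Sum>g\<in>F. t g * q \<eta> g) +
        norm T * norm \<eta> * (\<Sum>g\<in>F. t g * q \<xi> g)"
      unfolding sum_distrib_left sum.distrib[symmetric] by (intro sum.cong refl) (simp add: algebra_simps)
    also have "\<dots> \<le> 2 * e * norm \<xi> * norm \<eta> * 1 + norm T * norm \<xi> * (r * norm \<eta>) + norm T * norm \<eta> * (r * norm \<xi>)"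
      unfolding F(4) by (intro add_mono mult_left_mono q_mean order_refl) auto
    also have "\<dots> = 2 * e * norm \<xi> * norm \<eta> + 2 * ((norm T * r) * (norm \<xi> * norm \<eta>))"
      by (simp add: algebra_simps)
    \<comment> \<open>The final constant 4 is 2 from the compression and 1 from each of the two
      remaining parts.\<close>
    also have "\<dots> \<le> 2 * e * norm \<xi> * norm \<eta> + 2 * (e * (norm \<xi> * norm \<eta>))"
      using r(2) by (intro add_left_mono mult_left_mono mult_right_mono) auto
    finally show ?thesis by (simp add: algebra_simps)
  qed
  have "norm b \<le> 4 * e"
  proof (rule norm_blinfun_bound)
    fix \<xi>
    have "norm (b \<xi>) * norm (b \<xi>) \<le> (4 * e * norm \<xi>) * norm (b \<xi>)"
      using bound[of \<xi> "b \<xi>"] by (simp add: power2_norm_eq_inner[symmetric] power2_eq_square)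
    then show "norm (b \<xi>) \<le> 4 * e * norm \<xi>"
      using e by (cases "norm (b \<xi>) = 0") (auto simp: mult_le_cancel_right)
  qed (use e in simp)
  then show ?thesis using that[of F t] F unfolding b_def T_def by blast
qed

theorem Cred_average_small:
  assumes bd: "boundary_action G \<phi>" and a: "a \<in> CR" and m: "meager {x. diag_coeff a x \<noteq> 0}" and e: "e > 0"
  obtains F t where "finite F" "F \<subseteq> carrier G" "\<And>g. g \<in> F \<Longrightarrow> t g \<ge> 0" "sum t F = 1"
    "norm (\<Sum>g\<in>F. t g *\<^sub>R (u (inv g) o\<^sub>L a o\<^sub>L u g)) < e"
proof -
  \<comment> \<open>Approximation costs \<open>d\<close> and averaging the approximant costs
    \<open>4 * d\<close>; five sixths of \<open>e\<close> leave a strict inequality.\<close>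
  define d where "d = e / 6"
  have d: "d > 0" using e by (simp add: d_def)
  obtain xs where xs: "\<And>n. valid_terms (xs n)" "(\<lambda>n. term_op (xs n)) \<longlonglongrightarrow> a" using a by (rule CredE) blast
  have "\<forall>\<^sub>F n in sequentially. dist (term_op (xs n)) a < d" using xs(2) d by (rule tendstoD)
  then obtain n where n: "norm (term_op (xs n) - a) < d"
    using eventually_happens'[OF sequentially_bot] by (auto simp: dist_norm)
  define T where "T = term_op (xs n)"
  have "cmod (diag_coeff T x) \<le> d" if "x \<notin> {x. diag_coeff a x \<noteq> 0}" for x
    using diag_coeff_le[of "T - a" x] n that by (simp add: diag_coeff_diff T_def)
  then obtain F t where F: "finite F" "F \<subseteq> carrier G" "\<And>g. g \<in> F \<Longrightarrow> t g \<ge> 0" "sum t F = 1"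
    and le: "norm (\<Sum>g\<in>F. t g *\<^sub>R (u (inv g) o\<^sub>L T o\<^sub>L u g)) \<le> 4 * d"
    using average_small[OF bd xs(1) m d] unfolding T_def by blast
  have "norm (\<Sum>g\<in>F. t g *\<^sub>R (u (inv g) o\<^sub>L (a - T) o\<^sub>L u g)) \<le> (\<Sum>g\<in>F. t g * d)"
  proof (rule sum_norm_le)
    fix g assume g: "g \<in> F"
    then have gc: "g \<in> carrier G" "inv g \<in> carrier G" using F(2) by auto
    have "norm (u (inv g) o\<^sub>L (a - T) o\<^sub>L u g) \<le> (norm (u (inv g)) * norm (a - T)) * norm (u g)"
      by (intro order_trans[OF norm_blinfun_compose] mult_right_mono norm_blinfun_compose) auto
    also have "\<dots> \<le> (1 * d) * 1"
      using n gc d by (intro mult_mono norm_u) (auto simp: T_def norm_minus_commute)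
    finally show "norm (t g *\<^sub>R (u (inv g) o\<^sub>L (a - T) o\<^sub>L u g)) \<le> t g * d"
      using F(3)[OF g] by (simp add: mult_left_mono)
  qed
  also have "\<dots> = d" using F(4) by (simp flip: sum_distrib_right)
  finally have "norm (\<Sum>g\<in>F. t g *\<^sub>R (u (inv g) o\<^sub>L (a - T) o\<^sub>L u g)) \<le> d" .
  moreover have "(\<Sum>g\<in>F. t g *\<^sub>R (u (inv g) o\<^sub>L a o\<^sub>L u g)) =
      (\<Sum>g\<in>F. t g *\<^sub>R (u (inv g) o\<^sub>L (a - T) o\<^sub>L u g)) + (\<Sum>g\<in>F. t g *\<^sub>R (u (inv g) o\<^sub>L T o\<^sub>L u g))"
    by (simp add: bounded_bilinear.diff_left[OF bounded_bilinear_blinfun_compose]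
          bounded_bilinear.diff_right[OF bounded_bilinear_blinfun_compose] scaleR_diff_right sum_subtractf)
  ultimately have "norm (\<Sum>g\<in>F. t g *\<^sub>R (u (inv g) o\<^sub>L a o\<^sub>L u g)) \<le> d + 4 * d"
    using norm_triangle_mono[OF _ le] by (simp only:)
  also have "\<dots> < e" using e by (simp add: d_def)
  finally show ?thesis using that F by blast
qed

theorem relative_powers:
  assumes bd: "boundary_action G \<phi>"
  shows "relative_powers_averaging G \<phi>"
  unfolding relative_powers_averaging_def
proof (intro ballI impI)
  fix A assume "A \<in> Cess G \<phi>" and E0: "E_ess G \<phi> A = dix_class (\<lambda>_. 0)"
  then obtain a where a: "a \<in> CR" "A = coset a" by (auto simp: Cess_def)
  let ?conj = "\<lambda>g. ess_mult G \<phi> (ess_mult G \<phi> (ess_rep G \<phi> g) A) (ess_adj G \<phi> (ess_rep G \<phi> g))"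
  \<comment> \<open>\<open>E_ess\<close> takes the unique element of an image, so it has a
    meaningful value only once the expectation is constant on the coset. Two representatives have
    the same unit columns off a meager set.\<close>
  have "E_red G \<phi> b = dix_class (diag_coeff a)" if b: "b \<in> coset a" for b
  proof -
    have bC: "b \<in> CR" by (rule coset_Cred[OF a(1) b])
    have "meager {x. (b - a) (ket (gm \<one> x)) \<noteq> 0}" using b by (simp add: coset_mem ess_ideal_iff)
    then have "meager {x. diag_coeff b x \<noteq> diag_coeff a x}"
    proof (rule meager_subset, safe)
      fix x assume "diag_coeff b x \<noteq> diag_coeff a x" "(b - a) (ket (gm \<one> x)) = 0"
      then show False using diag_coeff_diff[of b a x] by (simp add: diag_coeff_def[of "b - a"] ell2_reps)
    qed
    then show ?thesis using E_red_eq[OF bC] dix_class_eq_iff[OF diag_coeff_bounded_borel[OF bC] diag_coeff_bounded_borel[OF a(1)]]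
      by simp
  qed
  then have "E_red G \<phi> ` coset a = {dix_class (diag_coeff a)}" using coset_self[of a] by (auto simp: image_iff)
  then have "dix_class (diag_coeff a) = dix_class (\<lambda>_. 0)" using E0 by (simp add: E_ess_def a(2))
  then have m: "meager {x. diag_coeff a x \<noteq> 0}"
    by (simp add: dix_class_eq_iff[OF diag_coeff_bounded_borel[OF a(1)] zero_bounded_borel])
  have conj: "?conj g = coset (u g o\<^sub>L a o\<^sub>L u (inv g))" if "g \<in> carrier G" for g
    using that a by (simp add: ess_rep_eq ess_mult_coset ess_adj_coset Cred_u Cred_mult u_adj)
  show "coset 0 \<in> ess_closure G \<phi> (ess_convex G \<phi> hull {?conj g | g. g \<in> carrier G})"
    unfolding ess_closure_def
  proof (intro CollectI conjI allI impI)
    show "coset 0 \<in> Cess G \<phi>" by (rule coset_Cess[OF Cred_0])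
    fix e :: real assume e: "e > 0"
    obtain F t where F: "finite F" "F \<subseteq> carrier G" "\<And>g. g \<in> F \<Longrightarrow> t g \<ge> 0" "sum t F = 1"
      and le: "norm (\<Sum>g\<in>F. t g *\<^sub>R (u (inv g) o\<^sub>L a o\<^sub>L u g)) < e"
      using Cred_average_small[OF bd a(1) m e] by blast
    let ?b = "\<Sum>g\<in>F. t g *\<^sub>R (u (inv g) o\<^sub>L a o\<^sub>L u g)"
    show "\<exists>B\<in>ess_convex G \<phi> hull {?conj g | g. g \<in> carrier G}.
        ess_norm (ess_add G \<phi> B (ess_scaleR G \<phi> (- 1) (coset 0))) < e"
    proof (rule bexI)
      have "ess_norm (coset ?b) < e" using ess_norm_coset_le le by (rule order.strict_trans1)
      then show "ess_norm (ess_add G \<phi> (coset ?b) (ess_scaleR G \<phi> (- 1) (coset 0))) < e"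
        by (simp add: ess_add_coset ess_scaleR_coset)
      show "coset ?b \<in> ess_convex G \<phi> hull {?conj g | g. g \<in> carrier G}"
        unfolding hull_def
      proof (intro InterI, clarify)
        fix T assume T: "ess_convex G \<phi> T" "{?conj g | g. g \<in> carrier G} \<subseteq> T"
        have "F \<noteq> {}" using F(4) by auto
        show "coset ?b \<in> T"
        proof (rule ess_convex_sum[OF T(1) F(1) \<open>F \<noteq> {}\<close> _ F(3,4)])
          fix g assume "g \<in> F"
          then have g: "inv g \<in> carrier G" "inv (inv g) = g" using F(2) by auto
          \<comment> \<open>The averages carry the inverse on the left, so the member of the
            conjugation orbit to be used is the one at \<open>inv g\<close>.\<close>
          have "?conj (inv g) \<in> T" using T(2) g(1) by blast
          then show "coset (u (inv g) o\<^sub>L a o\<^sub>L u g) \<in> T" unfolding conj[OF g(1)] g(2) .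
        qed
      qed
    qed
  qed
qed

end

theorem theoremG:
  fixes G :: "('g, 'm) monoid_scheme" and \<phi> :: "'g \<Rightarrow> 'x::t2_space \<Rightarrow> 'x"
  assumes "countable (carrier G)" and "boundary_action G \<phi>"
  shows "relative_powers_averaging G \<phi>"
proof -
  interpret group_action G UNIV \<phi> using assms(2) by (simp add: boundary_action_def)
  interpret countable_compact_action G \<phi>
    by standard (use assms in \<open>auto simp: boundary_action_def\<close>)
  show ?thesis by (rule relative_powers[OF assms(2)])
qed

end
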